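(* Let $(X,\mu)$ be a computable probability space and let $T:X\to X$ be a $\delta$ a.e.-computable transformation preserving $\mu$. Suppose $(X,T,\mu)$ is $\ln^2$-ergodic for observables in some set $\mathcal B$ of bounded functions, and let $\phi\in\mathcal B$ be a $\delta$ a.e.-computable observable. Then the set of points $x\in X$ which are typical with respect to $\phi$, i.e. such that $$\lim_{n\to\infty}\frac1n\sum_{i=0}^{n-1}\phi(T^i(x))=\int\phi\,d\mu,$$ contains a constructive Borel–Cantelli set. In particular, if $X$ is complete, it contains computable points.
   Context: Computability on $\mathbb N$ refers to (partial) recursive functions; an algorithm between effectively numbered countable sets ($\mathbb N$, $\mathbb Q$, the sets $S,\mathcal B^X,D$ below) is a map induced by a partial recursive function on numbers. A real $x$ is computable if there is an algorithm $\mathcal A:\mathbb N\to\mathbb Q$ with $|\mathcal A(n)-x|\le 2^{-n}$ for all $n$. Objects $O_i$ are computable (constructive, ...) uniformly in $i$ if a single algorithm, taking $i$ as an additional input, witnesses this for all $i$. A computable metric space (CMS) is a triple $(X,d,S)$ where $(X,d)$ is a separable metric space, $S=\{s_i\}_{i\in\mathbb N}$ is a countable dense subset (ideal points), and the reals $d(s_i,s_j)$ are computable uniformly in $i,j$. $\mathbb R$ is a CMS with ideal points $\mathbb Q$. A point $x\in X$ is computable if there is an algorithm $\mathcal A:\mathbb N\to S$ with $d(\mathcal A(n),x)\le 2^{-n}$ for all $n$. Ideal balls are the balls $B(s,q)$ with $s\in S$, $q\in\mathbb Q_{>0}$; their set $\mathcal B^X=\{B_0^X,B_1^X,\dots\}$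 is numbered so that number and (center, radius) are computable from one another. An open set $U$ is constructive if there is a (possibly partial) algorithm $\mathcal A:\mathbb N\to\mathcal B^X$ with $U=\bigcup_n\mathcal A(n)$ (undefined values contribute nothing). A constructive $G_\delta$-set is an intersection of a sequence of uniformly constructive open sets. A function $f:X\to Y$ between CMS's is computable on $E\subseteq X$ if there are uniformly constructive open sets $U_i\subseteq X$ with $f^{-1}(B_i^Y)\cap E=U_i\cap E$ for all $i$. The space of Borel probability measures on $X$ carries the Prokhorov metric $\rho(\mu,\nu)=\inf\{\epsilon>0:\mu(A)\le\nu(A^\epsilon)+\epsilon\text{ for every Borel }A\}$, $A^\epsilon=\{x:d(x,A)<\epsilon\}$. Let $D$ be the set of probability measures supported on finitely many points of $S$ with rational weights (effectively numbered). $\mu$ is computable if there is an algorithm producing $\mu_n\in D$ with $\rho(\mu_n,\mu)\le 2^{-n}$ for all $n$. A computable probability space is a pair $(X,\mu)$ with $X$ a CMS and $\mu$ a computable Borel probability measure on $X$. A (measurable) function $f:(X,\mu)\to Y$ is $\delta$ a.e.-computable if it is computable on some constructive $G_\delta$-set of $\mu$-measure one. A sequence $(a_i)$ of non-negative reals is effectively summable if there is an algorithm $A:\mathbb Q_{>0}\to\mathbb N$ such that $A(\epsilon)=n$ implies $\sum_{i\ge n}a_i\le\epsilon$. A constructive Borel–Cantelli set is a set $\bigcup_k\bigcap_{n\ge k}U_n$, where $(U_n)$ is a sequence of uniformly constructive open sets such that $(\mu(X\setminus U_n))_n$ is effectively summable. $(X,T,\mu)$ is $\ln^2$-ergodic for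 observables in a set $\mathcal B$ of real functions on $X$ if for each $(\phi,\psi)\in\mathcal B^2$ there is $c_{\phi,\psi}>0$ such that $\left|\frac1n\sum_{i<n}\int(\phi\circ T^i)\,\psi\,d\mu-\int\phi\,d\mu\int\psi\,d\mu\right|\le\frac{c_{\phi,\psi}}{(\ln n)^2}$ for all $n\ge2$. *)

theory Defs
  imports "HOL-Probability.Probability" "HOL-Library.Nat_Bijection" "HOL-Library.Countable"
begin

section \<open>Partial recursive functions\<close>

datatype recf =
    Zero
  | Succ
  | Proj nat
  | Comp recf "recf list"
  | PrimRec recf recf
  | Mu recf

text \<open>
  \<open>evals r xs y\<close>: the algorithm \<open>r\<close> halts on the arguments \<open>xs\<close> with output \<open>y\<close>. No arities are
  recorded; on argument lists of any fixed length \<open>k\<close> the codes \<open>r\<close> induce exactly the \<open>k\<close>-ary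
  partial recursive functions.
\<close>

inductive evals :: "recf \<Rightarrow> nat list \<Rightarrow> nat \<Rightarrow> bool" where
  evals_Zero: "evals Zero xs 0"
| evals_Succ: "evals Succ (x # xs) (Suc x)"
| evals_Proj: "i < length xs \<Longrightarrow> evals (Proj i) xs (xs ! i)"
| evals_Comp: "list_all2 (\<lambda>g y. evals g xs y) gs ys \<Longrightarrow> evals f ys z \<Longrightarrow> evals (Comp f gs) xs z"
| evals_PrimRec_0: "evals f xs y \<Longrightarrow> evals (PrimRec f g) (0 # xs) y"
| evals_PrimRec_Suc:
    "evals (PrimRec f g) (n # xs) y \<Longrightarrow> evals g (n # y # xs) z \<Longrightarrow>
     evals (PrimRec f g) (Suc n # xs) z"
| evals_Mu:
    "evals f (n # xs) 0 \<Longrightarrow> (\<forall>m<n. \<exists>y. evals f (m # xs) (Suc y)) \<Longrightarrow> evals (Mu f) xs n"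

lemma evals_deterministic:
  assumes "evals r xs y" "evals r xs z"
  shows "y = z"
  using assms
proof (induction arbitrary: z rule: evals.induct)
  case (evals_Zero xs)
  then show ?case by (auto elim: evals.cases)
next
  case (evals_Succ x xs)
  then show ?case by (auto elim: evals.cases)
next
  case (evals_Proj i xs)
  from evals_Proj.prems show ?case by (cases rule: evals.cases) auto
next
  case (evals_Comp xs gs ys f z')
  from evals_Comp.prems obtain ys' where
    ys': "list_all2 (\<lambda>g y. evals g xs y) gs ys'" and z: "evals f ys' z"
    by (cases rule: evals.cases) auto
  have "ys = ys'"
    using evals_Comp.IH(1) ys' by (auto simp: list_all2_conv_all_nth intro!: nth_equalityI)
  with z evals_Comp.IH(2) show ?case by simp
next
  case (evals_PrimRec_0 f xs y g)
  from evals_PrimRec_0.prems show ?case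
    by (cases rule: evals.cases) (auto dest: evals_PrimRec_0.IH)
next
  case (evals_PrimRec_Suc f g n xs y z')
  from evals_PrimRec_Suc.prems obtain y' where
    "evals (PrimRec f g) (n # xs) y'" "evals g (n # y' # xs) z"
    by (cases rule: evals.cases) auto
  with evals_PrimRec_Suc.IH show ?case by blast
next
  case (evals_Mu f n xs)
  from evals_Mu.prems have z: "evals f (z # xs) 0" "\<forall>m<z. \<exists>y. evals f (m # xs) (Suc y)"
    by (cases rule: evals.cases; auto)+
  have "\<not> z < n" using z(1) evals_Mu.IH(2) by fastforce
  moreover have "\<not> n < z" using z(2) evals_Mu.IH(1) by fastforce
  ultimately show ?case by simp
qed


section \<open>Numberings\<close>

text \<open>Numberings may list an element several times; each of them is effectively surjective.\<close>

definition rat_number :: "nat \<Rightarrow> real" where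
  "rat_number k = real_of_rat (nat_to_rat_surj k)"

definition pos_rat_number :: "nat \<Rightarrow> real" where
  "pos_rat_number k = (case prod_decode k of (a, b) \<Rightarrow> real (Suc a) / real (Suc b))"

lemma range_rat_number: "range rat_number = \<rat>"
  using surj_nat_to_rat_surj unfolding rat_number_def Rats_def
  by (metis image_image)

lemma range_pos_rat_number: "range pos_rat_number = {q \<in> \<rat>. q > 0}"
proof (intro equalityI subsetI)
  fix q assume "q \<in> range pos_rat_number"
  then show "q \<in> {q \<in> \<rat>. q > 0}"
    by (auto simp: pos_rat_number_def split: prod.splits simp del: of_nat_Suc)
next
  fix q :: real assume "q \<in> {q \<in> \<rat>. q > 0}"
  then have "q \<in> \<rat>" "q > 0" by auto
  then obtain m n :: nat where mn: "n \<noteq> 0" "\<bar>q\<bar> = real m / real n"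
    by (auto elim!: Rats_abs_nat_div_natE)
  then have "m \<noteq> 0" using \<open>q > 0\<close> by (cases m) auto
  then obtain a b where "m = Suc a" "n = Suc b" using mn by (meson not0_implies_Suc)
  with mn \<open>q > 0\<close> have "q = pos_rat_number (prod_encode (a, b))"
    by (simp add: pos_rat_number_def)
  then show "q \<in> range pos_rat_number" by blast
qed

definition ideal_ball :: "(nat \<Rightarrow> 'a::metric_space) \<Rightarrow> nat \<Rightarrow> 'a set" where
  "ideal_ball s k = (case prod_decode k of (i, j) \<Rightarrow> ball (s i) (pos_rat_number j))"


section \<open>Computable metric spaces\<close>

text \<open>
  The underlying space is the type \<open>'a\<close>, and \<open>s\<close> is the numbering of the ideal points.
\<close>

definition computable_metric_space :: "(nat \<Rightarrow> 'a::metric_space) \<Rightarrow> bool" where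
  "computable_metric_space s \<longleftrightarrow>
     closure (range s) = UNIV \<and>
     (\<exists>r. \<forall>i j n. \<exists>k. evals r [i, j, n] k \<and> \<bar>rat_number k - dist (s i) (s j)\<bar> \<le> (1/2) ^ n)"

definition computable_point :: "(nat \<Rightarrow> 'a::metric_space) \<Rightarrow> 'a \<Rightarrow> bool" where
  "computable_point s x \<longleftrightarrow> (\<exists>r. \<forall>n. \<exists>i. evals r [n] i \<and> dist (s i) x \<le> (1/2) ^ n)"

definition uniformly_constructive_open ::
  "(nat \<Rightarrow> 'a::metric_space) \<Rightarrow> (nat \<Rightarrow> 'a set) \<Rightarrow> bool" where
  "uniformly_constructive_open s U \<longleftrightarrow>
     (\<exists>r. \<forall>i. U i = (\<Union>k \<in> {k. \<exists>n. evals r [i, n] k}. ideal_ball s k))"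

definition constructive_gdelta :: "(nat \<Rightarrow> 'a::metric_space) \<Rightarrow> 'a set \<Rightarrow> bool" where
  "constructive_gdelta s G \<longleftrightarrow> (\<exists>U. uniformly_constructive_open s U \<and> G = (\<Inter>i. U i))"

definition computable_on ::
  "(nat \<Rightarrow> 'a::metric_space) \<Rightarrow> (nat \<Rightarrow> 'b::metric_space) \<Rightarrow> ('a \<Rightarrow> 'b) \<Rightarrow> 'a set \<Rightarrow> bool" where
  "computable_on s t f E \<longleftrightarrow>
     (\<exists>U. uniformly_constructive_open s U \<and> (\<forall>i. f -` ideal_ball t i \<inter> E = U i \<inter> E))"


section \<open>Computable probability spaces\<close>

text \<open>Since the distance to the empty set is infinite, whereas \<open>infdist x {} = 0\<close>, the
  neighbourhood of the empty set is treated separately.\<close>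

definition set_neighbourhood :: "'a::metric_space set \<Rightarrow> real \<Rightarrow> 'a set" where
  "set_neighbourhood A \<epsilon> = {x. A \<noteq> {} \<and> infdist x A < \<epsilon>}"

definition prokhorov_dist :: "'a::metric_space measure \<Rightarrow> 'a measure \<Rightarrow> real" where
  "prokhorov_dist M N =
     Inf {\<epsilon>. \<epsilon> > 0 \<and> (\<forall>A \<in> sets borel. measure M A \<le> measure N (set_neighbourhood A \<epsilon>) + \<epsilon>)}"

text \<open>
  A number codes a finite list of pairs (ideal point, rational weight). It denotes a finitely
  supported probability measure iff the weights are nonnegative and sum up to 1, which is what
  \<open>pmf_of_list_wf\<close> says.
\<close>

definition weighted_points :: "(nat \<Rightarrow> 'a) \<Rightarrow> nat \<Rightarrow> ('a \<times> real) list" where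
  "weighted_points s k =
     map (\<lambda>c. case prod_decode c of (i, q) \<Rightarrow> (s i, rat_number q)) (list_decode k)"

definition ideal_measure :: "(nat \<Rightarrow> 'a::metric_space) \<Rightarrow> nat \<Rightarrow> 'a measure" where
  "ideal_measure s k = distr (measure_pmf (pmf_of_list (weighted_points s k))) borel (\<lambda>x. x)"

definition computable_measure :: "(nat \<Rightarrow> 'a::metric_space) \<Rightarrow> 'a measure \<Rightarrow> bool" where
  "computable_measure s M \<longleftrightarrow>
     (\<exists>r. \<forall>n. \<exists>k. evals r [n] k \<and> pmf_of_list_wf (weighted_points s k) \<and>
        prokhorov_dist (ideal_measure s k) M \<le> (1/2) ^ n)"

definition computable_prob_space :: "(nat \<Rightarrow> 'a::metric_space) \<Rightarrow> 'a measure \<Rightarrow> bool" where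
  "computable_prob_space s M \<longleftrightarrow>
     computable_metric_space s \<and> prob_space M \<and> sets M = sets borel \<and> computable_measure s M"

definition ae_computable ::
  "(nat \<Rightarrow> 'a::metric_space) \<Rightarrow> 'a measure \<Rightarrow> (nat \<Rightarrow> 'b::metric_space) \<Rightarrow> ('a \<Rightarrow> 'b) \<Rightarrow> bool" where
  "ae_computable s M t f \<longleftrightarrow>
     f \<in> borel_measurable M \<and>
     (\<exists>G. constructive_gdelta s G \<and> measure M G = 1 \<and> computable_on s t f G)"

definition effectively_summable :: "(nat \<Rightarrow> real) \<Rightarrow> bool" where
  "effectively_summable a \<longleftrightarrow>
     (\<forall>i. a i \<ge> 0) \<and> summable a \<and>
     (\<exists>r (A :: real \<Rightarrow> nat).
        (\<forall>k. evals r [k] (A (pos_rat_number k))) \<and>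
        (\<forall>\<epsilon> \<in> \<rat>. \<epsilon> > 0 \<longrightarrow> (\<Sum>i. a (i + A \<epsilon>)) \<le> \<epsilon>))"

definition constructive_borel_cantelli ::
  "(nat \<Rightarrow> 'a::metric_space) \<Rightarrow> 'a measure \<Rightarrow> 'a set \<Rightarrow> bool" where
  "constructive_borel_cantelli s M C \<longleftrightarrow>
     (\<exists>U. uniformly_constructive_open s U \<and> effectively_summable (\<lambda>n. measure M (- U n)) \<and>
        C = (\<Union>k. \<Inter>n\<in>{k..}. U n))"


section \<open>Dynamics\<close>

definition measure_preserving_map :: "'a measure \<Rightarrow> ('a \<Rightarrow> 'a) \<Rightarrow> bool" where
  "measure_preserving_map M T \<longleftrightarrow> T \<in> measurable M M \<and> distr M M T = M"

text \<open>
  The integrability clause makes explicit that the integrals in the definition exist (a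
  non-integrable function would have integral 0 here).
\<close>

definition ln2_ergodic :: "'a measure \<Rightarrow> ('a \<Rightarrow> 'a) \<Rightarrow> ('a \<Rightarrow> real) set \<Rightarrow> bool" where
  "ln2_ergodic M T \<B> \<longleftrightarrow>
     (\<forall>\<phi>\<in>\<B>. \<forall>\<psi>\<in>\<B>.
        integrable M \<phi> \<and> integrable M \<psi> \<and> (\<forall>i. integrable M (\<lambda>x. \<phi> ((T ^^ i) x) * \<psi> x)) \<and>
        (\<exists>c>0. \<forall>n\<ge>2.
           \<bar>(\<Sum>i<n. \<integral>x. \<phi> ((T ^^ i) x) * \<psi> x \<partial>M) / real n - (\<integral>x. \<phi> x \<partial>M) * (\<integral>x. \<psi> x \<partial>M)\<bar>
             \<le> c / (ln (real n))\<^sup>2))"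

definition typical_points :: "'a measure \<Rightarrow> ('a \<Rightarrow> 'a) \<Rightarrow> ('a \<Rightarrow> real) \<Rightarrow> 'a set" where
  "typical_points M T \<phi> =
     {x. (\<lambda>n. (\<Sum>i<n. \<phi> ((T ^^ i) x)) / real n) \<longlonglongrightarrow> (\<integral>x. \<phi> x \<partial>M)}"

end

theory Submission
  imports Defs
begin

text \<open>
  Everything is reduced to two facts: a set of ideal balls is recursively enumerable if it is defined
  by a \<open>\<Sigma>\<^sub>1\<close> formula, and the condition that a constructive open set has measure
  more than \<open>q\<close> is \<open>\<Sigma>\<^sub>1\<close> (it is witnessed by a finitely supported approximation of the
  measure, its points lying in the open set with a margin).

  By \<open>ln\<^sup>2\<close>-ergodicity, the variance of the \<open>n\<close>-th time average is \<open>O(1 / ln\<^sup>2 n)\<close>. Along times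
  that grow just subexponentially, Chebyshev's inequality makes the probabilities of deviations by
  suitable tolerances tending to 0 effectively summable, and since the ratio of successive
  times tends to 1 and the observable is bounded, convergence along these times suffices. The
  events of small deviation, intersected with the stages of the constructive \<open>G\<^sub>\<delta>\<close>-set of points
  whose orbit stays in the domain of computability, form the Borel--Cantelli set.

  A computable point of a Borel--Cantelli set is the limit of a nested sequence of ideal balls, found
  by search, each of which meets the set in positive measure.
\<close>

section \<open>Recursive functions and semidecidable predicates\<close>

text \<open>Both \<open>T\<close> and \<open>\<phi>\<close> are computable only on a constructive
  G-delta set of full measure, so events about averages are open only relative to the points whose
  whole orbit stays there. Each event is therefore given by a code that has the right meaning on
  that set, and measures ignore the rest. Decay of order \<open>1 / (ln n)^2\<close> leaves just
  enough room: along geometric times it gives \<open>1 / k^2\<close>, but a fixed ratio of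
  successive times leaves an oscillation of fixed size between them. Letting the ratio tend to 1 and
  the tolerance to 0 costs a small power of \<open>k\<close>, which \<open>1 / k^2\<close> can
  spare. The ergodicity constant is only known to exist. This is harmless, since the algorithms
  depend on it through two natural numbers, a starting index and a factor in the modulus of
  summability. Algorithms are rarely written down: effective claims are brought into a shape to
  which closure rules for Sigma_1 predicates apply, and unbounded search turns them back into
  codes.\<close>

definition recursive_n :: "nat \<Rightarrow> (nat list \<Rightarrow> nat) \<Rightarrow> bool" where
  "recursive_n k f \<longleftrightarrow> (\<exists>r. \<forall>xs. length xs = k \<longrightarrow> evals r xs (f xs))"

lemma recursive_n_proj: "i < k \<Longrightarrow> recursive_n k (\<lambda>xs. xs ! i)"
  unfolding recursive_n_def using evals_Proj by metis

lemma recursive_n_comp: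
  assumes "recursive_n (length fs) F" "\<forall>f\<in>set fs. recursive_n k f"
  shows "recursive_n k (\<lambda>xs. F (map (\<lambda>f. f xs) fs))"
proof -
  obtain r where r: "\<And>xs. length xs = length fs \<Longrightarrow> evals r xs (F xs)"
    using assms(1) unfolding recursive_n_def by blast
  have "\<forall>f\<in>set fs. \<exists>g. \<forall>xs. length xs = k \<longrightarrow> evals g xs (f xs)"
    using assms(2) unfolding recursive_n_def by blast
  then obtain G where G: "\<And>f xs. f \<in> set fs \<Longrightarrow> length xs = k \<Longrightarrow> evals (G f) xs (f xs)"
    by metis
  have "evals (Comp r (map G fs)) xs (F (map (\<lambda>f. f xs) fs))" if "length xs = k" for xs
    by (rule evals_Comp[where ys = "map (\<lambda>f. f xs) fs"])
      (use that G r in \<open>auto simp: list_all2_conv_all_nth\<close>)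
  then show ?thesis unfolding recursive_n_def by blast
qed

lemma recursive_n_comp1:
  assumes "recursive_n 1 (\<lambda>xs. F (xs ! 0))" "recursive_n k f"
  shows "recursive_n k (\<lambda>xs. F (f xs))"
  using recursive_n_comp[of "[f]" "\<lambda>xs. F (xs ! 0)" k] assms by simp

lemma recursive_n_comp2:
  assumes "recursive_n 2 (\<lambda>xs. F (xs ! 0) (xs ! 1))" "recursive_n k f" "recursive_n k g"
  shows "recursive_n k (\<lambda>xs. F (f xs) (g xs))"
  using recursive_n_comp[of "[f, g]" "\<lambda>xs. F (xs ! 0) (xs ! 1)" k] assms
  by (simp add: numeral_2_eq_2)

lemma recursive_n_Suc: "recursive_n k f \<Longrightarrow> recursive_n k (\<lambda>xs. Suc (f xs))"
proof (rule recursive_n_comp1[where F = Suc])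
  have "evals Succ xs (Suc (xs ! 0))" if "length xs = 1" for xs
    using that evals_Succ[of "xs ! 0" "[]"] by (cases xs) auto
  then show "recursive_n 1 (\<lambda>xs. Suc (xs ! 0))" unfolding recursive_n_def by blast
qed

lemma recursive_n_const: "recursive_n k (\<lambda>_. c)"
proof (induction c)
  case 0 show ?case unfolding recursive_n_def using evals_Zero by blast
next
  case (Suc c) then show ?case by (rule recursive_n_Suc)
qed

lemma recursive_n_prim:
  assumes "recursive_n k f" "recursive_n (k + 2) g"
  shows "recursive_n (Suc k)
    (\<lambda>xs. rec_nat (f (tl xs)) (\<lambda>n y. g (n # y # tl xs)) (xs ! 0))"
proof -
  obtain rf where rf: "\<And>xs. length xs = k \<Longrightarrow> evals rf xs (f xs)"
    using assms(1) unfolding recursive_n_def by blast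
  obtain rg where rg: "\<And>xs. length xs = k + 2 \<Longrightarrow> evals rg xs (g xs)"
    using assms(2) unfolding recursive_n_def by blast
  have *: "evals (PrimRec rf rg) (n # xs) (rec_nat (f xs) (\<lambda>n y. g (n # y # xs)) n)"
    if "length xs = k" for n xs
    by (induction n) (auto intro!: evals_PrimRec_0 evals_PrimRec_Suc rf rg simp: that)
  have "evals (PrimRec rf rg) xs (rec_nat (f (tl xs)) (\<lambda>n y. g (n # y # tl xs)) (xs ! 0))"
    if "length xs = Suc k" for xs
    using *[of "tl xs" "hd xs"] that by (cases xs) auto
  then show ?thesis unfolding recursive_n_def by blast
qed

lemma recursive_n_prim1:
  assumes "recursive_n 2 (\<lambda>xs. g (xs ! 0) (xs ! 1))"
  shows "recursive_n 1 (\<lambda>xs. rec_nat c g (xs ! 0))"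
  using recursive_n_prim[of 0 "\<lambda>_. c" "\<lambda>xs. g (xs ! 0) (xs ! 1)"] assms recursive_n_const
  by (simp add: numeral_2_eq_2)

lemma recursive_n_prim2:
  assumes "recursive_n 1 (\<lambda>xs. f (xs ! 0))" "recursive_n 3 (\<lambda>xs. g (xs ! 0) (xs ! 1) (xs ! 2))"
  shows "recursive_n 2 (\<lambda>xs. rec_nat (f (xs ! 1)) (\<lambda>n y. g n y (xs ! 1)) (xs ! 0))"
proof -
  have "recursive_n (Suc 1) (\<lambda>xs. rec_nat (f (tl xs ! 0)) (\<lambda>n y. g n y (tl xs ! 0)) (xs ! 0))"
    using recursive_n_prim[of 1 "\<lambda>xs. f (xs ! 0)" "\<lambda>xs. g (xs ! 0) (xs ! 1) (xs ! 2)"] assms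
    by (simp add: numeral_3_eq_3 numeral_2_eq_2)
  then show ?thesis
    unfolding recursive_n_def
    by (auto simp: nth_tl numeral_2_eq_2)
qed

lemma recursive_n_add2: "recursive_n 2 (\<lambda>xs. xs ! 0 + xs ! 1)"
proof -
  have "recursive_n 2 (\<lambda>xs. rec_nat (xs ! 1) (\<lambda>n y. Suc y) (xs ! 0))"
    by (rule recursive_n_prim2[where f = "\<lambda>x. x" and g = "\<lambda>n y x. Suc y"])
      (intro recursive_n_Suc recursive_n_proj, simp)+
  moreover have "rec_nat a (\<lambda>n y. Suc y) b = b + a" for a b :: nat by (induction b) auto
  ultimately show ?thesis by simp
qed

lemmas recursive_n_add = recursive_n_comp2[where F = "(+)", OF recursive_n_add2]

lemma recursive_n_mult2: "recursive_n 2 (\<lambda>xs. xs ! 0 * xs ! 1)"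
proof -
  have "recursive_n 2 (\<lambda>xs. rec_nat 0 (\<lambda>n y. y + xs ! 1) (xs ! 0))"
    by (rule recursive_n_prim2[where f = "\<lambda>x. 0" and g = "\<lambda>n y x. y + x"])
      (intro recursive_n_const recursive_n_add recursive_n_proj; simp)+
  moreover have "rec_nat 0 (\<lambda>n y. y + a) b = b * a" for a b :: nat by (induction b) auto
  ultimately show ?thesis by simp
qed

lemmas recursive_n_mult = recursive_n_comp2[where F = "(*)", OF recursive_n_mult2]

lemma recursive_n_pred: "recursive_n k f \<Longrightarrow> recursive_n k (\<lambda>xs. f xs - 1)"
proof (rule recursive_n_comp1[where F = "\<lambda>x. x - 1"])
  have "recursive_n 1 (\<lambda>xs. rec_nat 0 (\<lambda>n y. n) (xs ! 0))"
    by (rule recursive_n_prim1) (auto intro: recursive_n_proj)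
  moreover have "rec_nat 0 (\<lambda>n y. n) b = b - 1" for b :: nat by (cases b) auto
  ultimately show "recursive_n 1 (\<lambda>xs. xs ! 0 - 1)" by simp
qed

lemma recursive_n_diff:
  assumes "recursive_n k f" "recursive_n k g"
  shows "recursive_n k (\<lambda>xs. f xs - g xs)"
proof -
  have "recursive_n 2 (\<lambda>xs. rec_nat (xs ! 1) (\<lambda>n y. y - 1) (xs ! 0))"
    by (rule recursive_n_prim2[where f = "\<lambda>x. x" and g = "\<lambda>n y x. y - 1"])
      (intro recursive_n_pred recursive_n_proj; simp)+
  moreover have "rec_nat a (\<lambda>n y. y - 1) b = a - b" for a b :: nat by (induction b) auto
  ultimately have "recursive_n 2 (\<lambda>xs. xs ! 1 - xs ! 0)" by simp
  then show ?thesis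
    using recursive_n_comp2[where F = "\<lambda>a b. b - a"] assms by blast
qed

lemma recursive_n_triangle:
  assumes "recursive_n k f"
  shows "recursive_n k (\<lambda>xs. triangle (f xs))"
proof (rule recursive_n_comp1[OF _ assms])
  have "recursive_n 1 (\<lambda>xs. rec_nat 0 (\<lambda>n y. y + Suc n) (xs ! 0))"
    by (rule recursive_n_prim1)
      (intro recursive_n_add recursive_n_Suc recursive_n_proj; simp)
  moreover have "rec_nat 0 (\<lambda>n y. y + Suc n) = triangle"
    by (rule ext, rename_tac n, induct_tac n) auto
  ultimately show "recursive_n 1 (\<lambda>xs. triangle (xs ! 0))" by simp
qed

section \<open>Cantor pairing and its projections\<close>

definition pair :: "nat \<Rightarrow> nat \<Rightarrow> nat" where "pair x y = prod_encode (x, y)"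
definition pfst :: "nat \<Rightarrow> nat" where "pfst p = fst (prod_decode p)"
definition psnd :: "nat \<Rightarrow> nat" where "psnd p = snd (prod_decode p)"

lemma pfst_pair [simp]: "pfst (pair x y) = x" and psnd_pair [simp]: "psnd (pair x y) = y"
  and pair_collapse [simp]: "pair (pfst p) (psnd p) = p"
  by (simp_all add: pair_def pfst_def psnd_def)

lemma prod_decode_eq_pair: "prod_decode p = (pfst p, psnd p)"
  by (simp add: pfst_def psnd_def)

lemma recursive_n_pair:
  "recursive_n k f \<Longrightarrow> recursive_n k g \<Longrightarrow> recursive_n k (\<lambda>xs. pair (f xs) (g xs))"
  unfolding pair_def prod_encode_def prod.case by (intro recursive_n_add recursive_n_triangle)

lemma recursive_n_Least:
  assumes "recursive_n (Suc k) f" "\<And>xs. length xs = k \<Longrightarrow> \<exists>n. f (n # xs) = 0"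
  shows "recursive_n k (\<lambda>xs. LEAST n. f (n # xs) = 0)"
proof -
  obtain r where r: "\<And>xs. length xs = Suc k \<Longrightarrow> evals r xs (f xs)"
    using assms(1) unfolding recursive_n_def by blast
  have "evals (Mu r) xs (LEAST n. f (n # xs) = 0)" if xs: "length xs = k" for xs
  proof (rule evals_Mu)
    show "evals r ((LEAST n. f (n # xs) = 0) # xs) 0"
      using r[of "(LEAST n. f (n # xs) = 0) # xs"] LeastI_ex[OF assms(2)[OF xs]] xs by simp
    show "\<forall>m<(LEAST n. f (n # xs) = 0). \<exists>y. evals r (m # xs) (Suc y)"
    proof (intro allI impI)
      fix m assume "m < (LEAST n. f (n # xs) = 0)"
      then have "f (m # xs) \<noteq> 0" by (rule not_less_Least)
      then obtain y where "f (m # xs) = Suc y" using not0_implies_Suc by blast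
      then show "\<exists>y. evals r (m # xs) (Suc y)" using r[of "m # xs"] xs by auto
    qed
  qed
  then show ?thesis unfolding recursive_n_def by blast
qed

text \<open>The code of \<open>(x, y)\<close> is \<open>triangle (x + y) + x\<close>. Its diagonal
  \<open>x + y\<close> is the first \<open>k\<close> with \<open>n < triangle (Suc k)\<close>, an
  inequality written as a vanishing truncated difference so that minimization finds it; both
  projections then follow by subtraction.\<close>

definition pair_diagonal :: "nat \<Rightarrow> nat" where
  "pair_diagonal n = (LEAST k. Suc n - triangle (Suc k) = 0)"

lemma pair_diagonal_pair: "pair_diagonal (pair x y) = x + y"
  unfolding pair_diagonal_def
proof (rule Least_equality)
  show "Suc (pair x y) - triangle (Suc (x + y)) = 0"
    by (simp add: pair_def prod_encode_def)
  fix k assume "Suc (pair x y) - triangle (Suc k) = 0"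
  then have k: "triangle (x + y) < triangle (Suc k)"
    by (simp add: pair_def prod_encode_def)
  have "mono triangle" by (rule incseq_SucI) simp
  then show "x + y \<le> k"
    using k by (metis monoD not_less not_less_eq_eq)
qed

lemma recursive_n_pair_diagonal: "recursive_n 1 (\<lambda>xs. pair_diagonal (xs ! 0))"
proof -
  have "recursive_n 1 (\<lambda>xs. LEAST n. (\<lambda>xs. Suc (xs ! 1) - triangle (Suc (xs ! 0))) (n # xs) = 0)"
  proof (rule recursive_n_Least)
    show "recursive_n (Suc 1) (\<lambda>xs. Suc (xs ! 1) - triangle (Suc (xs ! 0)))"
      by (intro recursive_n_diff recursive_n_Suc recursive_n_triangle recursive_n_proj) auto
    fix xs :: "nat list"
    have "Suc ((xs ! 0 # xs) ! 1) - triangle (Suc ((xs ! 0 # xs) ! 0)) = 0" by simp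
    then show "\<exists>n. Suc ((n # xs) ! 1) - triangle (Suc ((n # xs) ! 0)) = 0" by blast
  qed
  then show ?thesis by (simp add: pair_diagonal_def)
qed

lemma pfst_eq: "pfst p = p - triangle (pair_diagonal p)"
proof -
  obtain x y where "p = pair x y" by (metis pair_collapse)
  then show ?thesis using pair_diagonal_pair[of x y] pfst_pair[of x y]
    by (simp only:) (simp add: pair_def prod_encode_def)
qed

lemma psnd_eq: "psnd p = pair_diagonal p - pfst p"
proof -
  obtain x y where "p = pair x y" by (metis pair_collapse)
  then show ?thesis by (simp add: pair_diagonal_pair)
qed

lemma recursive_n_pfst: "recursive_n k f \<Longrightarrow> recursive_n k (\<lambda>xs. pfst (f xs))"
  unfolding pfst_eq
  by (intro recursive_n_diff recursive_n_triangle recursive_n_comp1[OF recursive_n_pair_diagonal])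

lemma recursive_n_psnd: "recursive_n k f \<Longrightarrow> recursive_n k (\<lambda>xs. psnd (f xs))"
  unfolding psnd_eq
  by (intro recursive_n_diff recursive_n_pfst recursive_n_comp1[OF recursive_n_pair_diagonal])

section \<open>Unary recursive functions\<close>

definition recursive :: "(nat \<Rightarrow> nat) \<Rightarrow> bool" where
  "recursive f \<longleftrightarrow> recursive_n 1 (\<lambda>xs. f (xs ! 0))"

lemma recursive_n_compose: "recursive f \<Longrightarrow> recursive_n k g \<Longrightarrow> recursive_n k (\<lambda>xs. f (g xs))"
  unfolding recursive_def by (rule recursive_n_comp1)

lemma recursive_iff: "recursive f \<longleftrightarrow> (\<exists>r. \<forall>x. evals r [x] (f x))"
proof -
  have "(\<forall>xs. length xs = 1 \<longrightarrow> evals r xs (f (xs ! 0))) \<longleftrightarrow> (\<forall>x. evals r [x] (f x))" for r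
    by (metis One_nat_def length_0_conv length_Suc_conv nth_Cons_0)
  then show ?thesis unfolding recursive_def recursive_n_def by simp
qed

lemma recursive_comp: "recursive f \<Longrightarrow> recursive g \<Longrightarrow> recursive (\<lambda>x. f (g x))"
  unfolding recursive_def by (rule recursive_n_comp1)

named_theorems recursive_intros

lemma recursive_basic [recursive_intros]:
  "recursive (\<lambda>x. x)" "recursive (\<lambda>_. c)"
  "recursive f \<Longrightarrow> recursive (\<lambda>x. Suc (f x))"
  "recursive f \<Longrightarrow> recursive g \<Longrightarrow> recursive (\<lambda>x. f x + g x)"
  "recursive f \<Longrightarrow> recursive g \<Longrightarrow> recursive (\<lambda>x. f x * g x)"
  "recursive f \<Longrightarrow> recursive g \<Longrightarrow> recursive (\<lambda>x. f x - g x)"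
  "recursive f \<Longrightarrow> recursive g \<Longrightarrow> recursive (\<lambda>x. pair (f x) (g x))"
  "recursive f \<Longrightarrow> recursive (\<lambda>x. pfst (f x))"
  "recursive f \<Longrightarrow> recursive (\<lambda>x. psnd (f x))"
  unfolding recursive_def
  by (auto intro: recursive_n_proj recursive_n_const recursive_n_Suc recursive_n_add
      recursive_n_mult recursive_n_diff recursive_n_pair recursive_n_pfst recursive_n_psnd)

lemma recursive_power [recursive_intros]: "recursive f \<Longrightarrow> recursive (\<lambda>x. f x ^ n)"
  by (induction n) (auto intro: recursive_intros)

lemma recursive_rec_nat:
  assumes f: "recursive f" and g: "recursive (\<lambda>p. g (pfst p) (pfst (psnd p)) (psnd (psnd p)))" and n: "recursive n"
  shows "recursive (\<lambda>x. rec_nat (f x) (\<lambda>m y. g x m y) (n x))"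
proof -
  have g': "recursive_n 3 (\<lambda>xs. g (xs ! 2) (xs ! 0) (xs ! 1))"
  proof -
    have "recursive_n 3 (\<lambda>xs. pair (xs ! 2) (pair (xs ! 0) (xs ! 1)))"
      by (intro recursive_n_pair recursive_n_proj) simp_all
    from recursive_n_compose[OF g this] show ?thesis by simp
  qed
  have "recursive_n 2 (\<lambda>xs. rec_nat (f (xs ! 1)) (\<lambda>m y. g (xs ! 1) m y) (xs ! 0))"
    by (rule recursive_n_prim2[OF f[unfolded recursive_def] g'])
  from recursive_n_comp2[where F = "\<lambda>n x. rec_nat (f x) (\<lambda>m y. g x m y) n", OF this n[unfolded recursive_def], of "\<lambda>xs. xs ! 0"]
  show ?thesis unfolding recursive_def by (auto intro: recursive_n_proj)
qed

lemma recursive_sum_nat: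
  assumes f: "recursive (\<lambda>p. f (pfst p) (psnd p))" and n: "recursive n"
  shows "recursive (\<lambda>x. \<Sum>m<n x. f x m)"
proof -
  have "recursive (\<lambda>p. psnd (psnd p) + f (pfst (pair (pfst p) (pfst (psnd p)))) (psnd (pair (pfst p) (pfst (psnd p)))))"
    by (intro recursive_comp[OF f] recursive_intros)
  then have "recursive (\<lambda>p. psnd (psnd p) + f (pfst p) (pfst (psnd p)))" by simp
  then have "recursive (\<lambda>x. rec_nat 0 (\<lambda>m y. y + f x m) (n x))"
    by (rule recursive_rec_nat[OF _ _ n, rotated]) (rule recursive_intros)
  moreover have "rec_nat 0 (\<lambda>m y. y + f x m) k = (\<Sum>m<k. f x m)" for x k by (induction k) auto
  ultimately show ?thesis by simp
qed

section \<open>Finite sequences coded by one number\<close>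

definition lhd :: "nat \<Rightarrow> nat" where "lhd l = pfst (l - 1)"
definition ltl :: "nat \<Rightarrow> nat" where "ltl l = psnd (l - 1)"
text \<open>This reads codes made by \<open>list_encode\<close>: 0 is the empty list, a successor is
  a pair of head and tail. Since \<open>ltl 0 = 0\<close>, lookup past the end is total and returns
  0.\<close>

definition lnth :: "nat \<Rightarrow> nat \<Rightarrow> nat" where "lnth l i = lhd ((ltl ^^ i) l)"

lemma list_encode_Cons: "list_encode (x # xs) = Suc (pair x (list_encode xs))"
  by (simp add: pair_def)

lemma prod_decode_0: "prod_decode 0 = (0, 0)"
  using prod_encode_inverse[of "(0, 0)"] by (simp add: prod_encode_def)

lemma lnth_list_encode: "lnth (list_encode xs) i = (if i < length xs then xs ! i else 0)"
proof (induction xs arbitrary: i)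
  case Nil
  have "ltl 0 = 0" by (simp add: ltl_def psnd_def prod_decode_0)
  then have "(ltl ^^ i) 0 = 0" by (induction i) auto
  then show ?case by (simp add: lnth_def lhd_def pfst_def prod_decode_0)
next
  case (Cons x xs)
  show ?case
  proof (cases i)
    case 0
    then show ?thesis by (simp add: lnth_def list_encode_Cons lhd_def del: list_encode.simps)
  next
    case (Suc j)
    then have "lnth (list_encode (x # xs)) i = lhd ((ltl ^^ j) (ltl (list_encode (x # xs))))"
      unfolding lnth_def by (simp only: funpow_Suc_right comp_def)
    also have "\<dots> = lnth (list_encode xs) j"
      unfolding list_encode_Cons lnth_def by (simp add: ltl_def)
    finally have "lnth (list_encode (x # xs)) i = lnth (list_encode xs) j" .
    then show ?thesis using Cons Suc by simp
  qed
qed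

lemma lnth_list_decode: "lnth l i = (if i < length (list_decode l) then list_decode l ! i else 0)"
  using lnth_list_encode[of "list_decode l"] by simp

text \<open>This lets a number quantifier range over finite sequences, in the role of Goedel's beta
  function: computation histories, orbit approximations and lists of witnesses all become single
  witnesses.\<close>

lemma ex_lnth: "\<exists>l. \<forall>i<n. lnth l i = f i"
  by (rule exI[of _ "list_encode (map f [0..<n])"]) (simp add: lnth_list_encode)

lemma recursive_lnth [recursive_intros]:
  assumes "recursive f" "recursive g"
  shows "recursive (\<lambda>x. lnth (f x) (g x))"
proof -
  have "recursive (\<lambda>x. rec_nat (f x) (\<lambda>m y. ltl y) (g x))"
    unfolding ltl_def by (intro recursive_rec_nat recursive_intros assms)
  moreover have "rec_nat l (\<lambda>m y. ltl y) n = (ltl ^^ n) l" for l n by (induction n) auto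
  ultimately have "recursive (\<lambda>x. (ltl ^^ g x) (f x))" by simp
  then show ?thesis unfolding lnth_def lhd_def by (intro recursive_intros)
qed

text \<open>Parity and halving serve to decode the integers inside \<open>rat_number\<close>, where
  the parity of the code is the sign.\<close>

lemma recursive_parity: 
  assumes "recursive f"
  shows "recursive (\<lambda>x. f x mod 2)"
proof -
  have "recursive (\<lambda>x. rec_nat 0 (\<lambda>m y. 1 - y) (f x))"
    by (intro recursive_rec_nat recursive_intros assms)
  moreover have "rec_nat 0 (\<lambda>m y. 1 - y) n = n mod 2" for n :: nat
    by (induction n) (auto simp: mod_Suc)
  ultimately show ?thesis by simp
qed

lemma recursive_half: 
  assumes "recursive f"
  shows "recursive (\<lambda>x. f x div 2)"
proof -
  have "recursive (\<lambda>x. \<Sum>m<f x. m mod 2)"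
    by (intro recursive_sum_nat recursive_parity recursive_intros assms)
  moreover have "(\<Sum>m<n. m mod 2) = n div 2" for n :: nat
    by (induction n) (auto simp: mod2_eq_if)
  ultimately show ?thesis by simp
qed

section \<open>Semidecidable predicates and their closure properties\<close>

text \<open>The Sigma_1 normal form is taken instead of the domain of a partial function, so that
  closure becomes arithmetic on the matrix: conjunction is a sum, disjunction a product, and an
  existential quantifier is absorbed into the witness.\<close>

definition semidecidable :: "(nat \<Rightarrow> bool) \<Rightarrow> bool" where
  "semidecidable P \<longleftrightarrow> (\<exists>d. recursive d \<and> (\<forall>x. P x \<longleftrightarrow> (\<exists>w. d (pair x w) = 0)))"

named_theorems semidecidable_intros

lemma semidecidableI:
  assumes "recursive (\<lambda>p. d (pfst p) (psnd p))" "\<And>x. P x \<longleftrightarrow> (\<exists>w. d x w = 0)"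
  shows "semidecidable P"
  unfolding semidecidable_def using assms by (intro exI[of _ "\<lambda>p. d (pfst p) (psnd p)"]) simp

lemma semidecidableE:
  assumes "semidecidable P"
  obtains d where "\<And>f g. recursive f \<Longrightarrow> recursive g \<Longrightarrow> recursive (\<lambda>x. d (f x) (g x))"
    "\<And>x. P x \<longleftrightarrow> (\<exists>w. d x w = 0)"
proof -
  obtain e where e: "recursive e" "\<forall>x. P x \<longleftrightarrow> (\<exists>w. e (pair x w) = 0)"
    using assms unfolding semidecidable_def by blast
  show ?thesis
    by (rule that[of "\<lambda>x w. e (pair x w)"]) (use e in \<open>auto intro: recursive_comp[OF e(1)] recursive_intros\<close>)
qed

lemma semidecidable_subst: "semidecidable P \<Longrightarrow> recursive f \<Longrightarrow> semidecidable (\<lambda>x. P (f x))"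
proof -
  assume P: "semidecidable P" and f: "recursive f"
  from P obtain d where d: "\<And>f g. recursive f \<Longrightarrow> recursive g \<Longrightarrow> recursive (\<lambda>x. d (f x) (g x))"
    "\<And>x. P x \<longleftrightarrow> (\<exists>w. d x w = 0)" by (rule semidecidableE) blast
  show ?thesis
    by (rule semidecidableI[of "\<lambda>x w. d (f x) w"]) (auto intro!: d recursive_comp[OF f] recursive_intros simp: d(2))
qed

lemma semidecidable_zero: "recursive f \<Longrightarrow> semidecidable (\<lambda>x. f x = 0)"
  by (rule semidecidableI[of "\<lambda>x w. f x"]) (auto intro!: recursive_comp[of f] recursive_intros)

lemma semidecidable_le [semidecidable_intros]: "recursive f \<Longrightarrow> recursive g \<Longrightarrow> semidecidable (\<lambda>x. f x \<le> g x)"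
  using semidecidable_zero[of "\<lambda>x. f x - g x"] by (auto intro: recursive_intros)

lemma semidecidable_less [semidecidable_intros]: "recursive f \<Longrightarrow> recursive g \<Longrightarrow> semidecidable (\<lambda>x. f x < g x)"
  using semidecidable_le[of "\<lambda>x. Suc (f x)" g] by (auto intro: recursive_intros simp: Suc_le_eq)

lemma semidecidable_conj [semidecidable_intros]:
  assumes "semidecidable P" "semidecidable Q" shows "semidecidable (\<lambda>x. P x \<and> Q x)"
proof -
  from assms(1) obtain d where d: "\<And>f g. recursive f \<Longrightarrow> recursive g \<Longrightarrow> recursive (\<lambda>x. d (f x) (g x))"
    "\<And>x. P x \<longleftrightarrow> (\<exists>w. d x w = 0)" by (rule semidecidableE) blast
  from assms(2) obtain e where e: "\<And>f g. recursive f \<Longrightarrow> recursive g \<Longrightarrow> recursive (\<lambda>x. e (f x) (g x))"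
    "\<And>x. Q x \<longleftrightarrow> (\<exists>w. e x w = 0)" by (rule semidecidableE) blast
  show ?thesis
  proof (rule semidecidableI[of "\<lambda>x w. d x (pfst w) + e x (psnd w)"])
    show "recursive (\<lambda>p. d (pfst p) (pfst (psnd p)) + e (pfst p) (psnd (psnd p)))"
      by (intro recursive_intros d e)
    fix x
    show "P x \<and> Q x \<longleftrightarrow> (\<exists>w. d x (pfst w) + e x (psnd w) = 0)"
    proof
      assume "P x \<and> Q x"
      then obtain v w where "d x v = 0" "e x w = 0" using d e by blast
      then have "d x (pfst (pair v w)) + e x (psnd (pair v w)) = 0" by simp
      then show "\<exists>w. d x (pfst w) + e x (psnd w) = 0" by blast
    qed (use d e in auto)
  qed
qed

lemma semidecidable_disj [semidecidable_intros]:
  assumes "semidecidable P" "semidecidable Q" shows "semidecidable (\<lambda>x. P x \<or> Q x)"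
proof -
  from assms(1) obtain d where d: "\<And>f g. recursive f \<Longrightarrow> recursive g \<Longrightarrow> recursive (\<lambda>x. d (f x) (g x))"
    "\<And>x. P x \<longleftrightarrow> (\<exists>w. d x w = 0)" by (rule semidecidableE) blast
  from assms(2) obtain e where e: "\<And>f g. recursive f \<Longrightarrow> recursive g \<Longrightarrow> recursive (\<lambda>x. e (f x) (g x))"
    "\<And>x. Q x \<longleftrightarrow> (\<exists>w. e x w = 0)" by (rule semidecidableE) blast
  show ?thesis
    by (rule semidecidableI[of "\<lambda>x w. d x w * e x w"])
      ((intro recursive_intros d(1) e(1) | simp add: d(2) e(2) ex_disj_distrib)+)
qed

lemma semidecidable_eq [semidecidable_intros]: "recursive f \<Longrightarrow> recursive g \<Longrightarrow> semidecidable (\<lambda>x. f x = g x)"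
  unfolding eq_iff by (intro semidecidable_intros)

lemma semidecidable_ex [semidecidable_intros]:
  assumes "semidecidable (\<lambda>p. P (pfst p) (psnd p))" shows "semidecidable (\<lambda>x. \<exists>y. P x y)"
proof -
  from assms obtain d where d: "\<And>f g. recursive f \<Longrightarrow> recursive g \<Longrightarrow> recursive (\<lambda>x. d (f x) (g x))"
    "\<And>p. P (pfst p) (psnd p) \<longleftrightarrow> (\<exists>w. d p w = 0)" by (rule semidecidableE) blast
  show ?thesis
  proof (rule semidecidableI[of "\<lambda>x w. d (pair x (pfst w)) (psnd w)"])
    show "recursive (\<lambda>p. d (pair (pfst p) (pfst (psnd p))) (psnd (psnd p)))"
      by (intro recursive_intros d)
    fix x
    have "(\<exists>y. P x y) \<longleftrightarrow> (\<exists>y w. d (pair x y) w = 0)"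
      using d(2)[of "pair x _"] by simp
    also have "\<dots> \<longleftrightarrow> (\<exists>w. d (pair x (pfst w)) (psnd w) = 0)"
      by (metis pfst_pair psnd_pair)
    finally show "(\<exists>y. P x y) \<longleftrightarrow> \<dots>" .
  qed
qed

text \<open>Sigma_1 collection: the finitely many witnesses are coded by one sequence, and the sum
  of the matrices vanishes exactly when each of them does.\<close>

lemma semidecidable_all_less [semidecidable_intros]:
  assumes "semidecidable (\<lambda>p. P (pfst p) (psnd p))" "recursive n" shows "semidecidable (\<lambda>x. \<forall>m<n x. P x m)"
proof -
  from assms obtain d where d: "\<And>f g. recursive f \<Longrightarrow> recursive g \<Longrightarrow> recursive (\<lambda>x. d (f x) (g x))"
    "\<And>p. P (pfst p) (psnd p) \<longleftrightarrow> (\<exists>w. d p w = 0)" by - (erule semidecidableE, blast)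
  show ?thesis
  proof (rule semidecidableI[of "\<lambda>x w. \<Sum>m<n x. d (pair x m) (lnth w m)"])
    show "recursive (\<lambda>p. \<Sum>m<n (pfst p). d (pair (pfst p) m) (lnth (psnd p) m))"
      by (intro recursive_sum_nat recursive_intros d recursive_comp[OF assms(2)])
    fix x
    have "(\<forall>m<n x. P x m) \<longleftrightarrow> (\<forall>m<n x. \<exists>w. d (pair x m) w = 0)"
      using d(2)[of "pair x _"] by simp
    also have "\<dots> \<longleftrightarrow> (\<exists>W. \<forall>m<n x. d (pair x m) (lnth W m) = 0)"
    proof
      assume "\<forall>m<n x. \<exists>w. d (pair x m) w = 0"
      then obtain f where f: "\<forall>m<n x. d (pair x m) (f m) = 0" by metis
      obtain W where "\<forall>m<n x. lnth W m = f m" using ex_lnth by blast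
      with f have "\<forall>m<n x. d (pair x m) (lnth W m) = 0" by simp
      then show "\<exists>W. \<forall>m<n x. d (pair x m) (lnth W m) = 0" ..
    qed blast
    finally show "(\<forall>m<n x. P x m) \<longleftrightarrow> (\<exists>w. (\<Sum>m<n x. d (pair x m) (lnth w m)) = 0)" by auto
  qed
qed

text \<open>Several arguments are coded by pairs, so that a bound variable becomes a component of the argument.\<close>

abbreviation semidecidable2 :: "(nat \<Rightarrow> nat \<Rightarrow> bool) \<Rightarrow> bool" where
  "semidecidable2 P \<equiv> semidecidable (\<lambda>p. P (pfst p) (psnd p))"

lemma semidecidable2_subst:
  assumes "semidecidable2 P" "recursive f" "recursive g" shows "semidecidable (\<lambda>x. P (f x) (g x))"
  using semidecidable_subst[OF assms(1), of "\<lambda>x. pair (f x) (g x)"] assms by (simp add: recursive_intros)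

section \<open>Search: selection and dependent choice\<close>

text \<open>The search runs over pairs of a value and a witness and returns the value of the least
  successful pair. The code is partial, with halting claimed only where a solution exists; this
  weaker form is what dependent choice needs.\<close>

lemma semidecidable_partial_selection:
  assumes "semidecidable2 P"
  shows "\<exists>r f. \<forall>x. (\<exists>y. P x y) \<longrightarrow> evals r [x] (f x) \<and> P x (f x)"
proof -
  from assms obtain d where d: "\<And>f g. recursive f \<Longrightarrow> recursive g \<Longrightarrow> recursive (\<lambda>x. d (f x) (g x))"
    "\<And>p. P (pfst p) (psnd p) \<longleftrightarrow> (\<exists>w. d p w = 0)" by (rule semidecidableE) blast
  let ?D = "\<lambda>x v. d (pair x (pfst v)) (psnd v)"
  have "recursive (\<lambda>p. ?D (psnd p) (pfst p))" by (intro recursive_intros d)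
  moreover have "recursive_n 2 (\<lambda>xs. pair (xs ! 0) (xs ! 1))"
    by (intro recursive_n_pair recursive_n_proj) simp_all
  ultimately have "recursive_n 2 (\<lambda>xs. ?D (psnd (pair (xs ! 0) (xs ! 1))) (pfst (pair (xs ! 0) (xs ! 1))))"
    by (rule recursive_n_compose)
  then have "recursive_n 2 (\<lambda>xs. ?D (xs ! 1) (xs ! 0))" by simp
  then obtain r where r0: "\<forall>xs. length xs = 2 \<longrightarrow> evals r xs (?D (xs ! 1) (xs ! 0))"
    unfolding recursive_n_def by blast
  have r: "evals r [v, x] (?D x v)" for v x using r0[rule_format, of "[v, x]"] by simp
  obtain q where q: "\<And>x. evals q [x] (pfst x)"
    using recursive_iff recursive_intros(1,8) by blast
  define f where "f x = (LEAST v. ?D x v = 0)" for x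
  have "evals (Comp q [Mu r]) [x] (pfst (f x)) \<and> P x (pfst (f x))" if "\<exists>y. P x y" for x
  proof -
    from that obtain y w where "d (pair x y) w = 0" using d(2)[of "pair x _"] by auto
    then have "?D x (pair y w) = 0" by simp
    then have 0: "?D x (f x) = 0" unfolding f_def by (rule LeastI)
    have "evals (Mu r) [x] (f x)"
    proof (rule evals_Mu)
      show "evals r [f x, x] 0" using r[of "f x" x] 0 by simp
      show "\<forall>m<f x. \<exists>y. evals r [m, x] (Suc y)"
      proof (intro allI impI)
        fix m assume "m < f x"
        then have "?D x m \<noteq> 0" unfolding f_def by (rule not_less_Least)
        then obtain y where "?D x m = Suc y" using not0_implies_Suc by blast
        then show "\<exists>y. evals r [m, x] (Suc y)" using r[of m x] by auto
      qed
    qed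
    then have "evals (Comp q [Mu r]) [x] (pfst (f x))"
      by (intro evals_Comp[of _ _ "[f x]"] q) simp
    moreover have "P x (pfst (f x))" using 0 d(2)[of "pair x (pfst (f x))"] by auto
    ultimately show ?thesis ..
  qed
  then show ?thesis
    by (intro exI[of _ "Comp q [Mu r]"] exI[of _ "\<lambda>x. pfst (f x)"] allI impI)
qed

lemma semidecidable_selection:
  assumes "semidecidable2 P" "\<And>x. \<exists>y. P x y"
  shows "\<exists>f. recursive f \<and> (\<forall>x. P x (f x))"
  using semidecidable_partial_selection[OF assms(1)] assms(2) unfolding recursive_iff by blast

text \<open>Integer roots, quotients and ceilings are obtained this way from the inequalities that
  characterize them.\<close>

lemma recursive_graph:
  assumes "semidecidable2 (\<lambda>x y. y = f x)" shows "recursive f"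
proof -
  obtain g where "recursive g" "\<forall>x. g x = f x" using semidecidable_selection[OF assms] by auto
  then show ?thesis by (metis ext)
qed

text \<open>No effectivity is asked of the invariant \<open>I\<close>: it never enters the algorithm
  and only guarantees that each search halts. It may thus speak of quantities that cannot be tested,
  such as the tail of a series.\<close>

lemma semidecidable_dependent_choice:
  assumes "semidecidable2 P" "I x0" "\<And>x. I x \<Longrightarrow> \<exists>y. P x y" "\<And>x y. I x \<Longrightarrow> P x y \<Longrightarrow> I y"
  shows "\<exists>f. recursive f \<and> f 0 = x0 \<and> (\<forall>n. I (f n) \<and> P (f n) (f (Suc n)))"
proof -
  obtain r g where g: "\<And>x. \<exists>y. P x y \<Longrightarrow> evals r [x] (g x) \<and> P x (g x)"
    using semidecidable_partial_selection[OF assms(1)] by blast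
  define f where "f n = (g ^^ n) x0" for n
  have f0: "f 0 = x0" and fS: "f (Suc n) = g (f n)" for n by (auto simp: f_def)
  have I: "I (f n)" for n
  proof (induction n)
    case 0 show ?case using f0 assms(2) by simp
  next
    case (Suc n)
    then have "P (f n) (f (Suc n))" unfolding fS using g assms(3) by blast
    with Suc show ?case by (rule assms(4))
  qed
  have step: "evals r [f n] (f (Suc n)) \<and> P (f n) (f (Suc n))" for n
    using g[OF assms(3)[OF I]] fS by simp
  obtain c where c: "\<And>xs. length xs = 0 \<Longrightarrow> evals c xs x0"
    using recursive_n_const[of 0 x0] unfolding recursive_n_def by blast
  have "evals (PrimRec c (Comp r [Proj 1])) [n] (f n)" for n
  proof (induction n)
    case 0 show ?case by (rule evals_PrimRec_0) (use c f0 in auto)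
  next
    case (Suc n)
    have "evals (Comp r [Proj 1]) [n, f n] (f (Suc n))"
      by (rule evals_Comp[of _ _ "[f n]"]) (use step evals_Proj[of 1 "[n, f n]"] in auto)
    with Suc show ?case by (rule evals_PrimRec_Suc)
  qed
  then have "recursive f" unfolding recursive_iff by blast
  then show ?thesis using f0 I step by blast
qed

section \<open>Evaluation of a fixed code is semidecidable\<close>

text \<open>The course of values, coded by one number \<open>W\<close>, replaces the recursion by a
  bounded quantifier over its steps.\<close>

lemma evals_PrimRec_iff:
  "evals (PrimRec f g) (n # xs) y \<longleftrightarrow>
    (\<exists>W. evals f xs (lnth W 0) \<and> (\<forall>m<n. evals g (m # lnth W m # xs) (lnth W (Suc m))) \<and> lnth W n = y)"
proof
  assume "evals (PrimRec f g) (n # xs) y"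
  then have "\<exists>h. evals f xs (h 0) \<and> (\<forall>m<n. evals g (m # h m # xs) (h (Suc m))) \<and> h n = y"
  proof (induction n arbitrary: y)
    case 0
    then have "evals f xs y" by (cases rule: evals.cases) auto
    then show ?case by (intro exI[of _ "\<lambda>_. y"]) simp
  next
    case (Suc n)
    from Suc.prems obtain z where z: "evals (PrimRec f g) (n # xs) z" "evals g (n # z # xs) y"
      by (cases rule: evals.cases) auto
    from Suc.IH[OF z(1)] obtain h where
      "evals f xs (h 0)" "\<forall>m<n. evals g (m # h m # xs) (h (Suc m))" "h n = z" by blast
    with z(2) show ?case
      by (intro exI[of _ "\<lambda>m. if m = Suc n then y else h m"]) (auto simp: less_Suc_eq)
  qed
  then obtain h where h: "evals f xs (h 0)" "\<forall>m<n. evals g (m # h m # xs) (h (Suc m))" "h n = y"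
    by blast
  obtain W where W: "\<forall>i<Suc n. lnth W i = h i" using ex_lnth by blast
  show "\<exists>W. evals f xs (lnth W 0) \<and> (\<forall>m<n. evals g (m # lnth W m # xs) (lnth W (Suc m))) \<and> lnth W n = y"
    by (rule exI[of _ W]) (use W h in auto)
next
  assume "\<exists>W. evals f xs (lnth W 0) \<and> (\<forall>m<n. evals g (m # lnth W m # xs) (lnth W (Suc m))) \<and> lnth W n = y"
  then obtain W where W: "evals f xs (lnth W 0)" "\<forall>m<n. evals g (m # lnth W m # xs) (lnth W (Suc m))"
    "lnth W n = y" by blast
  have "evals (PrimRec f g) (m # xs) (lnth W m)" if "m \<le> n" for m
    using that
  proof (induction m)
    case 0 then show ?case using W(1) by (auto intro: evals_PrimRec_0)
  next
    case (Suc m)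
    then show ?case using W(2) by (intro evals_PrimRec_Suc[of f g m xs "lnth W m"]) auto
  qed
  with W(3) show "evals (PrimRec f g) (n # xs) y" by blast
qed

lemma evals_PrimRec_Nil: "\<not> evals (PrimRec f g) [] y"
  by (auto elim: evals.cases)

lemma evals_Zero_iff: "evals Zero xs y \<longleftrightarrow> y = 0"
  by (auto elim: evals.cases intro: evals_Zero)

lemma evals_Succ_iff: "evals Succ xs y \<longleftrightarrow> (\<exists>x ys. xs = x # ys \<and> y = Suc x)"
  by (auto elim: evals.cases intro: evals_Succ)

lemma evals_Proj_iff: "evals (Proj i) xs y \<longleftrightarrow> i < length xs \<and> y = xs ! i"
  by (auto elim: evals.cases intro: evals_Proj)

lemma evals_Comp_iff:
  "evals (Comp f gs) xs z \<longleftrightarrow> (\<exists>ys. list_all2 (\<lambda>g y. evals g xs y) gs ys \<and> evals f ys z)"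
proof
  assume "evals (Comp f gs) xs z"
  then show "\<exists>ys. list_all2 (\<lambda>g y. evals g xs y) gs ys \<and> evals f ys z"
    by (cases rule: evals.cases) auto
qed (auto intro: evals_Comp)

lemma evals_Mu_iff:
  "evals (Mu f) xs n \<longleftrightarrow> evals f (n # xs) 0 \<and> (\<forall>m<n. \<exists>y. evals f (m # xs) (Suc y))"
proof
  assume "evals (Mu f) xs n"
  then show "evals f (n # xs) 0 \<and> (\<forall>m<n. \<exists>y. evals f (m # xs) (Suc y))"
    by (cases rule: evals.cases) auto
qed (auto intro: evals_Mu)

lemma list_decode_Suc_pair: "list_decode (Suc (pair x l)) = x # list_decode l"
  by (simp add: pair_def)

lemma list_decode_eq_Cons: "list_decode l = x # xs \<longleftrightarrow> (\<exists>t. l = Suc (pair x t) \<and> list_decode t = xs)"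
  by (metis list_decode_Suc_pair list_decode_inverse list_encode_Cons list_encode_inverse)

lemma semidecidable_length: "semidecidable2 (\<lambda>l i. i < length (list_decode l))"
proof -
  have "i < length (list_decode l) \<longleftrightarrow> 0 < rec_nat l (\<lambda>m y. ltl y) i" for l i
  proof -
    have "rec_nat l (\<lambda>m y. ltl y) i = list_encode (drop i (list_decode l))"
    proof (induction i)
      case (Suc i)
      have "ltl (list_encode ys) = list_encode (tl ys)" for ys
        by (cases ys) (auto simp: ltl_def psnd_def prod_decode_0)
      then show ?case using Suc by (simp add: drop_Suc tl_drop)
    qed simp
    moreover have "0 < list_encode ys \<longleftrightarrow> ys \<noteq> []" for ys by (cases ys) auto
    ultimately show ?thesis by (simp only: drop_eq_Nil not_le)
  qed
  moreover have "semidecidable2 (\<lambda>l i. 0 < rec_nat l (\<lambda>m y. ltl y) i)"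
    unfolding ltl_def by (intro semidecidable_intros recursive_rec_nat recursive_intros)
  ultimately show ?thesis by simp
qed

text \<open>Kleene's normal form for one code at a time. The induction is on \<open>r\<close>, which
  stays outside the predicate; argument lists, intermediate values and computation histories are all
  coded by numbers.\<close>

lemma semidecidable_evals_list: "semidecidable2 (\<lambda>l y. evals r (list_decode l) y)"
proof (induction r)
  case Zero
  show ?case unfolding evals_Zero_iff by (intro semidecidable_intros recursive_intros)
next
  case Succ
  have "evals Succ (list_decode l) y \<longleftrightarrow> (\<exists>x t. l = Suc (pair x t) \<and> y = Suc x)" for l y
    unfolding evals_Succ_iff list_decode_eq_Cons by blast
  then show ?case by (simp only:) (intro semidecidable_intros recursive_intros)
next
  case (Proj i)
  have "evals (Proj i) (list_decode l) y \<longleftrightarrow> i < length (list_decode l) \<and> y = lnth l i" for l y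
    unfolding evals_Proj_iff lnth_list_decode by auto
  then show ?case
    by (simp only:) (intro semidecidable_intros semidecidable2_subst[OF semidecidable_length] recursive_intros)
next
  case (Comp f gs)
  \<comment> \<open>The list \<open>gs\<close> is part of the code and hence fixed, so the
    conjunction over it is unfolded by an inner induction.\<close>
  have "semidecidable2 (\<lambda>l t. list_all2 (\<lambda>g y. evals g (list_decode l) y) gs (list_decode t))"
    using Comp.IH(2)
  proof (induction gs)
    case Nil
    have "list_all2 (\<lambda>g y. evals g (list_decode l) y) [] (list_decode t) \<longleftrightarrow> t = 0" for l t
      by (cases t) (auto split: prod.splits)
    then show ?case by (simp only:) (intro semidecidable_intros recursive_intros)
  next
    case (Cons g gs)
    have "semidecidable2 (\<lambda>l y. evals g (list_decode l) y)"
      "semidecidable2 (\<lambda>l t. list_all2 (\<lambda>g y. evals g (list_decode l) y) gs (list_decode t))"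
      using Cons by auto
    note IH = this[THEN semidecidable2_subst]
    have "list_all2 (\<lambda>g y. evals g (list_decode l) y) (g # gs) (list_decode t) \<longleftrightarrow>
      (\<exists>x u. t = Suc (pair x u) \<and> evals g (list_decode l) x \<and>
        list_all2 (\<lambda>g y. evals g (list_decode l) y) gs (list_decode u))" for l t
      unfolding list_all2_Cons1 list_decode_eq_Cons by blast
    then show ?case by (simp only:) (intro semidecidable_intros IH recursive_intros)
  qed
  note IH = this[THEN semidecidable2_subst] Comp.IH(1)[THEN semidecidable2_subst]
  have "evals (Comp f gs) (list_decode l) y \<longleftrightarrow>
    (\<exists>t. list_all2 (\<lambda>g y. evals g (list_decode l) y) gs (list_decode t) \<and> evals f (list_decode t) y)" for l y
    unfolding evals_Comp_iff by (metis list_encode_inverse)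
  then show ?case by (simp only:) (intro semidecidable_intros IH recursive_intros)
next
  case (PrimRec f g)
  note IH = PrimRec.IH[THEN semidecidable2_subst]
  have "evals (PrimRec f g) (list_decode l) y \<longleftrightarrow> (\<exists>n t W. l = Suc (pair n t) \<and>
    evals f (list_decode t) (lnth W 0) \<and>
    (\<forall>m<n. evals g (list_decode (Suc (pair m (Suc (pair (lnth W m) t))))) (lnth W (Suc m))) \<and>
    lnth W n = y)" for l y
  proof (cases l)
    case 0
    then show ?thesis using evals_PrimRec_Nil by simp
  next
    case (Suc k)
    then have "l = Suc (pair (pfst k) (psnd k))" by simp
    moreover have "pair n t = pair n' t' \<longleftrightarrow> n = n' \<and> t = t'" for n t n' t'
      by (metis pfst_pair psnd_pair)
    ultimately show ?thesis
      using evals_PrimRec_iff by (auto simp only: list_decode_Suc_pair nat.inject)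
  qed
  then show ?case by (simp only:) (intro semidecidable_intros IH recursive_intros)
next
  case (Mu f)
  note IH = Mu.IH[THEN semidecidable2_subst]
  have "evals (Mu f) (list_decode l) n \<longleftrightarrow> evals f (list_decode (Suc (pair n l))) 0 \<and>
    (\<forall>m<n. \<exists>y. evals f (list_decode (Suc (pair m l))) (Suc y))" for l n
    unfolding evals_Mu_iff list_decode_Suc_pair ..
  then show ?case by (simp only:) (intro semidecidable_intros IH recursive_intros)
qed

lemma semidecidable_evals [semidecidable_intros]:
  assumes "recursive h"
  shows "recursive f \<Longrightarrow> semidecidable (\<lambda>x. evals r [f x] (h x))"
    and "recursive f \<Longrightarrow> recursive g \<Longrightarrow> semidecidable (\<lambda>x. evals r [f x, g x] (h x))"
    and "recursive f \<Longrightarrow> recursive g \<Longrightarrow> recursive k \<Longrightarrow> semidecidable (\<lambda>x. evals r [f x, g x, k x] (h x))"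
proof -
  note * = semidecidable2_subst[OF semidecidable_evals_list[of r]]
  have l: "[a] = list_decode (Suc (pair a 0))" "[a, b] = list_decode (Suc (pair a (Suc (pair b 0))))"
    "[a, b, c] = list_decode (Suc (pair a (Suc (pair b (Suc (pair c 0))))))" for a b c
    by (simp_all add: pair_def)
  show "recursive f \<Longrightarrow> semidecidable (\<lambda>x. evals r [f x] (h x))"
    unfolding l(1) by (intro * recursive_intros assms)
  show "recursive f \<Longrightarrow> recursive g \<Longrightarrow> semidecidable (\<lambda>x. evals r [f x, g x] (h x))"
    unfolding l(2) by (intro * recursive_intros assms)
  show "recursive f \<Longrightarrow> recursive g \<Longrightarrow> recursive k \<Longrightarrow> semidecidable (\<lambda>x. evals r [f x, g x, k x] (h x))"
    unfolding l(3) by (intro * recursive_intros assms)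
qed

text \<open>The second argument \<open>n\<close> of the enumerator is read as a pair of a candidate
  \<open>k\<close> and a witness; the algorithm outputs \<open>k\<close> if the witness checks and
  diverges otherwise.\<close>

lemma semidecidable2_enumerable:
  assumes "semidecidable2 E"
  shows "\<exists>r. \<forall>i k. E i k \<longleftrightarrow> (\<exists>n. evals r [i, n] k)"
proof -
  from assms obtain d where d: "\<And>f g. recursive f \<Longrightarrow> recursive g \<Longrightarrow> recursive (\<lambda>x. d (f x) (g x))"
    "\<And>p. E (pfst p) (psnd p) \<longleftrightarrow> (\<exists>w. d p w = 0)" by (rule semidecidableE) blast
  let ?D = "\<lambda>i n. d (pair i (pfst n)) (psnd n)"
  have "recursive (\<lambda>p. ?D (pfst p) (psnd p))" by (intro recursive_intros d)
  moreover have "recursive_n 3 (\<lambda>xs. pair (xs ! 1) (xs ! 2))"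
    by (intro recursive_n_pair recursive_n_proj) simp_all
  ultimately have "recursive_n 3 (\<lambda>xs. ?D (pfst (pair (xs ! 1) (xs ! 2))) (psnd (pair (xs ! 1) (xs ! 2))))"
    by (rule recursive_n_compose)
  then have "recursive_n 3 (\<lambda>xs. ?D (xs ! 1) (xs ! 2))" by simp
  then obtain r where r0: "\<forall>xs. length xs = 3 \<longrightarrow> evals r xs (?D (xs ! 1) (xs ! 2))"
    unfolding recursive_n_def by blast
  have r: "evals r [v, i, n] y \<longleftrightarrow> y = ?D i n" for v i n y
    using r0[rule_format, of "[v, i, n]"] evals_deterministic[of r "[v, i, n]"] by auto
  \<comment> \<open>Since \<open>r\<close> ignores its search variable, minimization either stops at
    once with 0 or never stops: it is a guard. Adding its value to \<open>pfst n\<close> makes the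
    output undefined when the guard fails.\<close>
  have Mu: "evals (Mu r) [i, n] y \<longleftrightarrow> y = 0 \<and> ?D i n = 0" for i n y
    unfolding evals_Mu_iff r by auto
  have "recursive_n 2 (\<lambda>xs. pfst (xs ! 0) + xs ! 1)"
    by (intro recursive_n_add recursive_n_pfst recursive_n_proj) auto
  then obtain q where q0: "\<forall>xs. length xs = 2 \<longrightarrow> evals q xs (pfst (xs ! 0) + xs ! 1)"
    unfolding recursive_n_def by blast
  have q: "evals q [n, m] y \<longleftrightarrow> y = pfst n + m" for n m y
    using q0[rule_format, of "[n, m]"] evals_deterministic[of q "[n, m]"] by auto
  have "evals (Comp q [Proj 1, Mu r]) [i, n] k \<longleftrightarrow> ?D i n = 0 \<and> k = pfst n" for i n k
    unfolding evals_Comp_iff list_all2_Cons1 by (auto simp: evals_Proj_iff Mu q)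
  moreover have "E i k \<longleftrightarrow> (\<exists>n. ?D i n = 0 \<and> k = pfst n)" for i k
    using d(2)[of "pair i k"] by auto (metis pfst_pair psnd_pair)
  ultimately show ?thesis by blast
qed

section \<open>Rational-valued recursive functions\<close>

text \<open>A difference of naturals avoids coded signs and a successor avoids zero denominators;
  the sign of such a value is decided by comparing \<open>a x\<close> with
  \<open>b x\<close>.\<close>

definition rat_fun :: "(nat \<Rightarrow> real) \<Rightarrow> bool" where
  "rat_fun f \<longleftrightarrow> (\<exists>a b c. recursive a \<and> recursive b \<and> recursive c \<and>
     (\<forall>x. f x = (real (a x) - real (b x)) / real (Suc (c x))))"

named_theorems rat_fun_intros

lemma rat_funI:
  assumes "recursive a" "recursive b" "recursive c" "\<And>x. f x = (real (a x) - real (b x)) / real (Suc (c x))"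
  shows "rat_fun f"
  unfolding rat_fun_def using assms by blast

lemma rat_fun_of_nat [rat_fun_intros]: "recursive f \<Longrightarrow> rat_fun (\<lambda>x. real (f x))"
  by (rule rat_funI[of f "\<lambda>_. 0" "\<lambda>_. 0"]) (auto intro: recursive_intros)

lemma rat_fun_inverse_Suc [rat_fun_intros]: "recursive f \<Longrightarrow> rat_fun (\<lambda>x. 1 / real (Suc (f x)))"
  by (rule rat_funI[of "\<lambda>_. 1" "\<lambda>_. 0" f]) (auto intro: recursive_intros)

lemma rat_fun_numeral [rat_fun_intros]: "rat_fun (\<lambda>_. 0)" "rat_fun (\<lambda>_. 1)" "rat_fun (\<lambda>_. numeral k)"
  using rat_fun_of_nat[of "\<lambda>_. 0"] rat_fun_of_nat[of "\<lambda>_. 1"] rat_fun_of_nat[of "\<lambda>_. numeral k"]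
  by (auto intro: recursive_intros)

lemma rat_fun_comp: "rat_fun f \<Longrightarrow> recursive g \<Longrightarrow> rat_fun (\<lambda>x. f (g x))"
  unfolding rat_fun_def by (metis recursive_comp)

lemma fraction_add:
  "(real a - real b) / real (Suc c) + (real a' - real b') / real (Suc c') =
    (real (a * Suc c' + a' * Suc c) - real (b * Suc c' + b' * Suc c)) / real (Suc (c * c' + c + c'))"
proof -
  have "real (Suc (c * c' + c + c')) = real (Suc c) * real (Suc c')" by (simp add: algebra_simps)
  then show ?thesis by (simp add: add_frac_eq del: of_nat_Suc) (simp add: algebra_simps)
qed

lemma fraction_mult:
  "(real a - real b) / real (Suc c) * ((real a' - real b') / real (Suc c')) =
    (real (a * a' + b * b') - real (a * b' + b * a')) / real (Suc (c * c' + c + c'))"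
proof -
  have "real (Suc (c * c' + c + c')) = real (Suc c) * real (Suc c')" by (simp add: algebra_simps)
  then show ?thesis by (simp del: of_nat_Suc) (simp add: algebra_simps)
qed

lemma rat_fun_add [rat_fun_intros]:
  assumes "rat_fun f" "rat_fun g" shows "rat_fun (\<lambda>x. f x + g x)"
proof -
  obtain a b c where 1: "recursive a" "recursive b" "recursive c" "\<And>x. f x = (real (a x) - real (b x)) / real (Suc (c x))"
    using assms(1) unfolding rat_fun_def by blast
  obtain a' b' c' where 2: "recursive a'" "recursive b'" "recursive c'" "\<And>x. g x = (real (a' x) - real (b' x)) / real (Suc (c' x))"
    using assms(2) unfolding rat_fun_def by blast
  show ?thesis
    by (rule rat_funI[of "\<lambda>x. a x * Suc (c' x) + a' x * Suc (c x)" "\<lambda>x. b x * Suc (c' x) + b' x * Suc (c x)"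
        "\<lambda>x. c x * c' x + c x + c' x"])
      (intro recursive_intros 1(1-3) 2(1-3) | simp only: 1(4) 2(4) fraction_add)+
qed

lemma rat_fun_mult [rat_fun_intros]:
  assumes "rat_fun f" "rat_fun g" shows "rat_fun (\<lambda>x. f x * g x)"
proof -
  obtain a b c where 1: "recursive a" "recursive b" "recursive c" "\<And>x. f x = (real (a x) - real (b x)) / real (Suc (c x))"
    using assms(1) unfolding rat_fun_def by blast
  obtain a' b' c' where 2: "recursive a'" "recursive b'" "recursive c'" "\<And>x. g x = (real (a' x) - real (b' x)) / real (Suc (c' x))"
    using assms(2) unfolding rat_fun_def by blast
  show ?thesis
    by (rule rat_funI[of "\<lambda>x. a x * a' x + b x * b' x" "\<lambda>x. a x * b' x + b x * a' x"
        "\<lambda>x. c x * c' x + c x + c' x"])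
      (intro recursive_intros 1(1-3) 2(1-3) | simp only: 1(4) 2(4) fraction_mult)+
qed

lemma rat_fun_uminus [rat_fun_intros]: "rat_fun f \<Longrightarrow> rat_fun (\<lambda>x. - f x)"
  unfolding rat_fun_def by (metis minus_diff_eq minus_divide_left)

lemma rat_fun_diff [rat_fun_intros]: "rat_fun f \<Longrightarrow> rat_fun g \<Longrightarrow> rat_fun (\<lambda>x. f x - g x)"
  using rat_fun_add[of f "\<lambda>x. - g x"] rat_fun_uminus[of g] by simp

lemma rat_fun_pos_rat_number [rat_fun_intros]: "recursive f \<Longrightarrow> rat_fun (\<lambda>x. pos_rat_number (f x))"
  by (rule rat_funI[of "\<lambda>x. Suc (pfst (f x))" "\<lambda>_. 0" "\<lambda>x. psnd (f x)"])
    (auto intro!: recursive_intros simp: pos_rat_number_def prod_decode_eq_pair)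

text \<open>Codes with denominator 0 cause no exception: the rational they denote is 0, and so is a
  real quotient by 0.\<close>

lemma rat_number_eq:
  "rat_number k = real_of_int (int_decode (pfst k)) / real_of_int (int_decode (psnd k))"
proof (cases "int_decode (psnd k) = 0")
  case True
  then show ?thesis
    by (simp add: rat_number_def nat_to_rat_surj_def prod_decode_eq_pair rat_number_collapse)
next
  case False
  then show ?thesis
    by (simp add: rat_number_def nat_to_rat_surj_def prod_decode_eq_pair of_rat_rat)
qed

lemma rat_fun_rat_number [rat_fun_intros]:
  assumes "recursive f" shows "rat_fun (\<lambda>x. rat_number (f x))"
proof -
  \<comment> \<open>Positive and negative parts of the coded integer: an even code
    \<open>2 * k\<close> stands for \<open>k\<close>, an odd code \<open>2 * k + 1\<close> for
    \<open>- k - 1\<close>.\<close>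
  define ip where "ip n = (1 - n mod 2) * (n div 2)" for n :: nat
  define im where "im n = (n mod 2) * Suc (n div 2)" for n :: nat
  have ip: "recursive (\<lambda>x. ip (f x))" and im: "recursive (\<lambda>x. im (f x))" if "recursive f" for f
    unfolding ip_def im_def by (intro recursive_intros recursive_parity recursive_half that)+
  have dec: "real_of_int (int_decode n) = real (ip n) - real (im n)" and z: "ip n * im n = 0" for n
    by (auto simp: int_decode_def sum_decode_def ip_def im_def split: sum.splits if_splits)
      (auto simp: mod2_eq_if)
  show ?thesis
  proof (rule rat_funI)
    fix x
    define a where "a = ip (pfst (f x))" define a' where "a' = im (pfst (f x))"
    define b where "b = ip (psnd (f x))" define b' where "b' = im (psnd (f x))"
    have bb: "b * b' = 0" unfolding b_def b'_def by (rule z)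
    \<comment> \<open>Expanding by \<open>b - b'\<close> makes the denominator a square, and it
      equals \<open>b * b + b' * b'\<close> because one of \<open>b\<close>, \<open>b'\<close> is 0.
      If both are 0, the new numerator is 0 too, matching division by zero.\<close>
    have "(real a - real a') / (real b - real b') =
      (real (a * b + a' * b') - real (a * b' + a' * b)) / real (Suc (b * b + b' * b' - 1))"
    proof (cases "b = 0 \<and> b' = 0")
      case False
      have "(real a - real a') / (real b - real b') =
        ((real a - real a') * (real b - real b')) / ((real b - real b') * (real b - real b'))"
        using False bb by auto
      also have "(real b - real b') * (real b - real b') = real (Suc (b * b + b' * b' - 1))"
        using False bb by (auto simp: algebra_simps)
      finally show ?thesis by (simp add: algebra_simps)
    qed auto
    then show "rat_number (f x) = (real (a * b + a' * b') - real (a * b' + a' * b)) / real (Suc (b * b + b' * b' - 1))"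
      unfolding rat_number_eq dec a_def b_def a'_def b'_def by simp
  qed (intro recursive_intros ip im assms)+
qed

lemma semidecidable_rat_less [semidecidable_intros]:
  assumes "rat_fun f" "rat_fun g" shows "semidecidable (\<lambda>x. f x < g x)"
proof -
  have "rat_fun (\<lambda>x. f x - g x)" using assms by (rule rat_fun_diff)
  then obtain a b c where 1: "recursive a" "recursive b" "recursive c"
      "\<And>x. f x - g x = (real (a x) - real (b x)) / real (Suc (c x))"
    unfolding rat_fun_def by blast
  have "f x < g x \<longleftrightarrow> a x < b x" for x
  proof -
    have "f x < g x \<longleftrightarrow> f x - g x < 0" by auto
    also have "\<dots> \<longleftrightarrow> a x < b x" unfolding 1 by (auto simp: divide_less_0_iff)
    finally show ?thesis .
  qed
  then show ?thesis using 1 by (simp only:) (intro semidecidable_intros)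
qed

lemma rat_fun_sum:
  assumes f: "rat_fun (\<lambda>p. f (pfst p) (psnd p))" and n: "recursive n"
  shows "rat_fun (\<lambda>x. \<Sum>j<n x. f x j)"
proof -
  obtain a b c where 1: "recursive a" "recursive b" "recursive c"
      "\<And>p. f (pfst p) (psnd p) = (real (a p) - real (b p)) / real (Suc (c p))"
    using f unfolding rat_fun_def by blast
  \<comment> \<open>The state \<open>(A, B, C)\<close> stands for the partial sum
    \<open>(A - B) / (C + 1)\<close> and is updated as in \<open>fraction_add\<close>.\<close>
  define step where "step x j y = (let p = pair x j; A = pfst y; B = pfst (psnd y); C = psnd (psnd y) in
     pair (A * Suc (c p) + a p * Suc C) (pair (B * Suc (c p) + b p * Suc C) (C * c p + C + c p)))" for x j y
  define R where "R x k = rec_nat (pair 0 (pair 0 0)) (\<lambda>j y. step x j y) k" for x k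
  have R: "recursive (\<lambda>x. R x (n x))"
    unfolding R_def step_def Let_def
    by (intro recursive_rec_nat recursive_intros n 1(1-3)[THEN recursive_comp])
  have val: "(real (pfst (R x k)) - real (pfst (psnd (R x k)))) / real (Suc (psnd (psnd (R x k)))) = (\<Sum>j<k. f x j)" for x k
  proof (induction k)
    case 0 then show ?case by (simp add: R_def)
  next
    case (Suc k)
    have "f x k = (real (a (pair x k)) - real (b (pair x k))) / real (Suc (c (pair x k)))"
      using 1(4)[of "pair x k"] by simp
    moreover have "R x (Suc k) = step x k (R x k)" by (simp add: R_def)
    ultimately show ?case
      by (simp only: sum.lessThan_Suc Suc[symmetric] fraction_add step_def Let_def pfst_pair psnd_pair)
  qed
  show ?thesis
    by (rule rat_funI[of "\<lambda>x. pfst (R x (n x))" "\<lambda>x. pfst (psnd (R x (n x)))" "\<lambda>x. psnd (psnd (R x (n x)))"])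
      (use val in \<open>auto intro!: recursive_intros R\<close>)
qed

section \<open>Constructive open sets\<close>

definition ball_radius :: "nat \<Rightarrow> real" where "ball_radius b = pos_rat_number (psnd b)"

lemma ideal_ball_eq: "ideal_ball s b = ball (s (pfst b)) (ball_radius b)"
  by (simp add: ideal_ball_def ball_radius_def prod_decode_eq_pair)

lemma pos_rat_number_pos: "0 < pos_rat_number k"
  by (simp add: pos_rat_number_def split: prod.splits)

lemma ball_radius_pos: "0 < ball_radius b"
  by (simp add: ball_radius_def pos_rat_number_pos)

lemma rat_fun_ball_radius [rat_fun_intros]: "recursive f \<Longrightarrow> rat_fun (\<lambda>x. ball_radius (f x))"
  unfolding ball_radius_def by (intro rat_fun_intros recursive_intros)

lemma pos_rat_number_between:
  assumes "a < b" "0 < b" obtains k where "a < pos_rat_number k" "pos_rat_number k < b"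
proof -
  obtain q where q: "q \<in> \<rat>" "max a 0 < q" "q < b"
    using Rats_dense_in_real[of "max a 0" b] assms by auto
  then have "q \<in> range pos_rat_number" unfolding range_pos_rat_number by auto
  with q show ?thesis using that by auto
qed

lemma rat_number_between:
  assumes "a < b" obtains k where "a < rat_number k" "rat_number k < b"
  using Rats_dense_in_real[OF assms] range_rat_number that by (metis imageE)

definition open_of :: "(nat \<Rightarrow> 'a::metric_space) \<Rightarrow> (nat \<Rightarrow> bool) \<Rightarrow> 'a set" where
  "open_of s P = (\<Union>b\<in>Collect P. ideal_ball s b)"

lemma open_open_of: "open (open_of s P)"
  unfolding open_of_def ideal_ball_eq by auto

lemma open_ofI: "P b \<Longrightarrow> x \<in> ideal_ball s b \<Longrightarrow> x \<in> open_of s P"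
  unfolding open_of_def by blast

lemma open_ofE: "x \<in> open_of s P \<Longrightarrow> (\<And>b. P b \<Longrightarrow> x \<in> ideal_ball s b \<Longrightarrow> thesis) \<Longrightarrow> thesis"
  unfolding open_of_def by blast

text \<open>The bridge between enumerating codes and formulas; from here on a constructive open set
  is a Sigma_1 predicate on ball numbers.\<close>

lemma uniformly_constructive_open_iff:
  "uniformly_constructive_open s U \<longleftrightarrow> (\<exists>E. semidecidable2 E \<and> (\<forall>i. U i = open_of s (E i)))"
proof
  assume "uniformly_constructive_open s U"
  then obtain r where r: "\<forall>i. U i = (\<Union>k \<in> {k. \<exists>n. evals r [i, n] k}. ideal_ball s k)"
    unfolding uniformly_constructive_open_def by blast
  have "semidecidable2 (\<lambda>i k. \<exists>n. evals r [i, n] k)"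
    by (intro semidecidable_intros recursive_intros)
  with r show "\<exists>E. semidecidable2 E \<and> (\<forall>i. U i = open_of s (E i))"
    unfolding open_of_def by (intro exI[of _ "\<lambda>i k. \<exists>n. evals r [i, n] k"] conjI) simp_all
next
  assume "\<exists>E. semidecidable2 E \<and> (\<forall>i. U i = open_of s (E i))"
  then obtain E where E: "semidecidable2 E" "\<And>i. U i = open_of s (E i)" by blast
  obtain r where "\<forall>i k. E i k \<longleftrightarrow> (\<exists>n. evals r [i, n] k)"
    using semidecidable2_enumerable[OF E(1)] by blast
  then have "Collect (E i) = {k. \<exists>n. evals r [i, n] k}" for i by (simp add: set_eq_iff)
  then show "uniformly_constructive_open s U"
    unfolding uniformly_constructive_open_def open_of_def E(2) by (intro exI[of _ r]) simp
qed

text \<open>The formal inclusion of ideal balls, which unlike the actual one is semidecidable.\<close>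

definition ball_below :: "(nat \<Rightarrow> 'a::metric_space) \<Rightarrow> nat \<Rightarrow> nat \<Rightarrow> bool" where
  "ball_below s b b' \<longleftrightarrow> dist (s (pfst b)) (s (pfst b')) < ball_radius b' - ball_radius b"

lemma ball_below_subset: "ball_below s b b' \<Longrightarrow> x \<in> ideal_ball s b \<Longrightarrow> x \<in> ideal_ball s b'"
  unfolding ball_below_def ideal_ball_eq mem_ball
  using dist_triangle[of "s (pfst b')" x "s (pfst b)"] by (simp add: dist_commute)

definition family_inter :: "(nat \<Rightarrow> 'a::metric_space) \<Rightarrow> nat set \<Rightarrow> (nat \<Rightarrow> nat \<Rightarrow> bool) \<Rightarrow> nat \<Rightarrow> bool" where
  "family_inter s I P b \<longleftrightarrow> (\<forall>i\<in>I. \<exists>b'. P i b' \<and> ball_below s b b')"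

locale cms =
  fixes s :: "nat \<Rightarrow> 'a::metric_space"
  assumes cms: "computable_metric_space s"
begin

lemma ex_ideal_near:
  assumes "0 < e" obtains i where "dist (s i) x < e"
proof -
  have "x \<in> closure (range s)" using cms unfolding computable_metric_space_def by simp
  then show ?thesis using that assms unfolding closure_approachable by blast
qed

lemma semidecidable_dist_less [semidecidable_intros]:
  assumes f: "recursive f" and g: "recursive g" and q: "rat_fun q"
  shows "semidecidable (\<lambda>x. dist (s (f x)) (s (g x)) < q x)"
proof -
  obtain r where r: "\<And>i j n. \<exists>k. evals r [i, j, n] k \<and> \<bar>rat_number k - dist (s i) (s j)\<bar> \<le> (1/2) ^ n"
    using cms unfolding computable_metric_space_def by blast
  \<comment> \<open>The error bound with variable exponent is weakened to one covered directly by
    \<open>rat_fun_intros\<close>; all that matters is that it tends to 0.\<close>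
  have le: "(1/2 :: real) ^ n \<le> 1 / real (Suc n)" for n
  proof -
    have "real (Suc n) \<le> 2 ^ n" by (induction n) auto
    then show ?thesis by (simp add: power_one_over frac_le del: of_nat_Suc)
  qed
  have "dist (s i) (s j) < c \<longleftrightarrow> (\<exists>n k. evals r [i, j, n] k \<and> rat_number k + 1 / real (Suc n) < c)" for i j c
  proof
    assume "dist (s i) (s j) < c"
    then obtain n where n: "1 / real (Suc n) < (c - dist (s i) (s j)) / 2"
      using nat_approx_posE[of "(c - dist (s i) (s j)) / 2"] by auto
    obtain k where k: "evals r [i, j, n] k" "\<bar>rat_number k - dist (s i) (s j)\<bar> \<le> (1/2) ^ n"
      using r by blast
    have "rat_number k + t < c" if "t < (c - dist (s i) (s j)) / 2" "(1/2) ^ n \<le> t" for t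
    proof -
      have "rat_number k \<le> dist (s i) (s j) + (1/2) ^ n" using k(2) by (simp add: abs_le_iff)
      then have "rat_number k \<le> dist (s i) (s j) + t" using that(2) by linarith
      moreover have "2 * t < c - dist (s i) (s j)" using that(1) by simp
      ultimately show ?thesis by linarith
    qed
    with n le[of n] have "rat_number k + 1 / real (Suc n) < c" by blast
    with k(1) show "\<exists>n k. evals r [i, j, n] k \<and> rat_number k + 1 / real (Suc n) < c" by blast
  next
    assume "\<exists>n k. evals r [i, j, n] k \<and> rat_number k + 1 / real (Suc n) < c"
    then obtain n k where k: "evals r [i, j, n] k" "rat_number k + 1 / real (Suc n) < c" by blast
    have "\<bar>rat_number k - dist (s i) (s j)\<bar> \<le> (1/2) ^ n"
      using r[of i j n] k(1) evals_deterministic by blast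
    then show "dist (s i) (s j) < c" using k(2) le[of n] by linarith
  qed
  then show ?thesis
    by (simp only:)
      (intro semidecidable_intros recursive_intros rat_fun_intros rat_fun_comp[OF q] recursive_comp[OF f] recursive_comp[OF g])
qed

lemma semidecidable_ball_below [semidecidable_intros]:
  "recursive f \<Longrightarrow> recursive g \<Longrightarrow> semidecidable (\<lambda>x. ball_below s (f x) (g x))"
  unfolding ball_below_def by (intro semidecidable_intros recursive_intros rat_fun_intros)

lemma ex_small_ball:
  assumes "finite F" "\<And>b. b \<in> F \<Longrightarrow> x \<in> ideal_ball s b" "0 < e"
  obtains b where "x \<in> ideal_ball s b" "ball_radius b < e" "\<And>b'. b' \<in> F \<Longrightarrow> ball_below s b b'"
proof -
  \<comment> \<open>Half of the gap, because the new radius is spent twice: once for the distance of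
    the new centre from \<open>x\<close>, once in the formal inclusion.\<close>
  define g where "g b = (ball_radius b - dist x (s (pfst b))) / 2" for b
  define d where "d = Min (insert e (g ` F))"
  have "0 < g b" if "b \<in> F" for b
    using assms(2)[OF that] by (simp add: g_def ideal_ball_eq dist_commute)
  then have "0 < d" using assms(1,3) by (simp add: d_def)
  then obtain k where k: "0 < pos_rat_number k" "pos_rat_number k < d"
    using pos_rat_number_between[of 0 d] by auto
  obtain i where i: "dist (s i) x < pos_rat_number k" using ex_ideal_near k(1) by blast
  define b where "b = pair i k"
  have b: "pfst b = i" "ball_radius b = pos_rat_number k" by (simp_all add: b_def ball_radius_def)
  show ?thesis
  proof
    show "x \<in> ideal_ball s b" by (simp add: ideal_ball_eq b i)
    show "ball_radius b < e" using k(2) assms(1) by (simp add: b d_def)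
    fix b' assume "b' \<in> F"
    then have "d \<le> g b'" using assms(1) by (simp add: d_def)
    then have "2 * ball_radius b < ball_radius b' - dist x (s (pfst b'))"
      using k(2) by (simp add: b g_def)
    then show "ball_below s b b'"
      using i dist_triangle[of "s i" "s (pfst b')" x] unfolding ball_below_def b by linarith
  qed
qed

text \<open>Formal inclusion loses no point of a finite intersection, because small enough balls
  around the point qualify. The control of the radius is what makes nested balls shrink in the
  search for a computable point.\<close>

lemma family_inter_small:
  assumes "finite I" "x \<in> (\<Inter>i\<in>I. open_of s (P i))" "0 < e"
  obtains b where "family_inter s I P b" "x \<in> ideal_ball s b" "ball_radius b < e"
proof -
  have "\<forall>i\<in>I. \<exists>b. P i b \<and> x \<in> ideal_ball s b" using assms(2) by (auto elim: open_ofE)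
  then obtain B where B: "\<forall>i\<in>I. P i (B i) \<and> x \<in> ideal_ball s (B i)" by metis
  obtain b where b: "x \<in> ideal_ball s b" "ball_radius b < e" "\<And>b'. b' \<in> B ` I \<Longrightarrow> ball_below s b b'"
    by (rule ex_small_ball[of "B ` I" x e]) (use B assms in auto)
  then have "family_inter s I P b" using B by (auto simp: family_inter_def)
  with b that show ?thesis by blast
qed

lemma open_of_family_inter:
  assumes "finite I"
  shows "open_of s (family_inter s I P) = (\<Inter>i\<in>I. open_of s (P i))"
proof (intro equalityI subsetI INT_I)
  fix x i assume "x \<in> open_of s (family_inter s I P)" "i \<in> I"
  then show "x \<in> open_of s (P i)"
    unfolding open_of_def family_inter_def by (auto dest: ball_below_subset)
next
  fix x assume "x \<in> (\<Inter>i\<in>I. open_of s (P i))"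
  from family_inter_small[OF assms this, of 1] show "x \<in> open_of s (family_inter s I P)"
    by (auto intro: open_ofI)
qed

lemma semidecidable_family_inter:
  assumes "semidecidable (\<lambda>p. P (pfst (pfst p)) (psnd (pfst p)) (psnd p))" "recursive n" "recursive b"
  shows "semidecidable (\<lambda>x. family_inter s {..<n x} (P x) (b x))"
proof -
  have P: "semidecidable (\<lambda>x. P (f x) (g x) (h x))" if "recursive f" "recursive g" "recursive h" for f g h
    using semidecidable_subst[OF assms(1), of "\<lambda>x. pair (pair (f x) (g x)) (h x)"] that by (simp add: recursive_intros)
  show ?thesis
    unfolding family_inter_def Ball_def lessThan_iff
    by (intro semidecidable_intros P recursive_intros assms recursive_comp[OF assms(3)])
qed

end

section \<open>Measures of constructive open sets are lower semicomputable\<close>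

lemma set_neighbourhood_mono: "\<epsilon> \<le> \<delta> \<Longrightarrow> set_neighbourhood A \<epsilon> \<subseteq> set_neighbourhood A \<delta>"
  by (auto simp: set_neighbourhood_def)

lemma set_neighbourhood_iff: "x \<in> set_neighbourhood A \<epsilon> \<longleftrightarrow> (\<exists>a\<in>A. dist x a < \<epsilon>)"
proof (cases "A = {}")
  case False
  then show ?thesis
    by (auto simp: set_neighbourhood_def infdist_notempty cInf_less_iff)
qed (simp add: set_neighbourhood_def)

lemma open_set_neighbourhood: "open (set_neighbourhood A \<epsilon>)"
proof -
  have "set_neighbourhood A \<epsilon> = (\<Union>a\<in>A. ball a \<epsilon>)"
    by (auto simp: set_neighbourhood_iff dist_commute)
  then show ?thesis by auto
qed

text \<open>The defining inequality is one-sided; the reverse one follows by applying it to the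
  complement of a neighbourhood. Strictness in \<open>prokhorov_dist M N < \<delta>\<close> is used
  because the infimum need not be attained.\<close>

lemma prokhorov_le:
  assumes M: "prob_space M" "sets M = sets borel" and N: "prob_space N" "sets N = sets borel"
    and d: "prokhorov_dist M N < \<delta>" and A: "A \<in> sets borel"
  shows "measure M A \<le> measure N (set_neighbourhood A \<delta>) + \<delta>"
    and "measure N A \<le> measure M (set_neighbourhood A \<delta>) + \<delta>"
proof -
  interpret M: prob_space M by fact
  interpret N: prob_space N by fact
  have sp: "space M = UNIV" "space N = UNIV"
    using sets_eq_imp_space_eq[OF M(2)] sets_eq_imp_space_eq[OF N(2)] by auto
  let ?S = "{\<epsilon>. \<epsilon> > 0 \<and> (\<forall>A \<in> sets borel. measure M A \<le> measure N (set_neighbourhood A \<epsilon>) + \<epsilon>)}"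
  have "measure M A \<le> measure N B + 1" for A B
    using M.prob_le_1[of A] measure_nonneg[of N B] by linarith
  then have "1 \<in> ?S" by simp
  then have "?S \<noteq> {}" by blast
  moreover have "bdd_below ?S" by (rule bdd_belowI[of _ 0]) auto
  ultimately obtain \<epsilon> where \<epsilon>: "\<epsilon> > 0" "\<epsilon> < \<delta>"
    "\<And>A. A \<in> sets borel \<Longrightarrow> measure M A \<le> measure N (set_neighbourhood A \<epsilon>) + \<epsilon>"
    using d unfolding prokhorov_dist_def by (subst (asm) cInf_less_iff) auto
  note nb = open_set_neighbourhood[THEN borel_open]
  have "measure N (set_neighbourhood A \<epsilon>) \<le> measure N (set_neighbourhood A \<delta>)"
    by (rule N.finite_measure_mono) (use \<epsilon>(2) nb N(2) in \<open>simp_all add: set_neighbourhood_mono\<close>)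
  moreover have "measure M (set_neighbourhood A \<epsilon>) \<le> measure M (set_neighbourhood A \<delta>)"
    by (rule M.finite_measure_mono) (use \<epsilon>(2) nb M(2) in \<open>simp_all add: set_neighbourhood_mono\<close>)
  ultimately have mono: "measure N (set_neighbourhood A \<epsilon>) \<le> measure N (set_neighbourhood A \<delta>)"
    "measure M (set_neighbourhood A \<epsilon>) \<le> measure M (set_neighbourhood A \<delta>)" .
  show "measure M A \<le> measure N (set_neighbourhood A \<delta>) + \<delta>"
    using \<epsilon>(3)[OF A] \<epsilon>(2) mono by linarith
  \<comment> \<open>Points near \<open>B\<close> cannot lie in \<open>A\<close>, so the inequality
    for \<open>B\<close> turns into the reverse inequality for \<open>A\<close> after taking
    complements.\<close>
  define B where "B = - set_neighbourhood A \<epsilon>"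
  have B: "B \<in> sets borel" unfolding B_def using open_set_neighbourhood[of A \<epsilon>] by auto
  have "set_neighbourhood B \<epsilon> \<subseteq> - A"
    unfolding B_def by (auto simp: set_neighbourhood_iff) (metis dist_commute)
  then have "measure N (set_neighbourhood B \<epsilon>) \<le> measure N (- A)"
    using A N(2) by (intro N.finite_measure_mono) auto
  moreover have "measure N (- A) = 1 - measure N A"
    using N.prob_compl[of A] A N(2) sp by (simp add: Compl_eq_Diff_UNIV)
  moreover have "measure M B = 1 - measure M (set_neighbourhood A \<epsilon>)"
    using M.prob_compl[of "set_neighbourhood A \<epsilon>"] open_set_neighbourhood[of A \<epsilon>] M(2) sp
    by (simp add: Compl_eq_Diff_UNIV B_def)
  ultimately show "measure N A \<le> measure M (set_neighbourhood A \<delta>) + \<delta>"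
    using \<epsilon>(3)[OF B] \<epsilon>(2) mono by linarith
qed

lemma prob_space_ideal_measure: "prob_space (ideal_measure s k)"
  unfolding ideal_measure_def by (rule prob_space.prob_space_distr[OF prob_space_measure_pmf]) simp

lemma sets_ideal_measure: "sets (ideal_measure s k) = sets borel"
  by (simp add: ideal_measure_def)

lemma measure_ideal_measure:
  assumes "pmf_of_list_wf (weighted_points s k)" "A \<in> sets borel"
  shows "measure (ideal_measure s k) A =
    (\<Sum>j<length (list_decode k). if s (pfst (lnth k j)) \<in> A then rat_number (psnd (lnth k j)) else 0)"
proof -
  have "measure (ideal_measure s k) A = measure (measure_pmf (pmf_of_list (weighted_points s k))) A"
    unfolding ideal_measure_def by (subst measure_distr) (use assms in auto)
  also have "\<dots> = sum_list (map snd (filter (\<lambda>x. fst x \<in> A) (weighted_points s k)))"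
    by (rule measure_pmf_of_list) fact
  also have "\<dots> = sum_list (map (\<lambda>x. if fst x \<in> A then snd x else 0) (weighted_points s k))"
    by (rule sum_list_map_filter'[where f = snd])
  also have "\<dots> = sum_list (map (\<lambda>c. if s (pfst c) \<in> A then rat_number (psnd c) else 0) (list_decode k))"
    by (simp add: weighted_points_def o_def prod_decode_eq_pair cong: if_cong)
  also have "\<dots> = (\<Sum>j<length (list_decode k). if s (pfst (lnth k j)) \<in> A then rat_number (psnd (lnth k j)) else 0)"
    by (subst sum_list_sum_nth) (auto simp: lnth_list_decode atLeast0LessThan intro!: sum.cong)
  finally show ?thesis .
qed

lemma weight_nonneg:
  assumes "pmf_of_list_wf (weighted_points s k)"
  shows "0 \<le> rat_number (psnd (lnth k j))"
proof (cases "j < length (list_decode k)")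
  case True
  then have "rat_number (psnd (list_decode k ! j)) \<in> snd ` set (weighted_points s k)"
    by (force simp: weighted_points_def prod_decode_eq_pair image_iff)
  then show ?thesis using assms True by (auto simp: pmf_of_list_wf_def lnth_list_decode)
next
  case False
  have "rat_number 0 = 0" by (simp add: rat_number_eq pfst_def prod_decode_0 int_decode_def sum_decode_def)
  then show ?thesis using False by (simp add: lnth_list_decode psnd_def prod_decode_0)
qed

text \<open>\<open>F\<close> is a 0/1 certificate selecting atoms known to lie in \<open>A\<close>.
  Omitting atoms only lowers the sum, since weights are nonnegative, and indices past the end of the
  list have weight 0, so \<open>n\<close> need not be tied to the length.\<close>

lemma ideal_measure_ge:
  assumes wf: "pmf_of_list_wf (weighted_points s k)" and A: "A \<in> sets borel"
    and F: "\<And>j. j < n \<Longrightarrow> F j = 0 \<or> F j = 1 \<and> s (pfst (lnth k j)) \<in> A"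
  shows "(\<Sum>j<n. real (F j) * rat_number (psnd (lnth k j))) \<le> measure (ideal_measure s k) A"
proof -
  let ?g = "\<lambda>j. if s (pfst (lnth k j)) \<in> A then rat_number (psnd (lnth k j)) else 0"
  have z: "rat_number (psnd (lnth k j)) = 0" if "j \<ge> length (list_decode k)" for j
    using that by (simp add: lnth_list_decode psnd_def prod_decode_0 rat_number_eq pfst_def
        int_decode_def sum_decode_def)
  have "(\<Sum>j<n. real (F j) * rat_number (psnd (lnth k j))) \<le> (\<Sum>j<n. ?g j)"
    using F weight_nonneg[OF wf] by (intro sum_mono) fastforce
  also have "\<dots> \<le> (\<Sum>j<max n (length (list_decode k)). ?g j)"
    using weight_nonneg[OF wf] by (intro sum_mono2) auto
  also have "\<dots> = (\<Sum>j<length (list_decode k). ?g j)"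
    using z by (intro sum.mono_neutral_right) auto
  finally show ?thesis using measure_ideal_measure[OF wf A] by simp
qed

text \<open>Shrinking is done ball by ball, so the result depends on the code \<open>P\<close> and
  not only on the open set. In return, membership of an ideal point is Sigma_1 when \<open>P\<close>
  is and the margin is rational.\<close>

definition inner_open :: "(nat \<Rightarrow> 'a::metric_space) \<Rightarrow> (nat \<Rightarrow> bool) \<Rightarrow> real \<Rightarrow> 'a set" where
  "inner_open s P \<delta> = (\<Union>b\<in>Collect P. {x. dist x (s (pfst b)) < ball_radius b - \<delta>})"

lemma inner_open_eq: "inner_open s P \<delta> = (\<Union>b\<in>Collect P. ball (s (pfst b)) (ball_radius b - \<delta>))"
  by (auto simp: inner_open_def dist_commute)

lemma open_inner_open: "open (inner_open s P \<delta>)"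
  unfolding inner_open_eq by auto

lemma sets_inner_open [simp]: "inner_open s P \<delta> \<in> sets borel"
  using open_inner_open by (rule borel_open)

lemma set_neighbourhood_inner_open:
  "set_neighbourhood (inner_open s P (\<delta> + \<epsilon>)) \<epsilon> \<subseteq> inner_open s P \<delta>"
proof
  fix x assume "x \<in> set_neighbourhood (inner_open s P (\<delta> + \<epsilon>)) \<epsilon>"
  then obtain y b where "P b" "dist y (s (pfst b)) < ball_radius b - (\<delta> + \<epsilon>)" "dist x y < \<epsilon>"
    by (auto simp: set_neighbourhood_iff inner_open_def)
  moreover have "dist x (s (pfst b)) \<le> dist x y + dist y (s (pfst b))" by (rule dist_triangle)
  ultimately have "dist x (s (pfst b)) < ball_radius b - \<delta>" by linarith
  with \<open>P b\<close> show "x \<in> inner_open s P \<delta>" by (auto simp: inner_open_def)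
qed

lemma inner_open_0: "inner_open s P 0 = open_of s P"
  by (auto simp: inner_open_def open_of_def ideal_ball_eq dist_commute)

locale cps =
  fixes s :: "nat \<Rightarrow> 'a::metric_space" and M :: "'a measure"
  assumes cps: "computable_prob_space s M"
begin

sublocale cms s
  using cps by unfold_locales (simp add: computable_prob_space_def)

sublocale prob_space M
  using cps by (simp add: computable_prob_space_def)

lemma sets_M [measurable_cong, simp]: "sets M = sets borel"
  using cps by (simp add: computable_prob_space_def)

lemma space_M [simp]: "space M = UNIV"
  using sets_eq_imp_space_eq[OF sets_M] by simp

lemma sets_open_of [measurable, simp]: "open_of s P \<in> sets borel"
  using open_open_of by (rule borel_open)

lemma semidecidable_measure_open_of:
  assumes E: "semidecidable2 E"
  shows "semidecidable2 (\<lambda>e q. pos_rat_number q < measure M (open_of s (E e)))"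
proof -
  obtain r where r: "\<And>n. \<exists>k. evals r [n] k \<and> pmf_of_list_wf (weighted_points s k) \<and>
      prokhorov_dist (ideal_measure s k) M \<le> (1/2) ^ n"
    using cps unfolding computable_prob_space_def computable_measure_def by blast
  \<comment> \<open>The factor 2 makes the bound strict already at \<open>N = 0\<close>, as
    \<open>prokhorov_le\<close> demands.\<close>
  define \<delta> where "\<delta> N = 2 / real (Suc N)" for N
  have \<delta>: "(1/2 :: real) ^ N < \<delta> N" for N
  proof -
    have "real (Suc N) < 2 * 2 ^ N" by (induction N) auto
    then show ?thesis by (simp add: power_one_over \<delta>_def divide_simps del: of_nat_Suc)
  qed
  \<comment> \<open>The certificate: an accuracy \<open>N\<close>, the approximating measure
    \<open>k\<close> that \<open>r\<close> computes for it, and a 0/1 sequence \<open>F\<close>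
    marking atoms with margin \<open>\<delta> N\<close>. Any marking is sound; a sufficiently
    complete one succeeds. Well-formedness of \<open>k\<close> follows from determinism of
    \<open>r\<close>.\<close>
  define Q where "Q e q \<longleftrightarrow> (\<exists>N k n F. evals r [N] k \<and>
    (\<forall>j<n. lnth F j = 0 \<or> lnth F j = 1 \<and>
       (\<exists>b. E e b \<and> dist (s (pfst (lnth k j))) (s (pfst b)) < ball_radius b - 2 * (1 / real (Suc N)))) \<and>
    pos_rat_number q + 2 * (1 / real (Suc N)) < (\<Sum>j<n. real (lnth F j) * rat_number (psnd (lnth k j))))" for e q
  have "semidecidable2 Q"
    unfolding Q_def
    by (intro semidecidable_intros semidecidable2_subst[OF E] rat_fun_intros rat_fun_sum recursive_intros)
  moreover have "pos_rat_number q < measure M (open_of s (E e)) \<longleftrightarrow> Q e q" for e q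
  proof
    assume q: "pos_rat_number q < measure M (open_of s (E e))"
    \<comment> \<open>One half of the margin is consumed in passing from \<open>M\<close> to the
      approximating measure; the other half is the margin required of the atoms.\<close>
    let ?V = "\<lambda>N. inner_open s (E e) (\<delta> N + \<delta> N)"
    have tend: "(\<lambda>N. measure M (?V N) - 2 * \<delta> N) \<longlonglongrightarrow> measure M (\<Union>N. ?V N) - 2 * 0"
    proof (intro tendsto_diff tendsto_mult_left finite_Lim_measure_incseq)
      show "\<delta> \<longlonglongrightarrow> 0" unfolding \<delta>_def
        using LIMSEQ_inverse_real_of_nat[THEN tendsto_mult_left, of 2] by (simp add: inverse_eq_divide)
      show "incseq ?V"
      proof (rule incseq_SucI)
        fix N
        have "\<delta> (Suc N) \<le> \<delta> N" by (simp add: \<delta>_def field_simps)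
        then show "?V N \<subseteq> ?V (Suc N)" by (force simp: inner_open_def)
      qed
    qed (use open_inner_open in auto)
    have "(\<Union>N. ?V N) = open_of s (E e)"
    proof (intro equalityI subsetI)
      fix x assume "x \<in> open_of s (E e)"
      then obtain b where b: "E e b" "0 < ball_radius b - dist x (s (pfst b))"
        unfolding open_of_def ideal_ball_eq by (auto simp: dist_commute)
      then obtain N where "1 / real (Suc N) < (ball_radius b - dist x (s (pfst b))) / 4"
        using nat_approx_posE[of "(ball_radius b - dist x (s (pfst b))) / 4"] by auto
      then have "4 * (1 / real (Suc N)) < ball_radius b - dist x (s (pfst b))"
        by (simp only: less_divide_eq_numeral1(1) mult.commute)
      moreover have "\<delta> N = 2 * (1 / real (Suc N))" by (simp add: \<delta>_def)
      ultimately have "dist x (s (pfst b)) < ball_radius b - (\<delta> N + \<delta> N)" by linarith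
      with b(1) show "x \<in> (\<Union>N. ?V N)" by (auto simp: inner_open_def)
    next
      fix x assume "x \<in> (\<Union>N. ?V N)"
      then obtain N b where "E e b" "dist x (s (pfst b)) < ball_radius b - (\<delta> N + \<delta> N)"
        by (auto simp: inner_open_def)
      moreover have "\<delta> N > 0" by (simp add: \<delta>_def)
      ultimately show "x \<in> open_of s (E e)"
        unfolding open_of_def ideal_ball_eq by (force simp: dist_commute)
    qed
    with tend q have "\<forall>\<^sub>F N in sequentially. pos_rat_number q < measure M (?V N) - 2 * \<delta> N"
      by (intro order_tendstoD(1)) auto
    then obtain N where N: "pos_rat_number q < measure M (?V N) - 2 * \<delta> N"
      unfolding eventually_sequentially by blast
    obtain k where k: "evals r [N] k" "pmf_of_list_wf (weighted_points s k)"
      "prokhorov_dist (ideal_measure s k) M \<le> (1/2) ^ N" using r by blast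
    have "measure M (?V N) \<le> measure (ideal_measure s k) (set_neighbourhood (?V N) (\<delta> N)) + \<delta> N"
      using prokhorov_le(2)[OF prob_space_ideal_measure sets_ideal_measure prob_space_axioms sets_M,
          of s k "\<delta> N" "?V N"] k(3) \<delta>[of N] open_inner_open by auto
    also have "measure (ideal_measure s k) (set_neighbourhood (?V N) (\<delta> N)) \<le>
        measure (ideal_measure s k) (inner_open s (E e) (\<delta> N))"
    proof -
      interpret I: prob_space "ideal_measure s k" by (rule prob_space_ideal_measure)
      show ?thesis
        by (intro I.finite_measure_mono set_neighbourhood_inner_open)
          (simp add: sets_ideal_measure)
    qed
    finally have m: "pos_rat_number q + \<delta> N < measure (ideal_measure s k) (inner_open s (E e) (\<delta> N))"
      using N by simp
    let ?n = "length (list_decode k)"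
    obtain F where F: "\<forall>j<?n. lnth F j = (if s (pfst (lnth k j)) \<in> inner_open s (E e) (\<delta> N) then 1 else 0)"
      using ex_lnth[of ?n "\<lambda>j. if s (pfst (lnth k j)) \<in> inner_open s (E e) (\<delta> N) then 1 else 0"] ..
    have "measure (ideal_measure s k) (inner_open s (E e) (\<delta> N)) =
        (\<Sum>j<?n. real (lnth F j) * rat_number (psnd (lnth k j)))"
      using F open_inner_open by (subst measure_ideal_measure[OF k(2)]) (auto intro!: sum.cong)
    with m have G1: "pos_rat_number q + 2 * (1 / real (Suc N)) < (\<Sum>j<?n. real (lnth F j) * rat_number (psnd (lnth k j)))"
      by (simp add: \<delta>_def)
    have G2: "lnth F j = 0 \<or> lnth F j = 1 \<and>
       (\<exists>b. E e b \<and> dist (s (pfst (lnth k j))) (s (pfst b)) < ball_radius b - 2 * (1 / real (Suc N)))" if "j < ?n" for j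
      using F[rule_format, OF that] by (simp add: inner_open_def \<delta>_def split: if_splits)
    show "Q e q"
      unfolding Q_def
      by (intro exI[of _ N] exI[of _ k] exI[of _ ?n] exI[of _ F] conjI allI impI k(1) G1 G2)
  next
    assume "Q e q"
    then obtain N k n F where k: "evals r [N] k" and
      F: "\<forall>j<n. lnth F j = 0 \<or> lnth F j = 1 \<and> s (pfst (lnth k j)) \<in> inner_open s (E e) (\<delta> N)"
      and m: "pos_rat_number q + \<delta> N < (\<Sum>j<n. real (lnth F j) * rat_number (psnd (lnth k j)))"
      unfolding Q_def \<delta>_def by (auto simp: inner_open_def)
    have k': "pmf_of_list_wf (weighted_points s k)" "prokhorov_dist (ideal_measure s k) M \<le> (1/2) ^ N"
      using r[of N] evals_deterministic[OF k] by auto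
    have "(\<Sum>j<n. real (lnth F j) * rat_number (psnd (lnth k j))) \<le>
        measure (ideal_measure s k) (inner_open s (E e) (\<delta> N))"
      using F open_inner_open by (intro ideal_measure_ge[OF k'(1)]) auto
    also have "\<dots> \<le> measure M (set_neighbourhood (inner_open s (E e) (\<delta> N)) (\<delta> N)) + \<delta> N"
      using prokhorov_le(1)[OF prob_space_ideal_measure sets_ideal_measure prob_space_axioms sets_M,
          of s k "\<delta> N"] k'(2) \<delta>[of N] open_inner_open by auto
    also have "measure M (set_neighbourhood (inner_open s (E e) (\<delta> N)) (\<delta> N)) \<le> measure M (open_of s (E e))"
      using set_neighbourhood_inner_open[of s "E e" 0 "\<delta> N"]
      by (intro finite_measure_mono) (auto simp: inner_open_0)
    finally show "pos_rat_number q < measure M (open_of s (E e))" using m by linarith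
  qed
  ultimately show ?thesis by simp
qed

end

section \<open>Computable points in constructive Borel--Cantelli sets\<close>

lemma (in cps) sets_ideal_ball [simp]: "ideal_ball s b \<in> sets borel"
  unfolding ideal_ball_eq by (rule borel_open) simp

text \<open>There are only countably many ideal balls, so if all admissible ones met
  \<open>F\<close> in null sets, the set covered by them would be null.\<close>

lemma (in cps) ex_ball_positive_measure:
  assumes "0 < measure M (G \<inter> F)" "G \<in> sets borel" "F \<in> sets borel" "G \<inter> F \<subseteq> (\<Union>b\<in>Collect P. ideal_ball s b)"
  shows "\<exists>b. P b \<and> 0 < measure M (ideal_ball s b \<inter> F)"
proof (rule ccontr)
  assume "\<nexists>b. P b \<and> 0 < measure M (ideal_ball s b \<inter> F)"
  then have 0: "P b \<Longrightarrow> measure M (ideal_ball s b \<inter> F) = 0" for b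
    using measure_nonneg[of M "ideal_ball s b \<inter> F"] by (meson antisym_conv2 not_less)
  let ?A = "\<lambda>b. if P b then ideal_ball s b \<inter> F else {}"
  have A0: "measure M (?A b) = 0" for b using 0 by simp
  have "measure M (G \<inter> F) \<le> measure M (\<Union>b. ?A b)"
  proof (rule finite_measure_mono)
    show "(\<Union>b. ?A b) \<in> sets M" by (rule sets.countable_UN) (use assms(3) in auto)
  qed (use assms(4) in \<open>auto split: if_splits\<close>)
  also have "\<dots> \<le> (\<Sum>b. measure M (?A b))"
    by (rule finite_measure_subadditive_countably) (use assms(3) A0 in auto)
  also have "\<dots> = 0" by (simp only: A0 suminf_zero)
  finally show False using assms(1) by simp
qed

text \<open>
  A state \<open>((b, m), e)\<close> of the search consists of an ideal ball, a stage and a rational number such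
  that the part of the ball lying in the first \<open>m\<close> of the open sets has measure more than \<open>e\<close>,
  while the complements of the remaining ones have total measure at most \<open>e\<close>. So the ball meets the
  Borel--Cantelli set in positive measure, and a smaller ball with the same property exists.
\<close>

theorem (in cps) borel_cantelli_computable_point:
  assumes BC: "constructive_borel_cantelli s M C" and compl: "Topological_Spaces.complete (UNIV :: 'a set)"
  shows "\<exists>x\<in>C. computable_point s x"
proof -
  obtain U where U: "uniformly_constructive_open s U" "effectively_summable (\<lambda>n. measure M (- U n))"
    and C: "C = (\<Union>k. \<Inter>n\<in>{k..}. U n)"
    using BC unfolding constructive_borel_cantelli_def by blast
  obtain E where E: "semidecidable2 E" "\<And>i. U i = open_of s (E i)"
    using U(1) unfolding uniformly_constructive_open_iff by blast
  define a where "a n = measure M (- U n)" for n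
  obtain r and A :: "real \<Rightarrow> nat" where a: "summable a" and r: "\<And>k. evals r [k] (A (pos_rat_number k))"
    and A: "\<And>\<epsilon>. \<epsilon> \<in> \<rat> \<Longrightarrow> \<epsilon> > 0 \<Longrightarrow> (\<Sum>i. a (i + A \<epsilon>)) \<le> \<epsilon>"
    using U(2) unfolding effectively_summable_def a_def by blast
  have A': "(\<Sum>i. a (i + A (pos_rat_number e))) \<le> pos_rat_number e" for e
    using A[of "pos_rat_number e"] range_pos_rat_number by auto
  define tail where "tail m = (\<Sum>i. a (i + m))" for m
  have tail_mono: "tail m' \<le> tail m" if "m \<le> m'" for m m'
  proof -
    have "summable (\<lambda>i. a (i + m))" using a by (simp add: summable_iff_shift)
    from suminf_split_initial_segment[OF this, of "m' - m"] that
    have "tail m = tail m' + (\<Sum>i<m' - m. a (i + m))" by (simp add: tail_def add.assoc)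
    then show ?thesis by (simp add: a_def sum_nonneg)
  qed
  have sets_U: "U n \<in> sets borel" for n unfolding E(2) by simp
  \<comment> \<open>Total failure probability at most 1/2 from \<open>k0\<close> on leaves
    \<open>F\<close> positive measure; the search then aims at \<open>F\<close>, one member of the
    union that makes up \<open>C\<close>.\<close>
  define k0 where "k0 = A (1/2)"
  have k0: "tail k0 \<le> 1/2" unfolding tail_def k0_def by (rule A) auto
  define F where "F = (\<Inter>n\<in>{k0..}. U n)"
  have sets_F: "F \<in> sets borel" unfolding F_def using sets_U by (intro sets.countable_INT'') auto
  have tail_bound: "measure M (W \<inter> (\<Inter>n\<in>{k0..<m}. U n)) \<le> measure M (W \<inter> F) + tail m"
    if "W \<in> sets borel" "k0 \<le> m" for W m
  proof -
    have "W \<inter> (\<Inter>n\<in>{k0..<m}. U n) \<subseteq> (W \<inter> F) \<union> (\<Union>i. - U (i + m))"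
    proof
      fix x assume x: "x \<in> W \<inter> (\<Inter>n\<in>{k0..<m}. U n)"
      show "x \<in> (W \<inter> F) \<union> (\<Union>i. - U (i + m))"
      proof (cases "x \<in> F")
        case False
        then obtain n where n: "n \<ge> k0" "x \<notin> U n" unfolding F_def by auto
        with x have "n \<ge> m" by force
        then have "x \<in> - U ((n - m) + m)" using n by simp
        then show ?thesis by blast
      qed (use x in auto)
    qed
    then have "measure M (W \<inter> (\<Inter>n\<in>{k0..<m}. U n)) \<le> measure M ((W \<inter> F) \<union> (\<Union>i. - U (i + m)))"
      by (rule finite_measure_mono) (use that sets_F sets_U in auto)
    also have "\<dots> \<le> measure M (W \<inter> F) + measure M (\<Union>i. - U (i + m))"
      by (rule measure_Un_le) (use that sets_F sets_U in auto)
    also have "measure M (\<Union>i. - U (i + m)) \<le> (\<Sum>i. measure M (- U (i + m)))"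
    proof (rule finite_measure_subadditive_countably)
      show "summable (\<lambda>i. measure M (- U (i + m)))"
        using a summable_iff_shift[of a m] by (simp add: a_def)
    qed (use sets_U in auto)
    finally show ?thesis by (simp add: tail_def a_def)
  qed
  have "1 \<le> measure M F + tail k0"
    using tail_bound[of UNIV k0] prob_space by simp
  with k0 have F_pos: "0 < measure M F" by simp
  \<comment> \<open>Family 0 is the current ball and family \<open>Suc n\<close> is
    \<open>U n\<close>, replaced by the whole space for \<open>n < k0\<close>. Thus
    \<open>Q x\<close> codes the part of the ball in \<open>U k0\<close>, ...,
    \<open>U (psnd x - 1)\<close>.\<close>
  define P where "P x i b' \<longleftrightarrow> i = 0 \<and> b' = pfst x \<or> 0 < i \<and> (i - 1 < k0 \<or> E (i - 1) b')" for x i b'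
  define Q where "Q x = family_inter s {..<Suc (psnd x)} (P x)" for x
  have semidecidable_Q: "semidecidable2 Q"
    unfolding Q_def P_def
    by (intro semidecidable_family_inter semidecidable_intros semidecidable2_subst[OF E(1)] recursive_intros)
  have Q_inter: "(\<Inter>i<Suc (psnd x). open_of s (P x i)) = ideal_ball s (pfst x) \<inter> (\<Inter>n\<in>{k0..<psnd x}. U n)" for x
  proof -
    have "open_of s (P x 0) = ideal_ball s (pfst x)" by (auto simp: open_of_def P_def)
    moreover have "open_of s (P x (Suc n)) = (if n < k0 then UNIV else U n)" for n
    proof (cases "n < k0")
      case True
      have "x' \<in> open_of s (P x (Suc n))" for x'
      proof -
        obtain b where "x' \<in> ideal_ball s b" using ex_small_ball[of "{}" x' 1] by auto
        then show ?thesis by (rule open_ofI[rotated]) (simp add: P_def True)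
      qed
      then show ?thesis using True by auto
    next
      case False
      then have "P x (Suc n) = E n" by (intro ext) (simp add: P_def)
      then show ?thesis using False by (simp add: E(2))
    qed
    ultimately show ?thesis
      by (auto simp: lessThan_Suc_eq_insert_0 split: if_splits)
  qed
  have open_Q: "open_of s (Q x) = ideal_ball s (pfst x) \<inter> (\<Inter>n\<in>{k0..<psnd x}. U n)" for x
    unfolding Q_def open_of_family_inter[OF finite_lessThan] by (rule Q_inter)
  define I where "I v \<longleftrightarrow> pos_rat_number (psnd v) < measure M (open_of s (Q (pfst v))) \<and>
    k0 \<le> psnd (pfst v) \<and> tail (psnd (pfst v)) \<le> pos_rat_number (psnd v)" for v
  \<comment> \<open>The tail condition of \<open>I\<close> is not tested. It is enforced by taking
    the new stage to be \<open>t + Suc\<close> of the old one, with \<open>t\<close> the computed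
    modulus for the new rational; the summand also makes stages increase strictly, so every
    \<open>U n\<close> from \<open>k0\<close> on is eventually imposed.\<close>
  define R where "R v w \<longleftrightarrow> Q (pfst v) (pfst (pfst w)) \<and>
    2 * ball_radius (pfst (pfst w)) < ball_radius (pfst (pfst v)) \<and>
    (\<exists>t. evals r [psnd w] t \<and> psnd (pfst w) = t + Suc (psnd (pfst v))) \<and>
    pos_rat_number (psnd w) < measure M (open_of s (Q (pfst w)))" for v w
  have "semidecidable2 R"
    unfolding R_def
    by (intro semidecidable_intros semidecidable2_subst[OF semidecidable_Q] semidecidable2_subst[OF semidecidable_measure_open_of[OF semidecidable_Q]]
        rat_fun_intros recursive_intros)
  have new_state: "\<exists>e. let w = pair (pair b (A (pos_rat_number e) + j)) e in I w"
    if "0 < measure M (ideal_ball s b \<inter> F)" "k0 \<le> j" for b j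
  proof -
    obtain e where e: "pos_rat_number e < measure M (ideal_ball s b \<inter> F)"
      by (rule pos_rat_number_between[OF \<open>0 < measure M (ideal_ball s b \<inter> F)\<close> \<open>0 < measure M (ideal_ball s b \<inter> F)\<close>])
    also have "\<dots> \<le> measure M (open_of s (Q (pair b (A (pos_rat_number e) + j))))"
    proof (rule finite_measure_mono)
      show "ideal_ball s b \<inter> F \<subseteq> open_of s (Q (pair b (A (pos_rat_number e) + j)))"
        by (auto simp: open_Q F_def)
    qed simp
    finally have "pos_rat_number e < \<dots>" .
    moreover have "tail (A (pos_rat_number e) + j) \<le> pos_rat_number e"
      using tail_mono[of "A (pos_rat_number e)" "A (pos_rat_number e) + j"] A'[of e]
      by (simp add: tail_def)
    ultimately show ?thesis using that(2) by (intro exI[of _ e]) (simp add: Let_def I_def)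
  qed
  have "\<exists>b. ball_radius b < 1 \<and> 0 < measure M (ideal_ball s b \<inter> F)"
  proof (rule ex_ball_positive_measure[of UNIV])
    show "UNIV \<inter> F \<subseteq> (\<Union>b\<in>{b. ball_radius b < 1}. ideal_ball s b)"
    proof
      fix x
      obtain b where "x \<in> ideal_ball s b" "ball_radius b < 1" using ex_small_ball[of "{}" x 1] by auto
      then show "x \<in> (\<Union>b\<in>{b. ball_radius b < 1}. ideal_ball s b)" by blast
    qed
  qed (use F_pos sets_F in auto)
  then obtain b0 v0 where v0: "ball_radius b0 < 1" "pfst (pfst v0) = b0" "I v0"
    using new_state[of _ k0] by (metis order_refl pfst_pair)
  have step: "\<exists>w. R v w" if "I v" for v
  proof -
    let ?b = "pfst (pfst v)" and ?m = "psnd (pfst v)"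
    have "0 < measure M (ideal_ball s ?b \<inter> F)"
      using that tail_bound[of "ideal_ball s ?b" ?m] unfolding I_def open_Q by auto
    then have "\<exists>b'. (Q (pfst v) b' \<and> 2 * ball_radius b' < ball_radius ?b) \<and> 0 < measure M (ideal_ball s b' \<inter> F)"
    proof (rule ex_ball_positive_measure)
      show "ideal_ball s ?b \<inter> F \<subseteq> (\<Union>b'\<in>{b'. Q (pfst v) b' \<and> 2 * ball_radius b' < ball_radius ?b}. ideal_ball s b')"
      proof
        fix x assume "x \<in> ideal_ball s ?b \<inter> F"
        then have "x \<in> (\<Inter>i<Suc (psnd (pfst v)). open_of s (P (pfst v) i))"
          unfolding Q_inter by (auto simp: F_def)
        then obtain b' where "Q (pfst v) b'" "x \<in> ideal_ball s b'" "ball_radius b' < ball_radius ?b / 2"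
          unfolding Q_def using family_inter_small[of "{..<Suc (psnd (pfst v))}" x "P (pfst v)" "ball_radius ?b / 2"]
          ball_radius_pos[of ?b] by auto
        then show "x \<in> (\<Union>b'\<in>{b'. Q (pfst v) b' \<and> 2 * ball_radius b' < ball_radius ?b}. ideal_ball s b')"
          by auto
      qed
    qed (use sets_F in auto)
    then obtain b' where b': "Q (pfst v) b'" "2 * ball_radius b' < ball_radius ?b"
      "0 < measure M (ideal_ball s b' \<inter> F)" by blast
    have "k0 \<le> Suc ?m" using that by (simp add: I_def)
    from new_state[OF b'(3) this] obtain e where
      "I (pair (pair b' (A (pos_rat_number e) + Suc ?m)) e)" by (auto simp: Let_def)
    then have "R v (pair (pair b' (A (pos_rat_number e) + Suc ?m)) e)"
      unfolding R_def I_def using b' r[of e] by auto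
    then show ?thesis ..
  qed
  have "I w" if "I v" "R v w" for v w
  proof -
    obtain t where t: "evals r [psnd w] t" "psnd (pfst w) = t + Suc (psnd (pfst v))"
      using \<open>R v w\<close> unfolding R_def by blast
    have "t = A (pos_rat_number (psnd w))" using evals_deterministic[OF t(1) r] .
    then have "tail (psnd (pfst w)) \<le> pos_rat_number (psnd w)"
      using tail_mono[of t "psnd (pfst w)"] A'[of "psnd w"] t(2) by (simp add: tail_def)
    then show ?thesis using that t(2) unfolding I_def R_def by auto
  qed
  then obtain f where f: "recursive f" "f 0 = v0" "\<And>n. I (f n) \<and> R (f n) (f (Suc n))"
    using semidecidable_dependent_choice[OF \<open>semidecidable2 R\<close>, of I v0] v0(3) step by metis
  define B where "B n = pfst (pfst (f n))" for n
  define c where "c n = s (pfst (B n))" for n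
  define \<rho> where "\<rho> n = ball_radius (B n)" for n
  have Q: "Q (pfst (f n)) (B (Suc n))" for n using f(3)[of n] unfolding R_def B_def by blast
  have below: "dist (c (Suc n)) (c n) < \<rho> n - \<rho> (Suc n)" for n
    using Q[of n] by (auto simp: Q_def family_inter_def P_def ball_below_def c_def \<rho>_def B_def dest: bspec[of _ _ 0])
  have \<rho>_half: "2 * \<rho> (Suc n) < \<rho> n" for n using f(3)[of n] unfolding R_def B_def \<rho>_def by blast
  have \<rho>_le: "\<rho> n \<le> (1/2) ^ n" for n
  proof (induction n)
    case 0 show ?case using v0 f(2) by (simp add: \<rho>_def B_def)
  next
    case (Suc n) then show ?case using \<rho>_half[of n] by simp
  qed
  have \<rho>_pos: "0 < \<rho> n" for n by (simp add: \<rho>_def ball_radius_pos)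
  have dist_c: "dist (c (n + j)) (c n) \<le> \<rho> n - \<rho> (n + j)" for n j
  proof (induction j)
    case (Suc j)
    have "dist (c (n + Suc j)) (c n) \<le> dist (c (Suc (n + j))) (c (n + j)) + dist (c (n + j)) (c n)"
      using dist_triangle by simp
    then show ?case using Suc below[of "n + j"] by simp
  qed simp
  have "Cauchy c"
  proof (rule metric_CauchyI)
    fix e :: real assume "0 < e"
    then obtain N where N: "(1/2) ^ N < e / 2" using real_arch_pow_inv[of "e / 2" "1/2"] by auto
    have *: "dist (c m) (c N) < e / 2" if "m \<ge> N" for m
      using dist_c[of N "m - N"] \<rho>_pos[of m] \<rho>_le[of N] N that by simp
    show "\<exists>M. \<forall>m\<ge>M. \<forall>n\<ge>M. dist (c m) (c n) < e"
      using dist_triangle_half_l[OF *] by (metis * dist_commute dist_triangle_half_l)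
  qed
  then obtain x where x: "c \<longlonglongrightarrow> x" using completeE[OF compl _ \<open>Cauchy c\<close>] by auto
  have "dist x (c n) \<le> \<rho> n" for n
  proof (rule LIMSEQ_le_const2)
    show "(\<lambda>m. dist (c m) (c n)) \<longlonglongrightarrow> dist x (c n)" by (intro tendsto_intros x)
    show "\<exists>N. \<forall>m\<ge>N. dist (c m) (c n) \<le> \<rho> n"
    proof (intro exI allI impI)
      fix m assume "m \<ge> n"
      then show "dist (c m) (c n) \<le> \<rho> n" using dist_c[of n "m - n"] \<rho>_pos[of m] by simp
    qed
  qed
  \<comment> \<open>The strict inequality in the formal inclusion puts the limit inside each open
    ball and not merely in its closure.\<close>
  then have dist_x: "dist x (c n) < \<rho> n" for n
    using below[of n] dist_triangle[of x "c n" "c (Suc n)"] by (smt (verit))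
  have xQ: "x \<in> open_of s (Q (pfst (f n)))" for n
    using Q[of n] dist_x[of "Suc n"]
    by (intro open_ofI) (auto simp: ideal_ball_eq c_def \<rho>_def dist_commute)
  have m_ge: "n \<le> psnd (pfst (f n))" for n
  proof (induction n)
    case (Suc n) then show ?case using f(3)[of n] unfolding R_def by auto
  qed simp
  have "x \<in> U n" if "k0 \<le> n" for n
  proof -
    have "n \<in> {k0..<psnd (pfst (f (Suc n)))}" using m_ge[of "Suc n"] that by simp
    then show ?thesis using xQ[of "Suc n"] unfolding open_Q by blast
  qed
  then have "x \<in> F" unfolding F_def by simp
  then have "x \<in> C" unfolding C F_def by blast
  moreover have "computable_point s x"
  proof -
    have "recursive (\<lambda>n. pfst (B n))" unfolding B_def by (intro recursive_intros f(1))
    then obtain q where "\<And>n. evals q [n] (pfst (B n))" unfolding recursive_iff by blast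
    moreover have "dist (s (pfst (B n))) x \<le> (1/2) ^ n" for n
      using dist_x[of n] \<rho>_le[of n] by (simp add: c_def dist_commute)
    ultimately show ?thesis unfolding computable_point_def by blast
  qed
  ultimately show ?thesis by blast
qed

section \<open>Ergodic averages\<close>

lemma ln_le_two_sqrt: "0 < x \<Longrightarrow> ln x \<le> 2 * sqrt (x :: real)"
  using ln_le_minus_one[of "sqrt x"] by (simp add: ln_sqrt)

text \<open>\<open>x / (ln x)^2\<close> decreases up to \<open>exp 2\<close>, so monotonicity holds
  only up to a constant. With \<open>t = sqrt (n / l)\<close>,
  \<open>ln n \<le> ln l + 2 * t \<le> 4 * t * ln l\<close>, as \<open>ln l\<close> is at least 2/3;
  squaring gives 16.\<close>

lemma over_ln_squared_le:
  assumes "2 \<le> l" "l \<le> n"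
  shows "real l / (ln (real l))\<^sup>2 \<le> 16 * (real n / (ln (real n))\<^sup>2)"
proof -
  define t where "t = sqrt (real n / real l)"
  have l: "0 < real l" "0 < real n" using assms by auto
  have t: "1 \<le> t" "t\<^sup>2 = real n / real l" using assms by (auto simp: t_def divide_simps)
  have lnl: "2/3 \<le> ln (real l)"
  proof -
    have "ln 2 \<le> ln (real l)" using assms by (subst ln_le_cancel_iff) auto
    then show ?thesis using ln2_ge_two_thirds by linarith
  qed
  have lnn: "0 < ln (real n)" using assms by simp
  have "ln (real n) = ln (real l) + ln (real n / real l)" using l by (simp add: ln_div)
  also have "ln (real n / real l) \<le> 2 * t" unfolding t_def using l by (intro ln_le_two_sqrt) simp
  also have "ln (real l) + 2 * t \<le> 4 * (ln (real l) * t)"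
  proof -
    have "ln (real l) * 1 \<le> ln (real l) * t" using lnl t(1) by (intro mult_left_mono) auto
    moreover have "2/3 * t \<le> ln (real l) * t" using lnl t(1) by (intro mult_right_mono) auto
    ultimately show ?thesis by linarith
  qed
  finally have "(ln (real n))\<^sup>2 \<le> (4 * (ln (real l) * t))\<^sup>2" using lnn by (intro power_mono) auto
  also have "\<dots> = 16 * (ln (real l))\<^sup>2 * (real n / real l)" by (simp add: power_mult_distrib t(2))
  finally have "(ln (real n))\<^sup>2 * real l \<le> 16 * (ln (real l))\<^sup>2 * real n" using l by (simp add: field_simps)
  then show ?thesis using lnl lnn by (simp add: field_simps)
qed

text \<open>Enlarging the square by a row and a column adds every lag up to \<open>l\<close> twice,
  except lag 0, which is added once. This rewrites the variance through partial sums of covariances,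
  and it is these that ergodicity controls.\<close>

lemma sum_sum_abs_diff:
  fixes c :: "nat \<Rightarrow> real"
  shows "(\<Sum>i<n. \<Sum>j<n. c (max i j - min i j)) = (\<Sum>l<n. 2 * (\<Sum>i<Suc l. c i) - c 0)"
proof (induction n)
  case (Suc n)
  have 1: "(\<Sum>j<n. c (max n j - min n j)) = (\<Sum>j<n. c (n - j))"
    by (intro sum.cong) auto
  have 2: "(\<Sum>i<n. c (max i n - min i n)) = (\<Sum>j<n. c (n - j))"
    by (intro sum.cong) (auto simp: max_def min_def)
  have 3: "(\<Sum>j<n. c (n - j)) = (\<Sum>i<Suc n. c i) - c 0"
  proof -
    have "(\<Sum>j<n. c (n - j)) = (\<Sum>i<n. c (Suc i))"
      by (rule sum.reindex_bij_witness[of _ "\<lambda>i. n - Suc i" "\<lambda>j. n - Suc j"]) (auto simp: Suc_diff_Suc)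
    then show ?thesis by (simp add: sum.lessThan_Suc_shift del: sum.lessThan_Suc)
  qed
  have "(\<Sum>i<Suc n. \<Sum>j<Suc n. c (max i j - min i j)) = (\<Sum>i<n. \<Sum>j<n. c (max i j - min i j)) +
      (\<Sum>i<n. c (max i n - min i n)) + (\<Sum>j<n. c (max n j - min n j)) + c 0"
    by (simp add: sum.distrib)
  also have "\<dots> = (\<Sum>l<n. 2 * (\<Sum>i<Suc l. c i) - c 0) + (2 * (\<Sum>i<Suc n. c i) - c 0)"
    unfolding Suc 1 2 3 by (simp only: algebra_simps)
  also have "\<dots> = (\<Sum>l<Suc n. 2 * (\<Sum>i<Suc l. c i) - c 0)" by (rule sum.lessThan_Suc[symmetric])
  finally show ?case .
qed simp

definition time_average :: "('a \<Rightarrow> 'a) \<Rightarrow> ('a \<Rightarrow> real) \<Rightarrow> nat \<Rightarrow> 'a \<Rightarrow> real" where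
  "time_average T \<phi> n x = (\<Sum>i<n. \<phi> ((T ^^ i) x)) / real n"

lemma measurable_funpow: "T \<in> measurable M M \<Longrightarrow> T ^^ i \<in> measurable M M"
  by (induction i) (auto simp: id_def intro: measurable_comp)

lemma distr_funpow:
  assumes "T \<in> measurable M M" "distr M M T = M" shows "distr M M (T ^^ i) = M"
proof (induction i)
  case 0 then show ?case by (simp add: id_def distr_id)
next
  case (Suc i)
  have "distr M M (T \<circ> (T ^^ i)) = distr (distr M M (T ^^ i)) M T"
    using assms(1) measurable_funpow[OF assms(1), of i] by (rule distr_distr[symmetric])
  then show ?case by (simp only: funpow.simps Suc assms(2))
qed

section \<open>Autocovariances and the variance of time averages\<close>

locale ln2_ergodic_observable = prob_space M for M :: "'a measure" +
  fixes T :: "'a \<Rightarrow> 'a" and \<phi> :: "'a \<Rightarrow> real" and c :: real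
  assumes T [measurable]: "T \<in> measurable M M" and inv: "distr M M T = M"
    and int: "integrable M \<phi>" "\<And>i. integrable M (\<lambda>x. \<phi> ((T ^^ i) x) * \<phi> x)"
    and c: "0 < c" "\<And>n. n \<ge> 2 \<Longrightarrow>
      \<bar>(\<Sum>i<n. \<integral>x. \<phi> ((T ^^ i) x) * \<phi> x \<partial>M) / real n - (\<integral>x. \<phi> x \<partial>M) * (\<integral>x. \<phi> x \<partial>M)\<bar>
        \<le> c / (ln (real n))\<^sup>2"
begin

abbreviation "m \<equiv> (\<integral>x. \<phi> x \<partial>M)"

lemma integral_shift:
  fixes g :: "'a \<Rightarrow> real"
  assumes "integrable M g"
  shows "integrable M (\<lambda>x. g ((T ^^ i) x))" "(\<integral>x. g ((T ^^ i) x) \<partial>M) = (\<integral>x. g x \<partial>M)"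
proof -
  note [measurable] = measurable_funpow[OF T, of i] borel_measurable_integrable[OF assms]
  have d: "distr M M (T ^^ i) = M" using distr_funpow[OF T inv] .
  have "integrable (distr M M (T ^^ i)) g" using assms d by simp
  then show "integrable M (\<lambda>x. g ((T ^^ i) x))" using integrable_distr[of "T ^^ i" M M g] measurable_funpow[OF T, of i] by blast
  show "(\<integral>x. g ((T ^^ i) x) \<partial>M) = (\<integral>x. g x \<partial>M)"
    using integral_distr[of "T ^^ i" M M g] d by simp
qed

definition "cov i = (\<integral>x. \<phi> ((T ^^ i) x) * \<phi> x \<partial>M) - m * m"

lemma correlation:
  "integrable M (\<lambda>x. \<phi> ((T ^^ i) x) * \<phi> ((T ^^ j) x))"
  "(\<integral>x. \<phi> ((T ^^ i) x) * \<phi> ((T ^^ j) x) \<partial>M) = cov (max i j - min i j) + m * m"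
proof -
  have *: "integrable M (\<lambda>x. \<phi> ((T ^^ i) x) * \<phi> ((T ^^ j) x)) \<and>
    (\<integral>x. \<phi> ((T ^^ i) x) * \<phi> ((T ^^ j) x) \<partial>M) = cov (i - j) + m * m" if "j \<le> i" for i j
  proof -
    have "(T ^^ i) x = (T ^^ (i - j)) ((T ^^ j) x)" for x
      using that by (metis comp_apply funpow_add le_add_diff_inverse2)
    then show ?thesis
      using integral_shift[OF int(2)[of "i - j"], of j] by (simp add: cov_def)
  qed
  show "integrable M (\<lambda>x. \<phi> ((T ^^ i) x) * \<phi> ((T ^^ j) x))"
    "(\<integral>x. \<phi> ((T ^^ i) x) * \<phi> ((T ^^ j) x) \<partial>M) = cov (max i j - min i j) + m * m"
    using *[of j i] *[of i j] by (cases "j \<le> i"; simp add: mult.commute max_def min_def)+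
qed

lemma measurable_time_average [measurable]: "time_average T \<phi> n \<in> borel_measurable M"
  unfolding time_average_def using integral_shift(1)[OF int(1)] by (auto intro!: borel_measurable_divide borel_measurable_sum)

lemma integrable_time_average: "integrable M (time_average T \<phi> n)"
  unfolding time_average_def using integral_shift(1)[OF int(1)] by auto

lemma time_average_square:
  "(time_average T \<phi> n x)\<^sup>2 = (\<Sum>i<n. \<Sum>j<n. \<phi> ((T ^^ i) x) * \<phi> ((T ^^ j) x)) / (real n)\<^sup>2"
  by (simp add: time_average_def power2_eq_square sum_product)

lemma integrable_time_average_square: "integrable M (\<lambda>x. (time_average T \<phi> n x)\<^sup>2)"
  unfolding time_average_square by (intro integrable_divide Bochner_Integration.integrable_sum correlation)

lemma expectation_time_average: "0 < n \<Longrightarrow> expectation (time_average T \<phi> n) = m"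
  unfolding time_average_def using integral_shift[OF int(1)] by (simp add: Bochner_Integration.integral_sum)

lemma variance_time_average:
  assumes "0 < n"
  shows "variance (time_average T \<phi> n) = (\<Sum>l<n. 2 * (\<Sum>i<Suc l. cov i) - cov 0) / (real n)\<^sup>2"
proof -
  have "expectation (\<lambda>x. (time_average T \<phi> n x)\<^sup>2) =
      (\<Sum>i<n. \<Sum>j<n. cov (max i j - min i j) + m * m) / (real n)\<^sup>2"
    unfolding time_average_square
    by (simp add: Bochner_Integration.integral_sum correlation)
  also have "(\<Sum>i<n. \<Sum>j<n. cov (max i j - min i j) + m * m) =
      (\<Sum>i<n. \<Sum>j<n. cov (max i j - min i j)) + (real n)\<^sup>2 * m\<^sup>2"
    by (simp add: sum.distrib power2_eq_square)
  finally have "expectation (\<lambda>x. (time_average T \<phi> n x)\<^sup>2) - m\<^sup>2 =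
      (\<Sum>i<n. \<Sum>j<n. cov (max i j - min i j)) / (real n)\<^sup>2"
    using assms by (simp add: add_divide_distrib)
  then show ?thesis
    unfolding sum_sum_abs_diff[symmetric]
    using variance_eq[OF integrable_time_average integrable_time_average_square, of n]
      expectation_time_average[OF assms] by simp
qed

text \<open>Of the constants, 32 is twice the 16 of \<open>over_ln_squared_le\<close>, and 48 is
  three times it. The \<open>cov 0\<close> part covers the partial sum of length 1, where the
  ergodic estimate says nothing, and the subtracted \<open>cov 0\<close> of the other terms.\<close>

definition "var_bound = 32 * c + 48 * \<bar>cov 0\<bar>"

lemma variance_le:
  assumes "2 \<le> n"
  shows "variance (time_average T \<phi> n) \<le> var_bound / (ln (real n))\<^sup>2"
proof -
  define R where "R = real n / (ln (real n))\<^sup>2"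
  have R1: "1 \<le> 16 * R"
  proof -
    have "(ln 2)\<^sup>2 \<le> (1::real)\<^sup>2" using ln_2_less_1 by (intro power_mono) auto
    then have "1 \<le> 2 / (ln 2 :: real)\<^sup>2" by (simp add: le_divide_eq)
    also have "\<dots> \<le> 16 * R" using over_ln_squared_le[of 2 n] assms by (simp add: R_def)
    finally show ?thesis .
  qed
  have "2 * (\<Sum>i<Suc l. cov i) - cov 0 \<le> var_bound * R" if "l < n" for l
  proof (cases "l = 0")
    case True
    have "3 * \<bar>cov 0\<bar> * 1 \<le> 3 * \<bar>cov 0\<bar> * (16 * R)" using R1 by (intro mult_left_mono) auto
    moreover have "0 \<le> c * R" using c(1) R1 by simp
    ultimately have "3 * \<bar>cov 0\<bar> \<le> var_bound * R" by (simp add: var_bound_def algebra_simps)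
    moreover have "2 * cov 0 - cov 0 \<le> 3 * \<bar>cov 0\<bar>" by linarith
    ultimately show ?thesis using True by simp
  next
    case False
    define L where "L = real (Suc l)"
    have L: "0 < L" by (simp add: L_def)
    \<comment> \<open>A partial sum of covariances is its length times exactly the difference
      bounded by ergodicity for the pair \<open>(\<phi>, \<phi>)\<close>.\<close>
    have "(\<Sum>i<Suc l. cov i) = L * ((\<Sum>i<Suc l. \<integral>x. \<phi> ((T ^^ i) x) * \<phi> x \<partial>M) / L - m * m)"
      using L by (simp add: cov_def sum_subtractf L_def algebra_simps del: sum.lessThan_Suc of_nat_Suc)
    also have "\<dots> \<le> L * (c / (ln L)\<^sup>2)"
      using c(2)[of "Suc l"] False L unfolding L_def by (intro mult_left_mono) (auto simp: abs_le_iff)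
    also have "\<dots> = c * (L / (ln L)\<^sup>2)" by simp
    also have "\<dots> \<le> c * (16 * R)"
      unfolding L_def R_def using c(1) False that by (intro mult_left_mono over_ln_squared_le) auto
    finally have "2 * (\<Sum>i<Suc l. cov i) \<le> 32 * c * R" by simp
    moreover have "\<bar>cov 0\<bar> * 1 \<le> \<bar>cov 0\<bar> * (16 * R)" using R1 by (intro mult_left_mono) auto
    moreover have "0 \<le> \<bar>cov 0\<bar> * R" using R1 by simp
    ultimately show ?thesis by (simp add: var_bound_def algebra_simps del: sum.lessThan_Suc)
  qed
  then have "(\<Sum>l<n. 2 * (\<Sum>i<Suc l. cov i) - cov 0) \<le> (\<Sum>l<n. var_bound * R)" by (intro sum_mono) auto
  also have "\<dots> = (real n)\<^sup>2 * (var_bound / (ln (real n))\<^sup>2)" by (simp add: R_def power2_eq_square)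
  finally show ?thesis using assms by (simp add: variance_time_average divide_le_eq mult.commute)
qed

lemma var_bound_pos: "0 < var_bound"
  using c(1) unfolding var_bound_def by (intro add_pos_nonneg) auto

lemma deviation_le:
  assumes "2 \<le> n" "0 < e"
  shows "prob {x \<in> space M. e \<le> \<bar>time_average T \<phi> n x - m\<bar>} \<le> var_bound / (e * ln (real n))\<^sup>2"
proof -
  have "prob {x \<in> space M. e \<le> \<bar>time_average T \<phi> n x - m\<bar>} \<le> variance (time_average T \<phi> n) / e\<^sup>2"
    using Chebyshev_inequality[OF measurable_time_average integrable_time_average_square assms(2), of n]
      expectation_time_average[of n] assms(1) by simp
  also have "\<dots> \<le> var_bound / (ln (real n))\<^sup>2 / e\<^sup>2"
    using variance_le[OF assms(1)] by (intro divide_right_mono) auto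
  finally show ?thesis by (simp add: power_mult_distrib mult.commute)
qed

end

section \<open>The sampling times\<close>

text \<open>Growth \<open>h\<close> must tend to infinity while \<open>h^4 / k^2\<close> stays
  summable. With \<open>h\<close> of order \<open>k\<close> to the 1/8 the bound is of order
  \<open>k\<close> to the -3/2, whose tails have a simple telescoping majorant.\<close>

definition eighth_root :: "nat \<Rightarrow> nat" where
  "eighth_root k = (LEAST y. k < Suc y ^ 8)"

lemma eighth_root: "eighth_root k ^ 8 \<le> k" "k < Suc (eighth_root k) ^ 8"
proof -
  have "k < Suc k ^ 8" using self_le_power[of "Suc k" 8] by simp
  then show "k < Suc (eighth_root k) ^ 8" unfolding eighth_root_def by (rule LeastI)
  show "eighth_root k ^ 8 \<le> k"
  proof (cases "eighth_root k")
    case (Suc y)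
    then have "\<not> k < Suc y ^ 8" using not_less_Least[of y "\<lambda>y. k < Suc y ^ 8"]
      unfolding eighth_root_def by simp
    then show ?thesis using Suc by simp
  qed simp
qed

lemma eighth_root_eqI: "y ^ 8 \<le> k \<Longrightarrow> k < Suc y ^ 8 \<Longrightarrow> y = eighth_root k"
  using eighth_root[of k] 
  by (meson le_less_trans less_Suc_eq_le order_antisym power_less_imp_less_base zero_le)

lemma eighth_root_mono: "k \<le> k' \<Longrightarrow> eighth_root k \<le> eighth_root k'"
  using eighth_root(1)[of k] eighth_root(2)[of k']
  by (meson le_less_trans less_Suc_eq_le power_less_imp_less_base zero_le)

lemma recursive_eighth_root: "recursive eighth_root"
proof (rule recursive_graph)
  have "y = eighth_root k \<longleftrightarrow> y ^ 8 \<le> k \<and> k < Suc y ^ 8" for k y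
    using eighth_root[of k] eighth_root_eqI by blast
  then show "semidecidable2 (\<lambda>k y. y = eighth_root k)"
    by (simp only:) (intro semidecidable_intros recursive_intros)
qed

text \<open>
  With \<open>h = eighth_root + 1\<close>, the ratio of successive sampling times tends to 1, so that it suffices
  to control the averages at these times; but \<open>ln (sample_time k) \<ge> k / (2 h k)\<close>, so that the
  probabilities of deviations by \<open>1 / h k\<close> are \<open>O(h k ^ 4 / k\<^sup>2)\<close>, which is summable.
\<close>

definition sample_time :: "nat \<Rightarrow> nat" where
  "sample_time k = rec_nat 2 (\<lambda>k y. Suc (y + y div Suc (eighth_root k))) k"

lemma sample_time_simps [simp]: "sample_time 0 = 2"
  "sample_time (Suc k) = Suc (sample_time k + sample_time k div Suc (eighth_root k))"
  by (simp_all add: sample_time_def)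

lemma real_div_bounds:
  assumes "0 < b"
  shows "real (a div b) \<le> real a / real b" "real a / real b \<le> real (Suc (a div b))"
proof -
  have "real (a div b * b) \<le> real a" by (simp only: of_nat_le_iff div_times_less_eq_dividend)
  then show "real (a div b) \<le> real a / real b" using assms by (simp add: le_divide_eq)
  have "a \<le> Suc (a div b) * b" using dividend_less_div_times[OF assms, of a] by simp
  then have "real a \<le> real (Suc (a div b)) * real b" by (simp only: of_nat_le_iff flip: of_nat_mult)
  then show "real a / real b \<le> real (Suc (a div b))" using assms by (simp only: pos_divide_le_eq of_nat_0_less_iff)
qed

lemma recursive_div_Suc:
  assumes "recursive f" "recursive g" shows "recursive (\<lambda>x. f x div Suc (g x))"
proof (rule recursive_graph)
  have "y = a div Suc b \<longleftrightarrow> y * Suc b \<le> a \<and> a < Suc y * Suc b" for y a b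
    by (metis div_nat_eqI div_times_less_eq_dividend dividend_less_div_times mult.commute mult_Suc
        add.commute zero_less_Suc)
  then show "semidecidable2 (\<lambda>x y. y = f x div Suc (g x))"
    by (simp only:) (intro semidecidable_intros recursive_intros recursive_comp[OF assms(1)] recursive_comp[OF assms(2)])
qed

lemma recursive_sample_time: "recursive sample_time"
  unfolding sample_time_def[abs_def]
  by (intro recursive_rec_nat recursive_intros recursive_div_Suc recursive_comp[OF recursive_eighth_root])

text \<open>The start at 2 keeps every sampling time in the range where ergodicity is assumed and
  the logarithm is positive.\<close>

lemma sample_time_ge: "2 \<le> sample_time k" "k \<le> sample_time k"
  by (induction k) auto

lemma sample_time_mono: "k \<le> k' \<Longrightarrow> sample_time k \<le> sample_time k'"
  by (rule lift_Suc_mono_le) auto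

text \<open>The successor in the recursion makes up for the rounded quotient, so a step multiplies
  the time by at least \<open>1 + 1 / h\<close> and adds at least \<open>1 / (2 * h)\<close> to the
  logarithm. As \<open>h\<close> never decreases, the claimed lower bound grows by no more than
  that.\<close>

lemma ln_sample_time: "real k / (2 * real (Suc (eighth_root k))) \<le> ln (real (sample_time k))"
proof (induction k)
  case (Suc k)
  define h where "h = real (Suc (eighth_root k))"
  define N where "N = real (sample_time k)"
  have h: "1 \<le> h" and N: "2 \<le> N" using sample_time_ge(1)[of k] by (simp_all add: h_def N_def)
  have hS: "h \<le> real (Suc (eighth_root (Suc k)))" unfolding h_def using eighth_root_mono[of k "Suc k"] by simp
  have "N / h \<le> real (Suc (sample_time k div Suc (eighth_root k)))"
    unfolding N_def h_def using real_div_bounds(2)[of "Suc (eighth_root k)" "sample_time k"] by simp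
  then have 1: "N * (1 + 1 / h) \<le> real (sample_time (Suc k))" by (simp add: N_def algebra_simps)
  have "0 < 1 + 1 / h" using h by (simp add: add_pos_pos)
  then have "1 - 1 / (1 + 1 / h) \<le> ln (1 + 1 / h)"
    using ln_le_minus_one[of "inverse (1 + 1 / h)"] ln_inverse[of "1 + 1 / h"] by (simp add: inverse_eq_divide)
  moreover have "1 / (2 * h) \<le> 1 - 1 / (1 + 1 / h)" using h by (simp add: divide_simps)
  ultimately have 2: "1 / (2 * h) \<le> ln (1 + 1 / h)" by linarith
  have "real (Suc k) / (2 * real (Suc (eighth_root (Suc k)))) \<le> real (Suc k) / (2 * h)"
    using h hS by (intro divide_left_mono) auto
  also have "\<dots> = real k / (2 * h) + 1 / (2 * h)" by (simp add: add_divide_distrib)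
  also have "\<dots> \<le> ln N + ln (1 + 1 / h)" using Suc 2 by (simp add: h_def N_def)
  also have "\<dots> = ln (N * (1 + 1 / h))" using h N by (subst ln_mult) (auto simp: divide_simps)
  also have "\<dots> \<le> ln (real (sample_time (Suc k)))" using 1 h N by (subst ln_le_cancel_iff) (auto simp: divide_simps intro!: mult_pos_pos less_le_trans[OF _ 1])
  finally show ?case .
qed simp

definition tolerance :: "nat \<Rightarrow> real" where "tolerance k = 1 / real (Suc (eighth_root k))"

lemma tolerance_pos: "0 < tolerance k"
  by (simp add: tolerance_def)

lemma tolerance_tendsto: "tolerance \<longlonglongrightarrow> 0"
proof -
  have "filterlim eighth_root at_top sequentially"
    unfolding filterlim_at_top eventually_sequentially
  proof (intro allI exI impI)
    fix Z k :: nat assume "Z ^ 8 \<le> k"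
    then have "Z ^ 8 < Suc (eighth_root k) ^ 8" using eighth_root(2)[of k] by linarith
    then have "Z < Suc (eighth_root k)" by (rule power_less_imp_less_base) simp
    then show "Z \<le> eighth_root k" by simp
  qed
  then show ?thesis unfolding tolerance_def
    using filterlim_compose[OF LIMSEQ_inverse_real_of_nat] by (simp add: inverse_eq_divide)
qed

text \<open>Half the tolerance is taken to leave room for replacing \<open>m\<close> by a nearby
  rational. Chebyshev gives \<open>16 * var_bound * h^4 / k^2\<close>; since \<open>h\<close> is at
  most twice the integer eighth root, \<open>h^4 \<le> 16 * sqrt k\<close>, whence 256.\<close>

lemma (in ln2_ergodic_observable) sample_deviation_le:
  assumes "1 \<le> k"
  shows "prob {x \<in> space M. tolerance k / 2 \<le> \<bar>time_average T \<phi> (sample_time k) x - m\<bar>}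
    \<le> 256 * var_bound / (real k * sqrt (real k))"
proof -
  define h where "h = real (Suc (eighth_root k))"
  define r where "r = eighth_root k"
  have r: "1 \<le> r" using eighth_root(2)[of k] assms by (cases r) (auto simp: r_def)
  have "(real r ^ 4)\<^sup>2 \<le> real k" using eighth_root(1)[of k] unfolding r_def
    by (simp flip: power_mult)
  then have "real r ^ 4 \<le> sqrt (real k)" by (simp add: real_le_rsqrt)
  moreover have "h ^ 4 \<le> (2 * real r) ^ 4" using r by (intro power_mono) (auto simp: h_def r_def)
  ultimately have h4: "h ^ 4 \<le> 16 * sqrt (real k)" by (simp add: power_mult_distrib)
  have h: "1 \<le> h" by (simp add: h_def)
  have "prob {x \<in> space M. tolerance k / 2 \<le> \<bar>time_average T \<phi> (sample_time k) x - m\<bar>}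
    \<le> var_bound / (tolerance k / 2 * ln (real (sample_time k)))\<^sup>2"
    using sample_time_ge(1)[of k] tolerance_pos[of k] by (intro deviation_le) auto
  also have "\<dots> \<le> var_bound / (1 / h / 2 * (real k / (2 * h)))\<^sup>2"
  proof (intro divide_left_mono power_mono mult_mono)
    show "real k / (2 * h) \<le> ln (real (sample_time k))" unfolding h_def by (rule ln_sample_time)
    have "0 < real k / (2 * h)" using assms h by simp
    also have "\<dots> \<le> ln (real (sample_time k))" unfolding h_def by (rule ln_sample_time)
    finally show "0 < (tolerance k / 2 * ln (real (sample_time k)))\<^sup>2 * (1 / h / 2 * (real k / (2 * h)))\<^sup>2"
      using assms h tolerance_pos[of k] by simp
  qed (use h var_bound_pos assms in \<open>auto simp: tolerance_def h_def\<close>)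
  also have "\<dots> = 16 * var_bound * h ^ 4 / (real k)\<^sup>2" using h assms by (simp add: field_simps eval_nat_numeral)
  also have "\<dots> \<le> 16 * var_bound * (16 * sqrt (real k)) / (real k)\<^sup>2"
    using h4 var_bound_pos by (intro divide_right_mono mult_left_mono) auto
  also have "\<dots> = 256 * var_bound / (real k * sqrt (real k))"
  proof -
    have "real k = sqrt (real k) * sqrt (real k)" by simp
    then show ?thesis using assms by (simp add: divide_simps power2_eq_square)
  qed
  finally show ?thesis .
qed

text \<open>Between successive sampling times the orbit sum changes by at most \<open>B\<close> per
  step, and the number of steps is a vanishing fraction of the elapsed time.\<close>

lemma time_average_tendsto:
  assumes B: "\<And>x. \<bar>\<phi> x\<bar> \<le> B"
    and dev: "\<And>k. k0 \<le> k \<Longrightarrow> \<bar>time_average T \<phi> (sample_time k) x - m\<bar> \<le> 3 * tolerance k"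
  shows "(\<lambda>n. time_average T \<phi> n x) \<longlonglongrightarrow> m"
proof -
  define S where "S n = (\<Sum>i<n. \<phi> ((T ^^ i) x))" for n
  have avg: "time_average T \<phi> n x = S n / real n" for n by (simp add: time_average_def S_def)
  have B0: "0 \<le> B" using B[of x] by linarith
  have S_diff: "\<bar>S n - S l\<bar> \<le> B * (real n - real l)" if "l \<le> n" for l n
  proof -
    have "S n - S l = (\<Sum>i\<in>{l..<n}. \<phi> ((T ^^ i) x))"
      using sum_diff_nat_ivl[of 0 l n "\<lambda>i. \<phi> ((T ^^ i) x)"] that by (simp add: S_def atLeast0LessThan)
    also have "\<bar>\<dots>\<bar> \<le> (\<Sum>i\<in>{l..<n}. B)" by (rule order_trans[OF sum_abs sum_mono]) (rule B)
    finally show ?thesis using that by (simp add: of_nat_diff mult.commute)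
  qed
  \<comment> \<open>For \<open>n \<ge> 2\<close> this is the index of the last sampling time not
    exceeding \<open>n\<close>.\<close>
  define \<kappa> where "\<kappa> n = (LEAST k. n < sample_time (Suc k))" for n
  have \<kappa>: "n < sample_time (Suc (\<kappa> n))" for n
    unfolding \<kappa>_def by (rule LeastI[of _ n]) (use sample_time_ge(2)[of "Suc n"] in linarith)
  have \<kappa>': "sample_time (\<kappa> n) \<le> n" if "2 \<le> n" for n
  proof (cases "\<kappa> n")
    case (Suc j)
    then have "\<not> n < sample_time (Suc j)" using not_less_Least[of j "\<lambda>k. n < sample_time (Suc k)"] by (simp add: \<kappa>_def)
    then show ?thesis using Suc by simp
  qed (use that in simp)
  have \<kappa>_ge: "k \<le> \<kappa> n" if "sample_time k \<le> n" for k n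
  proof (rule ccontr)
    assume "\<not> k \<le> \<kappa> n"
    then have "sample_time (Suc (\<kappa> n)) \<le> sample_time k" by (intro sample_time_mono) simp
    with \<kappa>[of n] that show False by simp
  qed
  have \<kappa>_lim: "filterlim \<kappa> at_top sequentially"
    unfolding filterlim_at_top eventually_sequentially using \<kappa>_ge by blast
  define g where "g k = 3 * tolerance k + 2 * B * (tolerance k + 1 / real (sample_time k))" for k
  have "(\<lambda>k. 1 / real (sample_time k)) \<longlonglongrightarrow> 0"
  proof (rule tendsto_divide_0[OF tendsto_const])
    have "filterlim sample_time at_top sequentially"
      unfolding filterlim_at_top eventually_sequentially using sample_time_ge(2) order_trans by blast
    then show "filterlim (\<lambda>k. real (sample_time k)) at_infinity sequentially"
      by (intro filterlim_at_top_imp_at_infinity filterlim_compose[OF filterlim_real_sequentially])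
  qed
  then have "g \<longlonglongrightarrow> 3 * 0 + 2 * B * (0 + 0)"
    unfolding g_def by (intro tendsto_intros tolerance_tendsto)
  then have g_lim: "(\<lambda>n. g (\<kappa> n)) \<longlonglongrightarrow> 0" using filterlim_compose[OF _ \<kappa>_lim] by force
  have "\<forall>\<^sub>F n in sequentially. \<bar>time_average T \<phi> n x - m\<bar> \<le> g (\<kappa> n)"
    unfolding eventually_sequentially
  proof (intro exI allI impI)
    fix n assume n: "max 2 (sample_time k0) \<le> n"
    define k where "k = \<kappa> n"
    define l where "l = sample_time k"
    have k: "k0 \<le> k" "l \<le> n" "n < sample_time (Suc k)" and l: "2 \<le> l"
      using n \<kappa>_ge[of k0 n] \<kappa>'[of n] \<kappa>[of n] sample_time_ge(1)[of k] by (auto simp: k_def l_def)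
    have pos: "0 < real l" "0 < real n" using l k(2) by auto
    have "real n - real l \<le> real (l div Suc (eighth_root k)) + 1" using k(3) by (simp add: l_def)
    also have "real (l div Suc (eighth_root k)) \<le> real l * tolerance k"
      using real_div_bounds(1)[of "Suc (eighth_root k)" l] by (simp add: tolerance_def del: of_nat_Suc)
    finally have step: "real n - real l \<le> real l * tolerance k + 1" by simp
    have "\<bar>S l\<bar> \<le> B * real l" using S_diff[of 0 l] by (simp add: S_def)
    \<comment> \<open>The change is split into the effect of the new terms and that of the new
      denominator; each is at most \<open>B\<close> times the relative increase of time.\<close>
    have "\<bar>S n / real n - S l / real l\<bar> = \<bar>(S n - S l) / real n - S l / real l * ((real n - real l) / real n)\<bar>"
      using pos by (simp add: field_simps)
    also have "\<dots> \<le> \<bar>S n - S l\<bar> / real n + \<bar>S l\<bar> / real l * ((real n - real l) / real n)"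
      using pos k(2) by (intro order_trans[OF abs_triangle_ineq4]) (simp add: abs_mult)
    also have "\<dots> \<le> B * (real n - real l) / real n + B * ((real n - real l) / real n)"
      using pos k(2) S_diff[OF k(2)] \<open>\<bar>S l\<bar> \<le> B * real l\<close>
      by (intro add_mono divide_right_mono mult_right_mono) (auto simp: divide_le_eq)
    also have "\<dots> = 2 * B * ((real n - real l) / real n)" by simp
    also have "(real n - real l) / real n \<le> (real l * tolerance k + 1) / real l"
      using pos k(2) step by (intro frac_le) auto
    also have "\<dots> = tolerance k + 1 / real l" using pos by (simp add: field_simps)
    finally have "\<bar>S n / real n - S l / real l\<bar> \<le> 2 * B * (tolerance k + 1 / real l)"
      using B0 by (simp add: mult_left_mono)
    moreover have "\<bar>S l / real l - m\<bar> \<le> 3 * tolerance k" using dev[OF k(1)] by (simp add: avg l_def)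
    ultimately show "\<bar>time_average T \<phi> n x - m\<bar> \<le> g (\<kappa> n)"
      by (simp add: avg g_def flip: k_def l_def)
  qed
  then have "\<forall>\<^sub>F n in sequentially. norm (time_average T \<phi> n x - m) \<le> g (\<kappa> n)" by simp
  from Lim_null_comparison[OF this g_lim] show ?thesis by (simp add: Lim_null[symmetric])
qed

text \<open>The majorant of order \<open>k\<close> to the -3/2 is dominated by differences of
  \<open>4 * K / sqrt k\<close>, so tails telescope to an explicit bound that is easily
  inverted.\<close>

lemma effectively_summableI:
  assumes a: "\<And>n. 0 \<le> a n" "\<And>n. a n \<le> K / (real (n + k0) * sqrt (real (n + k0)))" and k0: "1 \<le> k0" and "0 < K"
  shows "effectively_summable a"
proof -
  \<comment> \<open>With \<open>u = sqrt k\<close>, \<open>v = sqrt (k + 1)\<close> and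
    \<open>v \<le> 3/2 * u\<close>, the product \<open>v * (u + v)\<close> is at most
    \<open>15/4 * u^2\<close>; rounding up gives the 4.\<close>
  define f where "f n = 4 * K / sqrt (real n)" for n
  have step: "K / (real k * sqrt (real k)) \<le> f k - f (Suc k)" if "1 \<le> k" for k
  proof -
    define u where "u = sqrt (real k)" define v where "v = sqrt (real (Suc k))"
    have uv: "0 < u" "u\<^sup>2 = real k" "v\<^sup>2 = real k + 1" "u < v" using that by (auto simp: u_def v_def)
    have v: "v \<le> 3/2 * u"
      by (rule power2_le_imp_le) (use uv that in \<open>auto simp: power_mult_distrib power2_eq_square\<close>)
    have "v * (u + v) \<le> 3/2 * u * (u + 3/2 * u)" using v uv by (intro mult_mono) auto
    also have "\<dots> \<le> 4 * (u * u)" using uv by simp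
    finally have "v * (u + v) \<le> 4 * (u * u)" .
    moreover have "(v - u) * (v + u) = 1" using uv by (simp add: algebra_simps power2_eq_square)
    ultimately have "v * (u + v) \<le> 4 * (u * u) * ((v - u) * (v + u))" by simp
    then have "v * (u + v) \<le> 4 * (u * u) * (v - u) * (u + v)" by (simp only: mult.assoc add.commute)
    then have "v \<le> 4 * (u * u) * (v - u)" using uv by (simp only: mult_le_cancel_right)
    then have "1 / (u * u * u) \<le> 4 / u - 4 / v" using uv
      by (simp add: divide_simps) (simp add: algebra_simps)
    then have "K * (1 / (u * u * u)) \<le> K * (4 / u - 4 / v)" using \<open>0 < K\<close> by (intro mult_left_mono) auto
    then have "K / (u * u * u) \<le> 4 * K / u - 4 * K / v" by (simp add: algebra_simps)
    then show ?thesis using uv unfolding f_def u_def[symmetric] v_def[symmetric]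
      by (simp add: power2_eq_square)
  qed
  have f_lim: "f \<longlonglongrightarrow> 0"
    unfolding f_def
    by (intro tendsto_divide_0[OF tendsto_const] filterlim_at_top_imp_at_infinity
        filterlim_compose[OF sqrt_at_top filterlim_real_sequentially])
  have sums: "(\<lambda>i. f (i + N) - f (Suc (i + N))) sums f N" for N
    using telescope_sums'[OF LIMSEQ_ignore_initial_segment[OF f_lim, of N]] by simp
  have le: "a (i + n) \<le> f (i + (n + k0)) - f (Suc (i + (n + k0)))" for i n
    using order_trans[OF a(2)[of "i + n"] step[of "i + n + k0"]] k0 by (simp add: add.assoc)
  have summ: "summable (\<lambda>i. a (i + n))" for n
    by (rule summable_comparison_test'[OF sums_summable[OF sums[of "n + k0"]], of 0])
      (use a(1) le in \<open>simp add: abs_of_nonneg\<close>)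
  have tail: "(\<Sum>i. a (i + n)) \<le> f (n + k0)" for n
    using suminf_le[OF le summ sums_summable[OF sums]] sums_unique[OF sums[of "n + k0"]] by simp
  obtain d :: nat where d: "4 * K \<le> real d" using real_arch_simple by blast
  \<comment> \<open>The square undoes the root in \<open>f\<close>. The real constant
    \<open>K\<close> enters the algorithm only through the natural number \<open>d\<close>.\<close>
  define A where "A \<epsilon> = (d * nat \<lceil>1 / \<epsilon>\<rceil>)\<^sup>2" for \<epsilon> :: real
  have "(\<Sum>i. a (i + A \<epsilon>)) \<le> \<epsilon>" if "\<epsilon> > 0" for \<epsilon>
  proof -
    define y where "y = nat \<lceil>1 / \<epsilon>\<rceil>"
    have y: "1 / \<epsilon> \<le> real y" unfolding y_def by (rule of_nat_ceiling)
    have "0 < d" using d \<open>0 < K\<close> by (cases d) auto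
    have "0 < y" using y that by (cases y) auto
    have "(\<Sum>i. a (i + A \<epsilon>)) \<le> 4 * K / sqrt (real (A \<epsilon> + k0))" using tail[of "A \<epsilon>"] by (simp add: f_def)
    also have "\<dots> \<le> 4 * K / (real d * real y)"
    proof (intro divide_left_mono)
      show "real d * real y \<le> sqrt (real (A \<epsilon> + k0))"
        by (rule real_le_rsqrt) (simp add: A_def y_def)
    qed (use \<open>0 < K\<close> \<open>0 < d\<close> \<open>0 < y\<close> k0 in auto)
    also have "\<dots> \<le> 1 / real y"
      using d \<open>0 < d\<close> \<open>0 < y\<close> by (simp add: divide_simps)
    also have "\<dots> \<le> \<epsilon>" using y that \<open>0 < y\<close> by (simp add: divide_simps mult.commute)
    finally show ?thesis .
  qed
  moreover have "recursive (\<lambda>k. A (pos_rat_number k))"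
  proof -
    have "recursive (\<lambda>k. nat \<lceil>1 / pos_rat_number k\<rceil>)"
    proof (rule recursive_graph)
      have "y = nat \<lceil>1 / pos_rat_number k\<rceil> \<longleftrightarrow>
        Suc (psnd k) \<le> y * Suc (pfst k) \<and> y * Suc (pfst k) < Suc (psnd k) + Suc (pfst k)" for k y
      proof -
        define p q where "p = real (Suc (pfst k))" and "q = real (Suc (psnd k))"
        have pq: "0 < p" "0 < q" by (auto simp: p_def q_def)
        have e: "1 / pos_rat_number k = q / p"
          by (simp add: pos_rat_number_def prod_decode_eq_pair p_def q_def)
        have "0 \<le> \<lceil>q / p\<rceil>" using pq by (simp add: le_ceiling_iff order_less_le_trans[OF _ divide_nonneg_nonneg])
        then have "y = nat \<lceil>q / p\<rceil> \<longleftrightarrow> int y = \<lceil>q / p\<rceil>" by auto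
        also have "\<dots> \<longleftrightarrow> real y - 1 < q / p \<and> q / p \<le> real y" by (auto simp: ceiling_eq_iff eq_commute[of "int y"])
        also have "\<dots> \<longleftrightarrow> q \<le> real y * p \<and> real y * p < q + p"
          using pq by (auto simp: field_simps)
        also have "\<dots> \<longleftrightarrow> Suc (psnd k) \<le> y * Suc (pfst k) \<and> y * Suc (pfst k) < Suc (psnd k) + Suc (pfst k)"
          unfolding p_def q_def of_nat_mult[symmetric] of_nat_add[symmetric] of_nat_le_iff of_nat_less_iff ..
        finally show ?thesis unfolding e .
      qed
      then show "semidecidable2 (\<lambda>k y. y = nat \<lceil>1 / pos_rat_number k\<rceil>)"
        by (simp only:) (intro semidecidable_intros recursive_intros)
    qed
    then show ?thesis unfolding A_def by (intro recursive_intros)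
  qed
  ultimately show ?thesis
    using a(1) summ[of 0] unfolding effectively_summable_def recursive_iff by auto
qed

section \<open>Typical points\<close>

text \<open>A whole path is coded by one number, so the exponent may vary with the argument; this
  gives uniformity in the iterate of \<open>T\<close>.\<close>

lemma semidecidable_relpowp:
  assumes "semidecidable2 R" "recursive n" "recursive i" "recursive b"
  shows "semidecidable (\<lambda>x. (R ^^ n x) (i x) (b x))"
proof -
  have "(R ^^ n) i b \<longleftrightarrow> (\<exists>W. lnth W 0 = i \<and> lnth W n = b \<and> (\<forall>j<n. R (lnth W j) (lnth W (Suc j))))"
    for n i b
  proof
    assume "(R ^^ n) i b"
    then obtain f where f: "f 0 = i" "f n = b" "\<forall>j<n. R (f j) (f (Suc j))"
      unfolding relpowp_fun_conv by blast
    obtain W where W: "\<forall>j<Suc n. lnth W j = f j" using ex_lnth by blast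
    show "\<exists>W. lnth W 0 = i \<and> lnth W n = b \<and> (\<forall>j<n. R (lnth W j) (lnth W (Suc j)))"
      by (rule exI[of _ W]) (use W f in auto)
  qed (auto simp: relpowp_fun_conv)
  then show ?thesis
    by (simp only:)
      (intro semidecidable_intros semidecidable2_subst[OF assms(1)] recursive_intros assms(2-4)[THEN recursive_comp])
qed

lemma constructive_gdelta_iff:
  "constructive_gdelta s G \<longleftrightarrow> (\<exists>E. semidecidable2 E \<and> G = (\<Inter>i. open_of s (E i)))"
proof
  assume "constructive_gdelta s G"
  then obtain U E where "semidecidable2 E" and U: "\<forall>i. U i = open_of s (E i)" "G = (\<Inter>i. U i)"
    unfolding constructive_gdelta_def uniformly_constructive_open_iff by blast
  moreover have "G = (\<Inter>i. open_of s (E i))" using U by simp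
  ultimately show "\<exists>E. semidecidable2 E \<and> G = (\<Inter>i. open_of s (E i))" by blast
next
  assume "\<exists>E. semidecidable2 E \<and> G = (\<Inter>i. open_of s (E i))"
  then obtain E where E: "semidecidable2 E" "G = (\<Inter>i. open_of s (E i))" by blast
  have "uniformly_constructive_open s (\<lambda>i. open_of s (E i))"
    unfolding uniformly_constructive_open_iff using E(1) by blast
  then show "constructive_gdelta s G" unfolding constructive_gdelta_def E(2) by blast
qed

lemma constructive_gdelta_Int:
  assumes "constructive_gdelta s G" "constructive_gdelta s H"
  shows "constructive_gdelta s (G \<inter> H)"
proof -
  obtain E F where E: "semidecidable2 E" "G = (\<Inter>i. open_of s (E i))" and F: "semidecidable2 F" "H = (\<Inter>i. open_of s (F i))"
    using assms unfolding constructive_gdelta_iff by blast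
  define D where "D j b \<longleftrightarrow> pfst j = 0 \<and> E (psnd j) b \<or> 0 < pfst j \<and> F (psnd j) b" for j b
  have D: "D (pair 0 i) = E i" "D (pair (Suc n) i) = F i" for i n by (auto simp: D_def fun_eq_iff)
  have "semidecidable2 D"
    unfolding D_def by (intro semidecidable_intros semidecidable2_subst[OF E(1)] semidecidable2_subst[OF F(1)] recursive_intros)
  moreover have "G \<inter> H = (\<Inter>j. open_of s (D j))"
  proof (intro equalityI subsetI INT_I)
    fix x j assume x: "x \<in> G \<inter> H"
    have "D j = (if pfst j = 0 then E (psnd j) else F (psnd j))" by (auto simp: D_def fun_eq_iff)
    then show "x \<in> open_of s (D j)" using x E(2) F(2) by auto
  next
    fix x assume x: "x \<in> (\<Inter>j. open_of s (D j))"
    have "x \<in> open_of s (D (pair 0 i))" "x \<in> open_of s (D (pair (Suc 0) i))" for i using x by blast+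
    then show "x \<in> G \<inter> H" unfolding D E(2) F(2) by blast
  qed
  ultimately show ?thesis unfolding constructive_gdelta_iff by blast
qed

lemma computable_onE:
  assumes "computable_on s t f H" "G \<subseteq> H"
  obtains E where "semidecidable2 E" "\<And>x i. x \<in> G \<Longrightarrow> f x \<in> ideal_ball t i \<longleftrightarrow> x \<in> open_of s (E i)"
proof -
  obtain E where "semidecidable2 E" and E: "\<forall>i. f -` ideal_ball t i \<inter> H = open_of s (E i) \<inter> H"
  proof -
    obtain U E where U: "\<forall>i. f -` ideal_ball t i \<inter> H = U i \<inter> H" and E: "semidecidable2 E" "\<forall>i. U i = open_of s (E i)"
      using assms(1) unfolding computable_on_def uniformly_constructive_open_iff by blast
    have "\<forall>i. f -` ideal_ball t i \<inter> H = open_of s (E i) \<inter> H" using U E(2) by simp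
    with E(1) that show ?thesis by blast
  qed
  moreover have "f x \<in> ideal_ball t i \<longleftrightarrow> x \<in> open_of s (E i)" if "x \<in> G" for x i
    using that assms(2) E[rule_format, of i] by blast
  ultimately show ?thesis using that by blast
qed

locale computable_observable = cps s M + ln2_ergodic_observable M T \<phi> c
  for s :: "nat \<Rightarrow> 'a::metric_space" and M :: "'a measure" and T \<phi> c +
  fixes G :: "'a set" and D ET E\<phi> :: "nat \<Rightarrow> nat \<Rightarrow> bool" and B :: real
  assumes D: "semidecidable2 D" and G: "G = (\<Inter>i. open_of s (D i))" and G_full: "prob G = 1"
    and ET: "semidecidable2 ET" "\<And>x i. x \<in> G \<Longrightarrow> T x \<in> ideal_ball s i \<longleftrightarrow> x \<in> open_of s (ET i)"
    and E\<phi>: "semidecidable2 E\<phi>" "\<And>x i. x \<in> G \<Longrightarrow> \<phi> x \<in> ideal_ball rat_number i \<longleftrightarrow> x \<in> open_of s (E\<phi> i)"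
    and bounded: "\<And>x. \<bar>\<phi> x\<bar> \<le> B"
begin

section \<open>Preimages under iterates and the set of good orbits\<close>

text \<open>\<open>ET i b\<close> says that ball \<open>b\<close> belongs to the code of the
  preimage of ball \<open>i\<close>, so relational powers lead from a target ball back to a code of
  its preimage under an iterate.\<close>

definition pull :: "nat \<Rightarrow> (nat \<Rightarrow> bool) \<Rightarrow> nat \<Rightarrow> bool" where
  "pull n P b \<longleftrightarrow> (\<exists>i. P i \<and> (ET ^^ n) i b)"

text \<open>Only the iterates before the \<open>n\<close>-th must lie in \<open>G\<close>, since
  each backward step applies \<open>T\<close> to one of them. The strict bound lets
  \<open>orbit_in_G_eq\<close> derive membership of the \<open>n\<close>-th iterate by strong
  induction.\<close>

lemma open_of_pull:
  assumes "\<And>j. j < n \<Longrightarrow> (T ^^ j) x \<in> G"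
  shows "x \<in> open_of s (pull n P) \<longleftrightarrow> (T ^^ n) x \<in> open_of s P"
proof -
  have "x \<in> open_of s ((ET ^^ n) i) \<longleftrightarrow> (T ^^ n) x \<in> ideal_ball s i" for i
    using assms
  proof (induction n arbitrary: x)
    case 0 show ?case by (auto simp: open_of_def)
  next
    case (Suc n)
    have "x \<in> G" using Suc.prems[of 0] by simp
    have IH: "T x \<in> open_of s ((ET ^^ n) i) \<longleftrightarrow> (T ^^ n) (T x) \<in> ideal_ball s i"
      by (rule Suc.IH) (use Suc.prems[of "Suc _"] in \<open>simp add: funpow_swap1\<close>)
    have "x \<in> open_of s ((ET ^^ Suc n) i) \<longleftrightarrow> (\<exists>b. (ET ^^ n) i b \<and> x \<in> open_of s (ET b))"
      by (auto simp: open_of_def relcompp_apply)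
    also have "\<dots> \<longleftrightarrow> (\<exists>b. (ET ^^ n) i b \<and> T x \<in> ideal_ball s b)"
      using ET(2)[OF \<open>x \<in> G\<close>] by simp
    also have "\<dots> \<longleftrightarrow> T x \<in> open_of s ((ET ^^ n) i)" by (auto simp: open_of_def)
    finally show ?case using IH by (simp add: funpow_swap1)
  qed
  note * = this
  have "x \<in> open_of s (pull n P) \<longleftrightarrow> (\<exists>i. P i \<and> x \<in> open_of s ((ET ^^ n) i))"
    by (auto simp: open_of_def pull_def)
  also have "\<dots> \<longleftrightarrow> (\<exists>i. P i \<and> (T ^^ n) x \<in> ideal_ball s i)" by (simp only: *)
  also have "\<dots> \<longleftrightarrow> (T ^^ n) x \<in> open_of s P" by (auto simp: open_of_def)
  finally show ?thesis .
qed

lemma semidecidable_pull: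
  assumes P: "semidecidable2 P" and "recursive n" "recursive i" "recursive b"
  shows "semidecidable (\<lambda>x. pull (n x) (P (i x)) (b x))"
  unfolding pull_def
  by (intro semidecidable_intros semidecidable2_subst[OF P] semidecidable_relpowp[OF ET(1)] recursive_intros assms(2-4)[THEN recursive_comp])

definition orbit_in_G :: "'a set" where "orbit_in_G = {x. \<forall>n. (T ^^ n) x \<in> G}"

definition orbit_code :: "nat \<Rightarrow> nat \<Rightarrow> bool" where "orbit_code i = pull (pfst i) (D (psnd i))"

lemma orbit_in_G_eq: "orbit_in_G = (\<Inter>i. open_of s (orbit_code i))"
proof (intro equalityI subsetI INT_I)
  fix x i assume "x \<in> orbit_in_G"
  then show "x \<in> open_of s (orbit_code i)"
    unfolding orbit_code_def
  proof (subst open_of_pull)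
    show "(T ^^ pfst i) x \<in> open_of s (D (psnd i))"
      using \<open>x \<in> orbit_in_G\<close> unfolding orbit_in_G_def using G by blast
  qed (simp add: orbit_in_G_def)
next
  fix x assume x: "x \<in> (\<Inter>i. open_of s (orbit_code i))"
  have "(T ^^ n) x \<in> G" for n
  proof (induction n rule: less_induct)
    case (less n)
    have "x \<in> open_of s (orbit_code (pair n j))" for j using x by blast
    then have "x \<in> open_of s (pull n (D j))" for j by (simp add: orbit_code_def)
    then show ?case unfolding G using open_of_pull[OF less] by blast
  qed
  then show "x \<in> orbit_in_G" by (simp add: orbit_in_G_def)
qed

lemma sets_orbit_in_G [simp]: "orbit_in_G \<in> sets borel"
  unfolding orbit_in_G_eq by (intro sets.countable_INT'') auto

lemma prob_orbit_in_G: "prob orbit_in_G = 1"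
proof -
  have sG: "G \<in> sets M" unfolding G sets_M by (intro sets.countable_INT'') auto
  have "AE x in M. (T ^^ n) x \<in> G" for n
  proof -
    have "AE x in distr M M (T ^^ n). x \<in> G"
      unfolding distr_funpow[OF T inv] using G_full sG by (simp add: AE_in_set_eq_1)
    then show ?thesis using measurable_funpow[OF T] sG by (subst (asm) AE_distr_iff) auto
  qed
  then have "AE x in M. x \<in> orbit_in_G" unfolding orbit_in_G_def by (simp add: AE_all_countable)
  then show ?thesis by (subst (asm) AE_in_set_eq_1) auto
qed

text \<open>Codes of events are faithful only on \<open>orbit_in_G\<close>; this transfers estimates
  of their probabilities to the whole space.\<close>

lemma prob_Int_orbit_in_G: "A \<in> sets borel \<Longrightarrow> prob (A \<inter> orbit_in_G) = prob A"
proof -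
  assume "A \<in> sets borel"
  moreover have "AE x in M. x \<in> orbit_in_G" using prob_orbit_in_G by (subst AE_in_set_eq_1) auto
  ultimately show ?thesis by (intro finite_measure_eq_AE) auto
qed

section \<open>Events of small deviation\<close>

text \<open>The witness \<open>l\<close> lists rational approximations to \<open>\<phi>\<close>
  along the orbit with error below \<open>1 / (d + 1)\<close>, the radius numbered
  \<open>pair 0 d\<close>. Their mean must be closer to the target than the tolerance by that error.
  Inequalities are multiplied by the time so that no division occurs.\<close>

definition near :: "nat \<Rightarrow> nat \<Rightarrow> nat \<Rightarrow> bool" where
  "near k q b \<longleftrightarrow> (\<exists>l d.
     family_inter s {..<sample_time k} (\<lambda>j. pull j (E\<phi> (pair (lnth l j) (pair 0 d)))) b \<and>
     (\<Sum>j<sample_time k. rat_number (lnth l j)) - real (sample_time k) * rat_number q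
       < real (sample_time k) * (tolerance k - 1 / real (Suc d)) \<and>
     real (sample_time k) * rat_number q - (\<Sum>j<sample_time k. rat_number (lnth l j))
       < real (sample_time k) * (tolerance k - 1 / real (Suc d)))"

lemma semidecidable_near:
  assumes "recursive k" "recursive q" "recursive b" shows "semidecidable (\<lambda>x. near (k x) (q x) (b x))"
  unfolding near_def tolerance_def
  by (intro semidecidable_intros semidecidable_family_inter semidecidable_pull E\<phi>(1) rat_fun_intros rat_fun_sum recursive_intros
      recursive_comp[OF recursive_sample_time] recursive_comp[OF recursive_eighth_root] assms[THEN recursive_comp])

lemma open_of_near:
  assumes "x \<in> orbit_in_G"
  shows "x \<in> open_of s (near k q) \<longleftrightarrow> \<bar>time_average T \<phi> (sample_time k) x - rat_number q\<bar> < tolerance k"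
proof -
  define N where "N = sample_time k"
  have N: "0 < real N" using sample_time_ge(1)[of k] by (simp add: N_def)
  define A where "A = (\<Sum>j<N. \<phi> ((T ^^ j) x))"
  have avg: "time_average T \<phi> N x = A / real N" by (simp add: time_average_def A_def)
  define L where "L l = (\<Sum>j<N. rat_number (lnth l j))" for l
  have "x \<in> open_of s (near k q) \<longleftrightarrow> (\<exists>l d.
      x \<in> open_of s (family_inter s {..<N} (\<lambda>j. pull j (E\<phi> (pair (lnth l j) (pair 0 d))))) \<and>
      \<bar>L l - real N * rat_number q\<bar> < real N * (tolerance k - 1 / real (Suc d)))"
    unfolding near_def N_def L_def abs_less_iff open_of_def by auto
  also have "\<dots> \<longleftrightarrow> (\<exists>l d. (\<forall>j<N. \<bar>\<phi> ((T ^^ j) x) - rat_number (lnth l j)\<bar> < 1 / real (Suc d)) \<and>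
      \<bar>L l - real N * rat_number q\<bar> < real N * (tolerance k - 1 / real (Suc d)))"
  proof -
    have "x \<in> open_of s (pull j (E\<phi> (pair c (pair 0 d)))) \<longleftrightarrow> \<bar>\<phi> ((T ^^ j) x) - rat_number c\<bar> < 1 / real (Suc d)"
      for j c d
    proof -
      have "x \<in> open_of s (pull j (E\<phi> (pair c (pair 0 d)))) \<longleftrightarrow> (T ^^ j) x \<in> open_of s (E\<phi> (pair c (pair 0 d)))"
        using assms by (intro open_of_pull) (simp add: orbit_in_G_def)
      also have "\<dots> \<longleftrightarrow> \<phi> ((T ^^ j) x) \<in> ideal_ball rat_number (pair c (pair 0 d))"
        using assms by (intro E\<phi>(2)[symmetric]) (simp add: orbit_in_G_def)
      also have "\<dots> \<longleftrightarrow> \<bar>\<phi> ((T ^^ j) x) - rat_number c\<bar> < 1 / real (Suc d)"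
        by (simp add: ideal_ball_eq ball_radius_def pos_rat_number_def prod_decode_eq_pair dist_real_def abs_minus_commute)
      finally show ?thesis .
    qed
    then show ?thesis by (simp only: open_of_family_inter[OF finite_lessThan] INT_iff Ball_def lessThan_iff)
  qed
  also have "\<dots> \<longleftrightarrow> \<bar>A - real N * rat_number q\<bar> < real N * tolerance k"
  proof
    assume "\<exists>l d. (\<forall>j<N. \<bar>\<phi> ((T ^^ j) x) - rat_number (lnth l j)\<bar> < 1 / real (Suc d)) \<and>
      \<bar>L l - real N * rat_number q\<bar> < real N * (tolerance k - 1 / real (Suc d))"
    then obtain l d where j: "\<forall>j<N. \<bar>\<phi> ((T ^^ j) x) - rat_number (lnth l j)\<bar> < 1 / real (Suc d)"
      and L: "\<bar>L l - real N * rat_number q\<bar> < real N * (tolerance k - 1 / real (Suc d))" by blast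
    have "\<bar>A - L l\<bar> \<le> (\<Sum>j<N. 1 / real (Suc d))"
      unfolding A_def L_def sum_subtractf[symmetric]
      by (rule order_trans[OF sum_abs sum_mono]) (use j in \<open>auto intro: less_imp_le\<close>)
    then have "\<bar>A - L l\<bar> \<le> real N * (1 / real (Suc d))" by simp
    then show "\<bar>A - real N * rat_number q\<bar> < real N * tolerance k" using L by (simp add: right_diff_distrib abs_le_iff abs_less_iff)
  next
    assume A: "\<bar>A - real N * rat_number q\<bar> < real N * tolerance k"
    \<comment> \<open>Half the slack per term: the approximation error is spent twice, in replacing
      \<open>A\<close> by \<open>L l\<close> and in the reduced tolerance.\<close>
    define e where "e = (real N * tolerance k - \<bar>A - real N * rat_number q\<bar>) / (2 * real N)"
    have e: "2 * (real N * e) = real N * tolerance k - \<bar>A - real N * rat_number q\<bar>" "0 < e"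
      using A N by (auto simp: e_def)
    obtain d where d: "1 / real (Suc d) < e" using nat_approx_posE[OF e(2)] by auto
    have "\<exists>c. \<bar>\<phi> ((T ^^ j) x) - rat_number c\<bar> < 1 / real (Suc d)" for j
    proof -
      obtain c where "\<phi> ((T ^^ j) x) - 1 / real (Suc d) < rat_number c" "rat_number c < \<phi> ((T ^^ j) x) + 1 / real (Suc d)"
        by (rule rat_number_between[of "\<phi> ((T ^^ j) x) - 1 / real (Suc d)" "\<phi> ((T ^^ j) x) + 1 / real (Suc d)"]) auto
      then show ?thesis by (intro exI[of _ c]) (simp add: abs_less_iff)
    qed
    then obtain C where C: "\<And>j. \<bar>\<phi> ((T ^^ j) x) - rat_number (C j)\<bar> < 1 / real (Suc d)" by metis
    obtain l where l: "\<forall>j<N. lnth l j = C j" using ex_lnth by blast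
    have "\<bar>A - L l\<bar> \<le> (\<Sum>j<N. 1 / real (Suc d))"
      unfolding A_def L_def sum_subtractf[symmetric]
      by (rule order_trans[OF sum_abs sum_mono]) (use C l in \<open>auto intro: less_imp_le\<close>)
    then have AL: "\<bar>A - L l\<bar> \<le> real N * (1 / real (Suc d))" by simp
    have "real N * (1 / real (Suc d)) < real N * e" using d N by (intro mult_strict_left_mono)
    then have "\<bar>L l - real N * rat_number q\<bar> < real N * tolerance k - real N * (1 / real (Suc d))"
      using AL e(1) by linarith
    then show "\<exists>l d. (\<forall>j<N. \<bar>\<phi> ((T ^^ j) x) - rat_number (lnth l j)\<bar> < 1 / real (Suc d)) \<and>
      \<bar>L l - real N * rat_number q\<bar> < real N * (tolerance k - 1 / real (Suc d))"
      using C l by (intro exI[of _ l] exI[of _ d]) (auto simp: right_diff_distrib)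
  qed
  also have "\<dots> \<longleftrightarrow> \<bar>A / real N - rat_number q\<bar> < tolerance k"
  proof -
    have "A - real N * rat_number q = real N * (A / real N - rat_number q)" using N by (simp add: right_diff_distrib)
    then show ?thesis using N by (simp add: abs_mult)
  qed
  finally show ?thesis by (simp add: avg flip: N_def)
qed

text \<open>
  The mean \<open>m\<close> need not be computed: a rational \<open>q\<close> such that the average is within the tolerance
  of \<open>q\<close> with probability more than \<open>1/2\<close> is automatically close to \<open>m\<close>, and this condition on
  \<open>q\<close> is semidecidable.
\<close>

definition concentrated :: "nat \<Rightarrow> nat \<Rightarrow> bool" where
  "concentrated k b \<longleftrightarrow> (\<exists>q. pos_rat_number (pair 0 1) < prob (open_of s (near k q)) \<and> near k q b)"

lemma pos_rat_number_half: "pos_rat_number (pair 0 1) = 1/2"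
  by (simp add: pos_rat_number_def prod_decode_eq_pair)

lemma semidecidable_concentrated:
  assumes "recursive k" "recursive b" shows "semidecidable (\<lambda>x. concentrated (k x) (b x))"
proof -
  have "semidecidable2 (\<lambda>e. near (pfst e) (psnd e))" by (intro semidecidable_near recursive_intros)
  then have "semidecidable2 (\<lambda>e r. pos_rat_number r < prob (open_of s (near (pfst e) (psnd e))))"
    by (rule semidecidable_measure_open_of)
  then have *: "semidecidable (\<lambda>x. pos_rat_number (r x) < prob (open_of s (near (k x) (q x))))"
    if "recursive k" "recursive q" "recursive r" for k q r
    using semidecidable2_subst[of _ "\<lambda>x. pair (k x) (q x)" r] that by (force intro: recursive_intros)
  show ?thesis unfolding concentrated_def
    by (intro semidecidable_intros * semidecidable_near recursive_intros assms[THEN recursive_comp])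
qed

abbreviation "bad k \<equiv> {x. tolerance k / 2 \<le> \<bar>time_average T \<phi> (sample_time k) x - m\<bar>}"

lemma sets_bad [measurable]: "bad k \<in> sets M"
proof -
  have "{x \<in> space M. tolerance k / 2 \<le> \<bar>time_average T \<phi> (sample_time k) x - m\<bar>} \<in> sets M" by measurable
  then show ?thesis by simp
qed

text \<open>An event of probability above 1/2 cannot be contained in a bad one of probability at
  most 1/4, so some \<open>y\<close> is near \<open>q\<close> and good. Passing from
  \<open>x\<close> to \<open>q\<close>, to the average at \<open>y\<close>, to \<open>m\<close>
  costs less than \<open>1 + 1 + 1/2\<close> tolerances.\<close>

lemma concentrated_imp_close:
  assumes "prob (bad k) \<le> 1/4" "x \<in> orbit_in_G" "x \<in> open_of s (concentrated k)"
  shows "\<bar>time_average T \<phi> (sample_time k) x - m\<bar> \<le> 3 * tolerance k"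
proof -
  obtain q where q: "1/2 < prob (open_of s (near k q))" "x \<in> open_of s (near k q)"
    using assms(3) unfolding open_of_def concentrated_def pos_rat_number_half by blast
  have "\<exists>y\<in>open_of s (near k q) \<inter> orbit_in_G. y \<notin> bad k"
  proof (rule ccontr)
    assume "\<not> ?thesis"
    then have "open_of s (near k q) \<inter> orbit_in_G \<subseteq> bad k" by blast
    then have "prob (open_of s (near k q) \<inter> orbit_in_G) \<le> prob (bad k)"
      by (rule finite_measure_mono) (rule sets_bad)
    then show False using q(1) assms(1) by (simp add: prob_Int_orbit_in_G)
  qed
  then obtain y where "y \<in> orbit_in_G" "y \<in> open_of s (near k q)"
    "\<bar>time_average T \<phi> (sample_time k) y - m\<bar> < tolerance k / 2" by force
  then have "\<bar>time_average T \<phi> (sample_time k) y - rat_number q\<bar> < tolerance k"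
    "\<bar>time_average T \<phi> (sample_time k) x - rat_number q\<bar> < tolerance k"
    "\<bar>time_average T \<phi> (sample_time k) y - m\<bar> < tolerance k / 2"
    using open_of_near assms(2) q(2) by auto
  then show ?thesis by linarith
qed

text \<open>Any rational \<open>q\<close> within half the tolerance of \<open>m\<close> works: every
  good point of \<open>orbit_in_G\<close> is then near \<open>q\<close>, and these have probability
  at least 3/4.\<close>

lemma close_imp_concentrated:
  assumes "prob (bad k) \<le> 1/4" "x \<in> orbit_in_G" "x \<notin> bad k"
  shows "x \<in> open_of s (concentrated k)"
proof -
  obtain q where "m - tolerance k / 2 < rat_number q" "rat_number q < m + tolerance k / 2"
    by (rule rat_number_between[of "m - tolerance k / 2" "m + tolerance k / 2"]) (use tolerance_pos[of k] in auto)
  then have q: "\<bar>m - rat_number q\<bar> < tolerance k / 2" by linarith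
  have sub: "y \<in> open_of s (near k q)" if "y \<in> - bad k \<inter> orbit_in_G" for y
  proof (subst open_of_near)
    show "y \<in> orbit_in_G" using that by blast
    have "\<bar>time_average T \<phi> (sample_time k) y - m\<bar> < tolerance k / 2" using that by simp
    then show "\<bar>time_average T \<phi> (sample_time k) y - rat_number q\<bar> < tolerance k" using q by linarith
  qed
  have "3/4 \<le> prob (- bad k)" using assms(1) prob_compl[OF sets_bad[of k]] by (simp add: Compl_eq_Diff_UNIV)
  also have "\<dots> = prob (- bad k \<inter> orbit_in_G)"
    using sets_bad[of k] by (intro prob_Int_orbit_in_G[symmetric]) auto
  also have "\<dots> \<le> prob (open_of s (near k q))" using sub by (intro finite_measure_mono) auto
  finally have "1/2 < prob (open_of s (near k q))" by simp
  moreover have "x \<in> open_of s (near k q)" using sub assms by auto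
  ultimately show ?thesis unfolding open_of_def concentrated_def pos_rat_number_half by blast
qed

section \<open>The Borel--Cantelli set of typical points\<close>

theorem borel_cantelli_typical_points:
  "\<exists>C. constructive_borel_cantelli s M C \<and> C \<subseteq> typical_points M T \<phi>"
proof -
  \<comment> \<open>From \<open>k0\<close> on, the bound \<open>256 * var_bound / k\<close> is at
    most 1/4, the bad probability allowed in the comparison of \<open>concentrated\<close> with
    closeness.\<close>
  obtain k0 :: nat where k0: "1024 * var_bound \<le> real k0" "1 \<le> k0"
    using real_arch_simple[of "max 1 (1024 * var_bound)"] by auto
  have bad_le: "prob (bad k) \<le> 256 * var_bound / (real k * sqrt (real k))" if "k0 \<le> k" for k
    using sample_deviation_le[of k] k0(2) that by simp
  have bad_quarter: "prob (bad k) \<le> 1/4" if "k0 \<le> k" for k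
  proof -
    have "1 \<le> real k" using k0(2) that by simp
    then have "real k * 1 \<le> real k * sqrt (real k)" by (intro mult_left_mono) auto
    then have "256 * var_bound / (real k * sqrt (real k)) \<le> 256 * var_bound / real k"
      using \<open>1 \<le> real k\<close> var_bound_pos by (intro divide_left_mono) auto
    also have "\<dots> \<le> 1/4" using k0(1) that \<open>1 \<le> real k\<close> by (simp add: divide_le_eq)
    finally show ?thesis using bad_le[OF that] by simp
  qed
  \<comment> \<open>Each open set imposes only finitely many stages of \<open>orbit_in_G\<close>, to
    remain open; lying in all but finitely many of the sets still imposes every stage.\<close>
  define P where "P k i b \<longleftrightarrow> i = 0 \<and> concentrated (k + k0) b \<or> 0 < i \<and> orbit_code (i - 1) b" for k i b
  define U where "U k = open_of s (family_inter s {..<Suc k} (P k))" for k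
  have U: "U k = open_of s (concentrated (k + k0)) \<inter> (\<Inter>i<k. open_of s (orbit_code i))" for k
  proof -
    have "P k 0 = concentrated (k + k0)" "P k (Suc i) = orbit_code i" for i
      by (auto simp: P_def fun_eq_iff)
    then show ?thesis
      unfolding U_def open_of_family_inter[OF finite_lessThan]
      by (simp add: lessThan_Suc_eq_insert_0)
  qed
  have "semidecidable2 (\<lambda>k. family_inter s {..<Suc k} (P k))"
    unfolding P_def orbit_code_def
    by (intro semidecidable_family_inter semidecidable_intros semidecidable_concentrated semidecidable_pull D recursive_intros)
  then have "uniformly_constructive_open s U"
    unfolding uniformly_constructive_open_iff U_def
    by (intro exI[of _ "\<lambda>k. family_inter s {..<Suc k} (P k)"]) simp
  moreover have "effectively_summable (\<lambda>n. prob (- U n))"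
  proof (rule effectively_summableI)
    fix n
    have "- U n \<inter> orbit_in_G \<subseteq> bad (n + k0)"
      using close_imp_concentrated[OF bad_quarter[of "n + k0"]] by (auto simp: U orbit_in_G_eq)
    then have "prob (- U n \<inter> orbit_in_G) \<le> prob (bad (n + k0))"
      by (rule finite_measure_mono) (rule sets_bad)
    also have "prob (- U n \<inter> orbit_in_G) = prob (- U n)"
      by (intro prob_Int_orbit_in_G) (auto simp: U_def)
    finally show "prob (- U n) \<le> 256 * var_bound / (real (n + k0) * sqrt (real (n + k0)))"
      using bad_le[of "n + k0"] by simp
  qed (use k0 var_bound_pos in auto)
  moreover have "(\<Union>k. \<Inter>n\<in>{k..}. U n) \<subseteq> typical_points M T \<phi>"
  proof
    fix x assume "x \<in> (\<Union>k. \<Inter>n\<in>{k..}. U n)"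
    then obtain j where j: "\<And>n. j \<le> n \<Longrightarrow> x \<in> U n" by auto
    have "x \<in> open_of s (orbit_code i)" for i
      using j[of "max j (Suc i)"] by (auto simp: U)
    then have orbit: "x \<in> orbit_in_G" by (simp add: orbit_in_G_eq)
    have "(\<lambda>n. time_average T \<phi> n x) \<longlonglongrightarrow> m"
    proof (rule time_average_tendsto[OF bounded])
      fix k assume k: "j + k0 \<le> k"
      then have "x \<in> open_of s (concentrated k)" using j[of "k - k0"] by (simp add: U)
      with k orbit show "\<bar>time_average T \<phi> (sample_time k) x - m\<bar> \<le> 3 * tolerance k"
        by (intro concentrated_imp_close bad_quarter) auto
    qed
    then show "x \<in> typical_points M T \<phi>" by (simp add: typical_points_def time_average_def)
  qed
  ultimately show ?thesis unfolding constructive_borel_cantelli_def by blast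
qed

end

theorem corollary2:
  fixes s :: "nat \<Rightarrow> 'a::metric_space"
    and M :: "'a measure"
    and T :: "'a \<Rightarrow> 'a"
    and \<B> :: "('a \<Rightarrow> real) set"
    and \<phi> :: "'a \<Rightarrow> real"
  assumes "computable_prob_space s M"
    and "ae_computable s M s T"
    and "measure_preserving_map M T"
    and "\<forall>\<psi>\<in>\<B>. bounded (range \<psi>)"
    and "ln2_ergodic M T \<B>"
    and "\<phi> \<in> \<B>"
    and "ae_computable s M rat_number \<phi>"
  shows "(\<exists>C. constructive_borel_cantelli s M C \<and> C \<subseteq> typical_points M T \<phi>) \<and>
         (Topological_Spaces.complete (UNIV :: 'a set) \<longrightarrow> (\<exists>x \<in> typical_points M T \<phi>. computable_point s x))"
proof -
  interpret cps s M by unfold_locales fact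
  obtain GT where GT: "constructive_gdelta s GT" "prob GT = 1" "computable_on s s T GT"
    using assms(2) unfolding ae_computable_def by blast
  obtain G\<phi> where G\<phi>: "constructive_gdelta s G\<phi>" "prob G\<phi> = 1" "computable_on s rat_number \<phi> G\<phi>"
    using assms(7) unfolding ae_computable_def by blast
  \<comment> \<open>One common domain, again a constructive G-delta of full measure, on which both
    \<open>T\<close> and \<open>\<phi>\<close> are computable.\<close>
  obtain D where D: "semidecidable2 D" "GT \<inter> G\<phi> = (\<Inter>i. open_of s (D i))"
    using constructive_gdelta_Int[OF GT(1) G\<phi>(1)] unfolding constructive_gdelta_iff by blast
  obtain ET where ET: "semidecidable2 ET" "\<And>x i. x \<in> GT \<inter> G\<phi> \<Longrightarrow> T x \<in> ideal_ball s i \<longleftrightarrow> x \<in> open_of s (ET i)"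
    by (rule computable_onE[OF GT(3) Int_lower1]) blast
  obtain E\<phi> where E\<phi>: "semidecidable2 E\<phi>" "\<And>x i. x \<in> GT \<inter> G\<phi> \<Longrightarrow> \<phi> x \<in> ideal_ball rat_number i \<longleftrightarrow> x \<in> open_of s (E\<phi> i)"
    by (rule computable_onE[OF G\<phi>(3) Int_lower2]) blast
  have sets: "GT \<in> sets M" "G\<phi> \<in> sets M"
    using GT(1) G\<phi>(1) unfolding constructive_gdelta_iff by (auto intro!: sets.countable_INT'')
  have "prob (GT \<inter> G\<phi>) = 1"
    using sets GT(2) G\<phi>(2) by (simp add: AE_in_set_eq_1[symmetric] sets.Int)
  have "bounded (range \<phi>)" using assms(4,6) by blast
  then obtain B where B: "\<And>x. \<bar>\<phi> x\<bar> \<le> B" unfolding bounded_real by blast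
  obtain c where c: "0 < c" "\<And>n. n \<ge> 2 \<Longrightarrow>
      \<bar>(\<Sum>i<n. \<integral>x. \<phi> ((T ^^ i) x) * \<phi> x \<partial>M) / real n - (\<integral>x. \<phi> x \<partial>M) * (\<integral>x. \<phi> x \<partial>M)\<bar>
        \<le> c / (ln (real n))\<^sup>2"
    and int: "integrable M \<phi>" "\<And>i. integrable M (\<lambda>x. \<phi> ((T ^^ i) x) * \<phi> x)"
    using assms(5,6) unfolding ln2_ergodic_def by blast
  interpret computable_observable s M T \<phi> c "GT \<inter> G\<phi>" D ET E\<phi> B
    by unfold_locales
      (use assms(3) c int D ET E\<phi> B \<open>prob (GT \<inter> G\<phi>) = 1\<close> in \<open>auto simp: measure_preserving_map_def\<close>)
  obtain C where C: "constructive_borel_cantelli s M C" "C \<subseteq> typical_points M T \<phi>"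
    using borel_cantelli_typical_points by blast
  show ?thesis
  proof (intro conjI impI)
    show "\<exists>C. constructive_borel_cantelli s M C \<and> C \<subseteq> typical_points M T \<phi>"
      by (rule borel_cantelli_typical_points)
    assume "Topological_Spaces.complete (UNIV :: 'a set)"
    from borel_cantelli_computable_point[OF C(1) this] C(2)
    show "\<exists>x \<in> typical_points M T \<phi>. computable_point s x" by (elim bexE) (rule bexI, assumption, erule subsetD)
  qed
qed

end
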